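(* Let $T^2$ be the $2$-torus and let $f\in\mathcal{F}(T^2,\mathbb{R})$ be such that its Kronrod-Reeb graph $\Gamma(f)$ is a tree. Then there exists a unique vertex $v$ of $\Gamma(f)$ such that the complement $T^2\setminus p_f^{-1}(v)$ is a disjoint union of open $2$-disks.
   Context: Class $\mathcal{F}$. For a smooth closed oriented surface $M$, $\mathcal{F}(M,\mathbb{R})$ is the set of all $f\in C^\infty(M,\mathbb{R})$ such that for each critical point $z$ of $f$ the germ of $f$ at $z$ is smoothly equivalent to some (nonzero) homogeneous polynomial $\mathbb{R}^2\to\mathbb{R}$ without multiple factors (over $\mathbb{R}$). Two germs of smooth functions $f,g:(\mathbb{R}^2,0)\to(\mathbb{R},0)$ are smoothly equivalent if there are germs of diffeomorphisms $h:(\mathbb{R}^2,0)\to(\mathbb{R}^2,0)$ and $\phi:(\mathbb{R},0)\to(\mathbb{R},0)$ with $\phi\circ g=f\circ h$; the germ of $f$ at a critical point $z$ is regarded as such a germ via a local chart centered at $z$ and after subtracting $f(z)$. Graph of $f$. A connected component of a level set $f^{-1}(t)$, $t\in\mathbb{R}$, is called critical if it contains a critical point of $f$, and regular otherwise. The Kronrod-Reeb graph $\Gamma(f)$ is the quotient space of $M$ by the partition into connected components of level sets of $f$, and $p_f:M\to\Gamma(f)$ is the quotient map. It is a finite one-dimensional CW-complex: its vertices are the critical components of level sets of $f$, and its open edges correspond to the connected components of the complement in $M$ of the union of all critical components. *)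

theory Defs
  imports "HOL-Analysis.Analysis" "HOL-Computational_Algebra.Squarefree"
    "HOL-Computational_Algebra.Polynomial"
begin

section \<open>Smooth maps and smooth equivalence of germs\<close>

text \<open>Meant for open \<open>S\<close> only: \<open>frechet_derivative f (at x)\<close> looks at a full neighbourhood of \<open>x\<close>.\<close>

fun diff_k_on :: "nat \<Rightarrow> 'a::real_normed_vector set \<Rightarrow> ('a \<Rightarrow> 'b::real_normed_vector) \<Rightarrow> bool" where
  "diff_k_on 0 S f \<longleftrightarrow> continuous_on S f"
| "diff_k_on (Suc k) S f \<longleftrightarrow>
     (\<forall>x\<in>S. f differentiable (at x)) \<and>
     (\<forall>v. diff_k_on k S (\<lambda>x. frechet_derivative f (at x) v))"

definition smooth_on :: "'a::real_normed_vector set \<Rightarrow> ('a \<Rightarrow> 'b::real_normed_vector) \<Rightarrow> bool" where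
  "smooth_on S f \<longleftrightarrow> (\<forall>k. diff_k_on k S f)"

text \<open>Germs at the origin are represented by total functions, of which only the values near
  \<open>0\<close> are relevant.\<close>

definition smooth_germ :: "('a::real_normed_vector \<Rightarrow> 'b::real_normed_vector) \<Rightarrow> bool" where
  "smooth_germ f \<longleftrightarrow> f 0 = 0 \<and> (\<exists>U. open U \<and> 0 \<in> U \<and> smooth_on U f)"

definition diffeo_germ :: "('a::real_normed_vector \<Rightarrow> 'a) \<Rightarrow> bool" where
  "diffeo_germ h \<longleftrightarrow> h 0 = 0 \<and>
     (\<exists>U V k. open U \<and> 0 \<in> U \<and> open V \<and> homeomorphism U V h k \<and> smooth_on U h \<and> smooth_on V k)"

definition smoothly_equivalent :: "(real \<times> real \<Rightarrow> real) \<Rightarrow> (real \<times> real \<Rightarrow> real) \<Rightarrow> bool" where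
  "smoothly_equivalent f g \<longleftrightarrow> smooth_germ f \<and> smooth_germ g \<and>
     (\<exists>h \<phi>. diffeo_germ h \<and> diffeo_germ \<phi> \<and>
        eventually (\<lambda>x. \<phi> (g x) = f (h x)) (nhds 0))"

section \<open>Homogeneous polynomials in two variables\<close>

text \<open>\<open>real poly poly\<close> serves as \<open>\<real>[X][Y]\<close>: the outer variable is \<open>Y\<close>, so
  \<open>coeff (coeff P j) i\<close> is the coefficient of \<open>X\<^sup>i Y\<^sup>j\<close>.  Its units are the nonzero constants,
  so \<open>squarefree\<close> means nonzero and without multiple factors over \<open>\<real>\<close>.\<close>

definition poly_fun2 :: "real poly poly \<Rightarrow> real \<times> real \<Rightarrow> real" where
  "poly_fun2 P = (\<lambda>(x, y). poly (poly P [:y:]) x)"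

definition homogeneous2 :: "real poly poly \<Rightarrow> bool" where
  "homogeneous2 P \<longleftrightarrow> (\<exists>n. \<forall>i j. coeff (coeff P j) i \<noteq> 0 \<longrightarrow> i + j = n)"

section \<open>The torus and the class \<open>\<F>\<close>\<close>

definition torus :: "(complex \<times> complex) set" where
  "torus = sphere 0 1 \<times> sphere 0 1"

text \<open>The universal covering of the torus.  Its restrictions to small discs are the inverses of
  the charts of the standard smooth structure.\<close>

definition torus_cover :: "real \<times> real \<Rightarrow> complex \<times> complex" where
  "torus_cover = (\<lambda>(s, t). (cis s, cis t))"

lemma torus_cover_range: "range torus_cover = torus"
proof -
  have "\<exists>s. z = cis s" if "norm z = 1" for z
    using that by (metis complex_norm_eq_1_exp cis_conv_exp)
  then show ?thesis
    by (force simp: torus_def torus_cover_def image_iff)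
qed

definition critical_point :: "(complex \<times> complex \<Rightarrow> real) \<Rightarrow> complex \<times> complex \<Rightarrow> bool" where
  "critical_point f z \<longleftrightarrow>
     (\<exists>p. torus_cover p = z \<and> ((f \<circ> torus_cover) has_derivative (\<lambda>_. 0)) (at p))"

text \<open>The germ at \<open>torus_cover p\<close> is read in the chart inverse to \<open>u \<mapsto> torus_cover (p + u)\<close>.\<close>

definition class_F :: "(complex \<times> complex \<Rightarrow> real) set" where
  "class_F = {f. smooth_on UNIV (f \<circ> torus_cover) \<and>
     (\<forall>p. critical_point f (torus_cover p) \<longrightarrow>
        (\<exists>P. homogeneous2 P \<and> squarefree P \<and>
           smoothly_equivalent (\<lambda>u. f (torus_cover (p + u)) - f (torus_cover p)) (poly_fun2 P)))}"

section \<open>The Kronrod--Reeb graph\<close>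

definition level_components :: "(complex \<times> complex \<Rightarrow> real) \<Rightarrow> (complex \<times> complex) set set" where
  "level_components f = (\<Union>t. components {z \<in> torus. f z = t})"

definition reeb_proj :: "(complex \<times> complex \<Rightarrow> real) \<Rightarrow> complex \<times> complex \<Rightarrow> (complex \<times> complex) set" where
  "reeb_proj f z = connected_component_set {w \<in> torus. f w = f z} z"

lemma reeb_proj_image: "reeb_proj f ` torus = level_components f"
  by (auto simp: reeb_proj_def level_components_def components_def)

definition reeb_topology :: "(complex \<times> complex \<Rightarrow> real) \<Rightarrow> (complex \<times> complex) set topology" where
  "reeb_topology f = topology (\<lambda>U. U \<subseteq> level_components f \<and>
     openin (top_of_set torus) {z \<in> torus. reeb_proj f z \<in> U})"

lemma openin_reeb_topology:
  "openin (reeb_topology f) U \<longleftrightarrow> U \<subseteq> level_components f \<and>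
     openin (top_of_set torus) {z \<in> torus. reeb_proj f z \<in> U}"
proof -
  let ?L = "\<lambda>U. U \<subseteq> level_components f \<and>
     openin (top_of_set torus) {z \<in> torus. reeb_proj f z \<in> U}"
  have "istopology ?L"
    unfolding istopology_def
  proof (intro conjI allI impI)
    fix S T assume "?L S" "?L T"
    moreover have "{z \<in> torus. reeb_proj f z \<in> S \<inter> T} =
        {z \<in> torus. reeb_proj f z \<in> S} \<inter> {z \<in> torus. reeb_proj f z \<in> T}"
      by auto
    ultimately show "S \<inter> T \<subseteq> level_components f"
      and "openin (top_of_set torus) {z \<in> torus. reeb_proj f z \<in> S \<inter> T}"
      by (auto simp: openin_Int)
  next
    fix \<K> assume K: "\<forall>K\<in>\<K>. ?L K"
    then show "\<Union>\<K> \<subseteq> level_components f" by auto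
    have "{z \<in> torus. reeb_proj f z \<in> \<Union>\<K>} = (\<Union>K\<in>\<K>. {z \<in> torus. reeb_proj f z \<in> K})"
      by auto
    with K show "openin (top_of_set torus) {z \<in> torus. reeb_proj f z \<in> \<Union>\<K>}"
      by (auto intro!: openin_Union)
  qed
  then show ?thesis
    by (simp add: reeb_topology_def)
qed

lemma quotient_map_reeb_proj: "quotient_map (top_of_set torus) (reeb_topology f) (reeb_proj f)"
proof -
  have "topspace (reeb_topology f) = level_components f"
  proof
    show "topspace (reeb_topology f) \<subseteq> level_components f"
      using openin_reeb_topology openin_topspace by blast
    have "{z \<in> torus. reeb_proj f z \<in> level_components f} = torus"
      by (auto simp flip: reeb_proj_image)
    then have "openin (reeb_topology f) (level_components f)"
      by (simp add: openin_reeb_topology)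
    then show "level_components f \<subseteq> topspace (reeb_topology f)"
      by (rule openin_subset)
  qed
  then show ?thesis
    by (auto simp: quotient_map_def reeb_proj_image openin_reeb_topology)
qed

definition reeb_vertices :: "(complex \<times> complex \<Rightarrow> real) \<Rightarrow> (complex \<times> complex) set set" where
  "reeb_vertices f = {K \<in> level_components f. \<exists>z\<in>K. critical_point f z}"

text \<open>Open edges, as subsets of the graph.\<close>

definition reeb_edges :: "(complex \<times> complex \<Rightarrow> real) \<Rightarrow> (complex \<times> complex) set set set" where
  "reeb_edges f = (\<lambda>W. reeb_proj f ` W) ` components (torus - \<Union>(reeb_vertices f))"

text \<open>The end vertices of an edge are the points its closure adds to it (\<open>u = v\<close> for a loop).\<close>

definition reeb_joins ::
  "(complex \<times> complex \<Rightarrow> real) \<Rightarrow> (complex \<times> complex) set set \<Rightarrow>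
   (complex \<times> complex) set \<Rightarrow> (complex \<times> complex) set \<Rightarrow> bool" where
  "reeb_joins f e u v \<longleftrightarrow> reeb_topology f closure_of e - e = {u, v}"

section \<open>Trees\<close>

text \<open>Undirected multigraphs with vertex set \<open>V\<close> and edge set \<open>E\<close>; \<open>joins e u v\<close> says that \<open>u\<close>
  and \<open>v\<close> are the ends of \<open>e\<close>.  A loop is a cycle of length 1, and two parallel edges form a
  cycle of length 2.\<close>

definition graph_connected :: "'v set \<Rightarrow> 'e set \<Rightarrow> ('e \<Rightarrow> 'v \<Rightarrow> 'v \<Rightarrow> bool) \<Rightarrow> bool" where
  "graph_connected V E joins \<longleftrightarrow> V \<noteq> {} \<and>
     (\<forall>u\<in>V. \<forall>v\<in>V. (u, v) \<in> {(x, y). x \<in> V \<and> y \<in> V \<and> (\<exists>e\<in>E. joins e x y)}\<^sup>*)"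

definition graph_cycle ::
  "'v set \<Rightarrow> 'e set \<Rightarrow> ('e \<Rightarrow> 'v \<Rightarrow> 'v \<Rightarrow> bool) \<Rightarrow> 'v list \<Rightarrow> 'e list \<Rightarrow> bool" where
  "graph_cycle V E joins vs es \<longleftrightarrow>
     es \<noteq> [] \<and> length vs = length es \<and> set vs \<subseteq> V \<and> set es \<subseteq> E \<and> distinct vs \<and> distinct es \<and>
     (\<forall>i < length es. joins (es ! i) (vs ! i) (vs ! (Suc i mod length vs)))"

definition graph_tree :: "'v set \<Rightarrow> 'e set \<Rightarrow> ('e \<Rightarrow> 'v \<Rightarrow> 'v \<Rightarrow> bool) \<Rightarrow> bool" where
  "graph_tree V E joins \<longleftrightarrow>
     graph_connected V E joins \<and> \<not> (\<exists>vs es. graph_cycle V E joins vs es)"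

definition reeb_graph_is_tree :: "(complex \<times> complex \<Rightarrow> real) \<Rightarrow> bool" where
  "reeb_graph_is_tree f \<longleftrightarrow> graph_tree (reeb_vertices f) (reeb_edges f) (reeb_joins f)"

section \<open>Disjoint unions of open discs\<close>

definition disjoint_union_of_open_discs :: "'a::topological_space set \<Rightarrow> bool" where
  "disjoint_union_of_open_discs S \<longleftrightarrow>
     (\<exists>\<D>. pairwise disjnt \<D> \<and> \<Union>\<D> = S \<and>
        (\<forall>D\<in>\<D>. openin (top_of_set S) D \<and> D homeomorphic ball (0 :: real \<times> real) 1))"

end

theory Submission
  imports Defs "HOL-Complex_Analysis.Complex_Analysis" "HOL-Library.Transitive_Closure_Table"
begin

text \<open>Lift to the universal covering and call a subset of the torus essential if it contains a loop
  that is not contractible in the torus.  Since the graph is a tree, every regular level component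
  separates the torus into two sides.  By the Fashoda theorem loops on different sides have linearly
  dependent classes; if both or neither of the sides were essential, some nonzero linear functional
  would vanish on all classes of loops on either side, and would give rise to a nonconstant locally
  constant function on the plane.  So exactly one side is essential.  Moving from vertex to vertex
  towards the essential side must stop, because it decreases a finite set of vertices, and it can only
  stop at a vertex all of whose complementary components are inessential.  Such a component lifts
  homeomorphically to the plane, where its image has no holes and hence is a disc.

  Two different vertices with this property would yield two open discs that cover the torus and have
  connected intersection; the logarithms of the first coordinate on the two discs would then fit
  together to one on the whole torus, which is impossible.\<close>

section \<open>Level components and tubes\<close>

text \<open>A critical level enters the argument only as a closed connected set; squarefreeness
  serves to make critical points isolated, so that there are finitely many vertices. Away from the
  vertices the tools are small boxes on which \<open>f\<close> is open with connected slices, and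
  the product structure along an edge is rebuilt from them by compactness and connectedness.
  Finiteness of the set of edges is not known beforehand; it is deduced from acyclicity. The descent
  is carried out for an abstract predicate \<open>bad\<close>, later instantiated by
  \<open>essential\<close>. That exactly one side is essential is a Mayer-Vietoris argument in
  disguise: a cohomology class of the torus that vanishes on both sides has primitives over both,
  and since the level between them is connected, the primitives differ there by a single constant
  and can be matched. For two essential sides the class is the intersection form with an essential
  loop, for two inessential sides any class will do.\<close>

lemma connected_subset_of_separation:
  assumes "connected X" "openin (top_of_set T) A" "openin (top_of_set T) B"
    and "X \<subseteq> A \<union> B" "A \<inter> B \<inter> X = {}" "A \<inter> X \<noteq> {}"
  shows "X \<subseteq> A"
proof -
  obtain A' B' where AB: "open A'" "open B'" "A = T \<inter> A'" "B = T \<inter> B'"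
    using assms(2,3) by (auto simp: openin_open)
  show ?thesis
    using connectedD[OF assms(1) AB(1,2)] assms(4-6) AB(3,4) by blast
qed

lemma Union_subset_Union_closure: "\<Union>\<C> \<subseteq> \<Union>(closure ` \<C>)"
proof (rule Union_least)
  fix X assume X: "X \<in> \<C>"
  have "X \<subseteq> closure X" by (rule closure_subset)
  also have "\<dots> \<subseteq> \<Union>(closure ` \<C>)" by (rule Union_upper[OF imageI[OF X]])
  finally show "X \<subseteq> \<Union>(closure ` \<C>)" .
qed

text \<open>The set \<open>V\<close> stands for the vertices of the graph; \<open>box\<close> is all that is used of the local structure
  at points on no critical level component.\<close>

locale level_structure =
  fixes T :: "'a::euclidean_space set" and f :: "'a \<Rightarrow> real" and V :: "'a set set"
  assumes compact_T: "compact T" and connected_T: "connected T"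
    and locally_connected_T: "locally connected T"
    and cont: "continuous_on T f"
    and finite_V: "finite V"
    and V_levels: "V \<subseteq> (\<Union>t. components {z \<in> T. f z = t})"
    and box: "\<lbrakk>z \<in> T - \<Union>V; openin (top_of_set T) U; z \<in> U\<rbrakk> \<Longrightarrow>
      \<exists>B d. openin (top_of_set T) B \<and> z \<in> B \<and> B \<subseteq> U \<and> 0 < d \<and>
        f ` B = {f z - d<..<f z + d} \<and> (\<forall>t. connected (B \<inter> f -` {t}))"
begin

abbreviation topen :: "'a set \<Rightarrow> bool" where "topen \<equiv> openin (top_of_set T)"

definition lev :: "'a \<Rightarrow> 'a set" where
  "lev z = connected_component_set {w \<in> T. f w = f z} z"

text \<open>The union of the regular level components. Its connected components stand for the open
  edges of the graph.\<close>

definition R :: "'a set" where "R = T - \<Union>V"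

lemma lev_refl: "z \<in> T \<Longrightarrow> z \<in> lev z"
  by (simp add: lev_def)

lemma lev_subset: "lev z \<subseteq> {w \<in> T. f w = f z}"
  unfolding lev_def by (rule connected_component_subset)

lemma lev_subset_T: "lev z \<subseteq> T"
  using lev_subset by auto

lemma f_lev: "w \<in> lev z \<Longrightarrow> f w = f z"
  using lev_subset by auto

lemma lev_eq: "w \<in> lev z \<Longrightarrow> lev w = lev z"
proof -
  assume w: "w \<in> lev z"
  have "lev z = connected_component_set {x \<in> T. f x = f z} w"
    unfolding lev_def by (rule connected_component_eq[symmetric]) (use w in \<open>simp add: lev_def\<close>)
  then show ?thesis using f_lev[OF w] by (simp add: lev_def)
qed

lemma lev_disjoint: "lev z \<inter> lev w \<noteq> {} \<Longrightarrow> lev z = lev w"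
  by (metis disjoint_iff lev_eq)

lemma connected_lev: "connected (lev z)"
  by (simp add: lev_def connected_connected_component)

lemma lev_maximal:
  assumes "connected A" "A \<subseteq> T" "z \<in> A" "\<And>w. w \<in> A \<Longrightarrow> f w = f z"
  shows "A \<subseteq> lev z"
  unfolding lev_def using assms by (intro connected_component_maximal) blast+

lemma closed_T: "closed T"
  using compact_T by (rule compact_imp_closed)

lemma compact_level_set: "compact {w \<in> T. f w = t}"
proof -
  have "closed {w \<in> T. f w = t}"
    using continuous_closed_preimage_constant[OF cont closed_T, of t] by simp
  then have "compact (T \<inter> {w \<in> T. f w = t})"
    using compact_T compact_Int_closed by blast
  moreover have "T \<inter> {w \<in> T. f w = t} = {w \<in> T. f w = t}" by auto
  ultimately show ?thesis by simp
qed

lemma compact_lev: "compact (lev z)"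
  unfolding lev_def using compact_level_set[of "f z"]
  by (metis closed_connected_component compact_Int_closed compact_imp_closed
      connected_component_subset inf.absorb_iff2)

lemma closed_lev: "closed (lev z)"
  by (simp add: compact_lev compact_imp_closed)

lemma components_lev: 
  assumes "K \<in> components {z \<in> T. f z = t}" "z \<in> K"
  shows "K = lev z"
proof -
  have "z \<in> {z \<in> T. f z = t}" using assms in_components_subset by blast
  then have "f z = t" by simp
  moreover obtain x where "K = connected_component_set {z \<in> T. f z = t} x"
    using assms(1) by (auto simp: components_def)
  then have "K = connected_component_set {z \<in> T. f z = t} z"
    using assms(2) connected_component_eq[of z _ x] by simp
  ultimately show ?thesis by (simp add: lev_def)
qed

lemma vertex_lev: "K \<in> V \<Longrightarrow> z \<in> K \<Longrightarrow> K = lev z"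
proof -
  assume K: "K \<in> V" "z \<in> K"
  then obtain t where "K \<in> components {z \<in> T. f z = t}" using V_levels by auto
  then show "K = lev z" using components_lev K(2) by simp
qed

lemma vertex_nonempty: "K \<in> V \<Longrightarrow> K \<noteq> {}"
  using V_levels in_components_nonempty by blast

lemma vertexE:
  assumes "K \<in> V"
  obtains z where "z \<in> T" "z \<in> K" "K = lev z"
proof -
  obtain z where "z \<in> K" using vertex_nonempty[OF assms] by auto
  then show thesis using that vertex_lev[OF assms] lev_subset_T[of z] by auto
qed

lemma closed_vertex: "K \<in> V \<Longrightarrow> closed K"
  by (metis closed_lev vertexE)

lemma connected_vertex: "K \<in> V \<Longrightarrow> connected K"
  by (metis connected_lev vertexE)

lemma vertex_subset_T: "K \<in> V \<Longrightarrow> K \<subseteq> T"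
  by (metis lev_subset_T vertexE)

lemma vertices_disjoint: "K \<in> V \<Longrightarrow> L \<in> V \<Longrightarrow> K \<noteq> L \<Longrightarrow> K \<inter> L = {}"
  using vertex_lev by blast

lemma closed_S: "closed (\<Union>V)"
  using closed_vertex finite_V by blast

lemma topen_T: "topen T"
  by simp

lemma topen_Int_open: "topen U \<Longrightarrow> open O' \<Longrightarrow> topen (U \<inter> O')"
  by (metis Int_commute openin_Int_open)

lemma topen_diff: "topen U \<Longrightarrow> closed C \<Longrightarrow> topen (U - C)"
  by (metis Diff_eq open_Compl topen_Int_open)

lemma topen_R: "topen R"
  unfolding R_def using closed_S topen_diff topen_T by blast

lemma R_subset: "R \<subseteq> T"
  by (auto simp: R_def)

lemma lev_subset_R: "z \<in> R \<Longrightarrow> lev z \<subseteq> R"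
proof -
  assume z: "z \<in> R"
  have "w \<notin> K" if w: "w \<in> lev z" and K: "K \<in> V" for w K
  proof
    assume "w \<in> K"
    then have "K = lev z" using vertex_lev[OF K] lev_eq[OF w] by simp
    then show False using z K lev_refl[of z] unfolding R_def by auto
  qed
  then show ?thesis using lev_subset_T[of z] unfolding R_def by auto
qed

lemma topen_components: "topen U \<Longrightarrow> A \<in> components U \<Longrightarrow> topen A"
  using locally_connected_T locally_connected_open_component by blast

lemma topen_preimage: "topen U \<Longrightarrow> open J \<Longrightarrow> topen (U \<inter> f -` J)"
proof -
  assume U: "topen U" "open J"
  have "topen (T \<inter> f -` J)"
    using cont U continuous_openin_preimage_gen by blast
  then have "topen (U \<inter> (T \<inter> f -` J))" using U by blast
  moreover have "U \<inter> (T \<inter> f -` J) = U \<inter> f -` J" using U openin_imp_subset by blast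
  ultimately show ?thesis by simp
qed

text \<open>A box around \<open>z\<close> is mapped onto an open interval around \<open>f z\<close>,
  so \<open>f\<close> is an open map on the regular part.\<close>

lemma open_image:
  assumes "topen U" "U \<subseteq> R"
  shows "open (f ` U)"
  unfolding open_contains_ball
proof
  fix t assume "t \<in> f ` U"
  then obtain z where z: "z \<in> U" "t = f z" by auto
  then obtain B d where "B \<subseteq> U" "0 < d" "f ` B = {f z - d<..<f z + d}"
    using box[of z U] assms R_def by (metis subset_iff)
  then show "\<exists>e>0. ball t e \<subseteq> f ` U"
    using z by (metis ball_eq_greaterThanLessThan image_mono)
qed

text \<open>Tubes are the preimages of open arcs of the graph that \<open>f\<close> embeds into the line.\<close>

definition tube :: "'a set \<Rightarrow> bool" where
  "tube X \<longleftrightarrow> topen X \<and> X \<subseteq> R \<and> connected (f ` X) \<and> (\<forall>z\<in>X. lev z \<subseteq> X) \<and>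
     (\<forall>z\<in>X. \<forall>w\<in>X. f z = f w \<longrightarrow> w \<in> lev z)"

lemma tube_fibre: "tube X \<Longrightarrow> z \<in> X \<Longrightarrow> X \<inter> f -` {f z} = lev z"
  unfolding tube_def by (auto dest: f_lev)

text \<open>On a tube \<open>f\<close> is open with connected fibres, and connected sets of values
  pull back to connected sets under such maps. In particular, cutting a tube at a level leaves
  connected halves.\<close>

lemma connected_tube_preimage:
  assumes "tube X" "connected J"
  shows "connected (X \<inter> f -` J)"
proof -
  have X: "topen X" "X \<subseteq> R" "connected (f ` X)" using assms by (auto simp: tube_def)
  have op: "openin (top_of_set (f ` X)) (f ` C)" if "openin (top_of_set X) C" for C
  proof -
    have "topen C" using that X(1) openin_trans by blast
    then have "open (f ` C)"
      using open_image openin_imp_subset[OF that] X(2) by blast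
    then show ?thesis
      using openin_imp_subset[OF that] by (meson image_mono open_subset)
  qed
  have "connected (X \<inter> f -` (J \<inter> f ` X))"
  proof (rule connected_open_monotone_preimage[OF _ refl op])
    show "continuous_on X f"
      using cont X R_subset continuous_on_subset by blast
    show "connected (X \<inter> f -` {y})" if "y \<in> f ` X" for y
      using that tube_fibre[OF assms(1)] connected_lev by auto
    show "connected (J \<inter> f ` X)"
      using assms X(3) by (simp add: is_interval_connected_1 [symmetric] is_interval_Int)
  qed auto
  moreover have "X \<inter> f -` (J \<inter> f ` X) = X \<inter> f -` J" by auto
  ultimately show ?thesis by simp
qed

lemma connected_tube: "tube X \<Longrightarrow> connected X"
  using connected_tube_preimage[of X UNIV] by simp


lemma topen_subset: "topen U \<Longrightarrow> U \<subseteq> T"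
  by (rule openin_imp_subset)

lemma topen_restrict:
  assumes "topen U" "C \<subseteq> T"
  shows "openin (top_of_set C) (C \<inter> U)"
proof -
  obtain G where "open G" "U = T \<inter> G" using assms(1) by (auto simp: openin_open)
  then have "C \<inter> U = C \<inter> G" using assms(2) by auto
  then show ?thesis using \<open>open G\<close> by auto
qed

lemma boxes_on_level:
  assumes "C \<subseteq> R" "topen U" "C \<subseteq> U"
  obtains B d where "\<And>x. x \<in> C \<Longrightarrow> topen (B x) \<and> x \<in> B x \<and> B x \<subseteq> U \<and> 0 < (d x :: real) \<and>
     f ` B x = {f x - d x<..<f x + d x} \<and> (\<forall>t. connected (B x \<inter> f -` {t}))"
proof -
  have "\<exists>B d. topen B \<and> x \<in> B \<and> B \<subseteq> U \<and> 0 < (d :: real) \<and>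
     f ` B = {f x - d<..<f x + d} \<and> (\<forall>t. connected (B \<inter> f -` {t}))" if "x \<in> C" for x
    by (rule box) (use assms that in \<open>auto simp: R_def\<close>)
  then have "\<forall>x\<in>C. \<exists>B d. topen B \<and> x \<in> B \<and> B \<subseteq> U \<and> 0 < (d :: real) \<and>
     f ` B = {f x - d<..<f x + d} \<and> (\<forall>t. connected (B \<inter> f -` {t}))" by blast
  from bchoice[OF this] obtain B where B: "\<forall>x\<in>C. \<exists>d. topen (B x) \<and> x \<in> B x \<and> B x \<subseteq> U \<and> 0 < (d :: real) \<and>
     f ` B x = {f x - d<..<f x + d} \<and> (\<forall>t. connected (B x \<inter> f -` {t}))" by blast
  from bchoice[OF this] obtain d where d: "\<forall>x\<in>C. topen (B x) \<and> x \<in> B x \<and> B x \<subseteq> U \<and> 0 < (d x :: real) \<and>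
     f ` B x = {f x - d x<..<f x + d x} \<and> (\<forall>t. connected (B x \<inter> f -` {t}))" by blast
  show thesis by (rule that[OF bspec[OF d]])
qed

text \<open>This replaces a flow along the compact level \<open>lev z\<close>. Finitely many boxes
  cover it; at values close to \<open>f z\<close> the slices of neighbouring boxes meet and so join
  up to one connected piece. A separating neighbourhood \<open>P\<close> keeps the nearby level
  components from leaving the boxes.\<close>

lemma local_tube:
  assumes z: "z \<in> R" and U: "topen U" "lev z \<subseteq> U"
  obtains X where "tube X" "z \<in> X" "X \<subseteq> U"
proof -
  define C where "C = lev z"
  define c where "c = f z"
  have zC: "z \<in> C" using z R_subset lev_refl C_def by auto
  have C: "C \<subseteq> R" "connected C" "compact C" "C \<subseteq> T"
    using lev_subset_R[OF z] connected_lev compact_lev lev_subset_T by (auto simp: C_def)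
  have fC: "f x = c" if "x \<in> C" for x using that f_lev C_def c_def by auto
  obtain B d where B: "\<And>x. x \<in> C \<Longrightarrow> topen (B x) \<and> x \<in> B x \<and> B x \<subseteq> U \<inter> R \<and> 0 < (d x :: real) \<and>
     f ` B x = {f x - d x<..<f x + d x} \<and> (\<forall>t. connected (B x \<inter> f -` {t}))"
  proof (rule boxes_on_level[of C "U \<inter> R"])
    show "topen (U \<inter> R)" using U(1) topen_R by (rule openin_Int)
    show "C \<subseteq> U \<inter> R" using C U by (simp add: C_def)
  qed (use C in auto)
  have slice: "B x \<inter> f -` {t} \<noteq> {}" if "x \<in> C" "\<bar>t - c\<bar> < d x" for x t
  proof -
    have "t \<in> f ` B x" using B[OF that(1)] fC[OF that(1)] that(2) by auto
    then show ?thesis by auto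
  qed
  define O' where "O' = (\<Union>x\<in>C. B x)"
  \<comment> \<open>\<open>Q x y\<close> says that at every value close to \<open>c\<close> the
    slices of \<open>B x\<close> and \<open>B y\<close> lie in one connected part of the level set.
    The relation is symmetric and transitive and holds locally, since overlapping boxes have an open
    set of common values; connectedness of \<open>C\<close> spreads it from \<open>z\<close> over
    all of \<open>C\<close>.\<close>
  define Q where "Q x y \<longleftrightarrow> (\<exists>e>0. \<forall>t. \<bar>t - c\<bar> < e \<longrightarrow>
      (\<exists>A. connected A \<and> A \<subseteq> O' \<inter> f -` {t} \<and> (B x \<union> B y) \<inter> f -` {t} \<subseteq> A))" for x y
  have Qz: "Q z y" if "y \<in> C" for y
  proof (rule connected_equivalence_relation[OF C(2) zC that])
    show "Q y x" if "Q x y" for x y using that unfolding Q_def by (metis sup_commute)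
  next
    fix x y w assume Q: "Q x y" "Q y w" and xyw: "x \<in> C" "y \<in> C" "w \<in> C"
    obtain e1 where e1: "e1 > 0" "\<And>t. \<bar>t - c\<bar> < e1 \<Longrightarrow>
      (\<exists>A. connected A \<and> A \<subseteq> O' \<inter> f -` {t} \<and> (B x \<union> B y) \<inter> f -` {t} \<subseteq> A)"
      using Q(1) unfolding Q_def by blast
    obtain e2 where e2: "e2 > 0" "\<And>t. \<bar>t - c\<bar> < e2 \<Longrightarrow>
      (\<exists>A. connected A \<and> A \<subseteq> O' \<inter> f -` {t} \<and> (B y \<union> B w) \<inter> f -` {t} \<subseteq> A)"
      using Q(2) unfolding Q_def by blast
    define e where "e = min (min e1 e2) (d y)"
    show "Q x w" unfolding Q_def
    proof (intro exI[of _ e] conjI allI impI)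
      show "e > 0" using e1 e2 B[OF xyw(2)] by (simp add: e_def)
      fix t assume t: "\<bar>t - c\<bar> < e"
      obtain A1 where A1: "connected A1" "A1 \<subseteq> O' \<inter> f -` {t}" "(B x \<union> B y) \<inter> f -` {t} \<subseteq> A1"
        using e1(2)[of t] t e_def by auto
      obtain A2 where A2: "connected A2" "A2 \<subseteq> O' \<inter> f -` {t}" "(B y \<union> B w) \<inter> f -` {t} \<subseteq> A2"
        using e2(2)[of t] t e_def by auto
      have "B y \<inter> f -` {t} \<noteq> {}" using slice[OF xyw(2), of t] t e_def by auto
      then have "A1 \<inter> A2 \<noteq> {}" using A1(3) A2(3) by blast
      then have "connected (A1 \<union> A2)" using A1 A2 connected_Un by blast
      then show "\<exists>A. connected A \<and> A \<subseteq> O' \<inter> f -` {t} \<and> (B x \<union> B w) \<inter> f -` {t} \<subseteq> A"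
        using A1 A2 by (intro exI[of _ "A1 \<union> A2"]) auto
    qed
  next
    fix x assume x: "x \<in> C"
    show "\<exists>S. openin (top_of_set C) S \<and> x \<in> S \<and> (\<forall>y\<in>S. Q x y)"
    proof (intro exI[of _ "C \<inter> B x"] conjI ballI)
      show "openin (top_of_set C) (C \<inter> B x)"
        using B[OF x] C(4) by (intro topen_restrict) auto
      show "x \<in> C \<inter> B x" using x B by auto
      fix y assume y: "y \<in> C \<inter> B x"
      have op: "open (f ` (B x \<inter> B y))"
        using B[OF x] B[of y] y by (intro open_image) auto
      have "c \<in> f ` (B x \<inter> B y)" using y B fC by (intro image_eqI[of _ _ y]) auto
      then obtain e where e: "e > 0" "ball c e \<subseteq> f ` (B x \<inter> B y)"
        using op open_contains_ball by blast
      show "Q x y" unfolding Q_def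
      proof (intro exI[of _ e] conjI allI impI)
        fix t assume "\<bar>t - c\<bar> < e"
        then have "t \<in> f ` (B x \<inter> B y)" using e(2) by (auto simp: dist_real_def abs_minus_commute)
        then have "(B x \<inter> f -` {t}) \<inter> (B y \<inter> f -` {t}) \<noteq> {}" by auto
        then have "connected ((B x \<inter> f -` {t}) \<union> (B y \<inter> f -` {t}))"
          using B[OF x] B[of y] y connected_Un by blast
        moreover have "(B x \<inter> f -` {t}) \<union> (B y \<inter> f -` {t}) \<subseteq> O' \<inter> f -` {t}"
          using x y by (auto simp: O'_def)
        ultimately show "\<exists>A. connected A \<and> A \<subseteq> O' \<inter> f -` {t} \<and> (B x \<union> B y) \<inter> f -` {t} \<subseteq> A"
          by (intro exI conjI) auto
      qed (use e in auto)
    qed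
  qed
  have "\<exists>D. D \<subseteq> C \<and> finite D \<and> C \<subseteq> (\<Union>x\<in>D. B x)"
  proof -
    have "\<forall>x\<in>C. \<exists>G. open G \<and> B x = T \<inter> G"
    proof
      fix x assume "x \<in> C"
      then have "topen (B x)" using B by blast
      then show "\<exists>G. open G \<and> B x = T \<inter> G" by (auto simp: openin_open)
    qed
    from bchoice[OF this] obtain G where G: "\<forall>x\<in>C. open (G x) \<and> B x = T \<inter> G x" ..
    have "C \<subseteq> (\<Union>x\<in>C. G x)"
    proof
      fix x assume x: "x \<in> C"
      then have "x \<in> T \<inter> G x" using B[OF x] bspec[OF G x] by simp
      then show "x \<in> (\<Union>x\<in>C. G x)" using x by blast
    qed
    then obtain D where "D \<subseteq> C" "finite D" "C \<subseteq> (\<Union>x\<in>D. G x)"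
      using compactE_image[OF C(3), of C G] G by blast
    moreover have "(\<Union>x\<in>D. B x) = T \<inter> (\<Union>x\<in>D. G x)" using G \<open>D \<subseteq> C\<close> by blast
    ultimately show ?thesis using C(4) by (intro exI[of _ D]) simp
  qed
  then obtain D where D: "D \<subseteq> C" "finite D" "C \<subseteq> (\<Union>x\<in>D. B x)" by blast
  have "\<forall>x\<in>D. \<exists>e>0. \<forall>t. \<bar>t - c\<bar> < e \<longrightarrow>
      (\<exists>A. connected A \<and> A \<subseteq> O' \<inter> f -` {t} \<and> (B z \<union> B x) \<inter> f -` {t} \<subseteq> A)"
    using Qz D unfolding Q_def by (meson subsetD)
  then obtain e where e: "\<And>x. x \<in> D \<Longrightarrow> e x > (0::real)"
    "\<And>x t. x \<in> D \<Longrightarrow> \<bar>t - c\<bar> < e x \<Longrightarrow>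
      (\<exists>A. connected A \<and> A \<subseteq> O' \<inter> f -` {t} \<and> (B z \<union> B x) \<inter> f -` {t} \<subseteq> A)"
    by metis
  define N where "N = (\<Union>x\<in>D. B x)"
  have N: "topen N" "C \<subseteq> N" "N \<subseteq> U \<inter> R"
  proof -
    have "topen (B x)" "B x \<subseteq> U \<inter> R" if "x \<in> D" for x using B[of x] that D(1) by auto
    then show "topen N" "N \<subseteq> U \<inter> R" unfolding N_def by (blast intro: openin_Union)+
  qed (use D N_def in simp)
  have NT: "N \<subseteq> T" using N(1) topen_subset by blast
  have "compact (T - N)"
    using N(1) compact_T by (metis closedin_compact closedin_diff closedin_self)
  then have "closed (T - N)" by (rule compact_imp_closed)
  moreover have "C \<inter> (T - N) = {}" using N(2) by blast
  ultimately obtain P P' where P: "open P" "open P'" "C \<subseteq> P" "T - N \<subseteq> P'" "P \<inter> P' = {}"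
    using separation_normal[OF compact_imp_closed[OF C(3)]] by metis
  \<comment> \<open>The points outside both \<open>P\<close> and \<open>P'\<close> form a compact
    set on which \<open>f\<close> avoids \<open>c\<close>. There \<open>f\<close> stays at distance
    at least \<open>m\<close> from \<open>c\<close>, so level components at nearby values cannot
    cross from \<open>P\<close> to \<open>P'\<close>.\<close>
  define M where "M = T - P - P'"
  have "compact M" unfolding M_def
    using compact_T P by (metis compact_diff)
  have Mc: "f x \<noteq> c" if x: "x \<in> M" for x
  proof
    assume "f x = c"
    moreover have "x \<in> N" "x \<notin> P" "x \<in> T" using x P(4) by (auto simp: M_def)
    then obtain y where y: "y \<in> D" "x \<in> B y" by (auto simp: N_def)
    then have yC: "y \<in> C" using D by auto
    ultimately have "B y \<inter> f -` {c} \<subseteq> lev y"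
      using B[OF yC] fC[OF yC] topen_subset by (intro lev_maximal) auto
    then have "x \<in> C" using y \<open>f x = c\<close> yC lev_eq[of y z] by (auto simp: C_def)
    then show False using \<open>x \<notin> P\<close> P by auto
  qed
  obtain m where m: "m > 0" "\<And>x. x \<in> M \<Longrightarrow> m \<le> \<bar>f x - c\<bar>"
  proof (cases "M = {}")
    case False
    have "continuous_on M (\<lambda>x. \<bar>f x - c\<bar>)"
      using continuous_on_subset[OF cont, of M] M_def by (intro continuous_intros) auto
    then obtain x0 where "x0 \<in> M" "\<And>x. x \<in> M \<Longrightarrow> \<bar>f x0 - c\<bar> \<le> \<bar>f x - c\<bar>"
      using continuous_attains_inf[OF \<open>compact M\<close> False] by blast
    then show ?thesis using that[of "\<bar>f x0 - c\<bar>"] Mc[of x0] by auto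
  qed (use that[of 1] in auto)
  \<comment> \<open>The radius \<open>r\<close> ensures that every value near \<open>c\<close> is
    taken inside \<open>B z\<close> and \<open>P\<close>, so that each nearby level component has a
    point in \<open>P\<close> to start from.\<close>
  have "open (f ` (B z \<inter> P))"
    using B[OF zC] topen_Int_open P(1) by (intro open_image) auto
  moreover have "c \<in> f ` (B z \<inter> P)" using B[OF zC] zC P(3) c_def by auto
  ultimately obtain r where r: "r > 0" "ball c r \<subseteq> f ` (B z \<inter> P)"
    using open_contains_ball by blast
  define E where "E = insert m (insert r (insert (d z) (e ` D)))"
  define \<epsilon> where "\<epsilon> = Min E"
  have E: "finite E" "E \<noteq> {}" using D(2) by (auto simp: E_def)
  have epsE: "\<epsilon> \<le> u" if "u \<in> E" for u unfolding \<epsilon>_def using E(1) that by (rule Min_le)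
  have "\<epsilon> \<in> E" unfolding \<epsilon>_def using E by (rule Min_in)
  then have "\<epsilon> > 0" using m(1) r(1) e(1) B[OF zC] by (auto simp: E_def)
  moreover have "\<epsilon> \<le> m" "\<epsilon> \<le> r" "\<epsilon> \<le> d z" "\<And>x. x \<in> D \<Longrightarrow> \<epsilon> \<le> e x"
    by (rule epsE, simp add: E_def)+
  ultimately have eps: "\<epsilon> > 0" "\<epsilon> \<le> m" "\<epsilon> \<le> r" "\<epsilon> \<le> d z" "\<And>x. x \<in> D \<Longrightarrow> \<epsilon> \<le> e x"
    by blast+
  \<comment> \<open>The connected pieces \<open>A x\<close> all contain the slice of
    \<open>B z\<close>, so the whole slice of \<open>N\<close> lies in one level component. That
    component has a point in \<open>P\<close>, cannot cross \<open>M\<close>, and therefore stays in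
    \<open>N\<close>.\<close>
  have key: "N \<inter> f -` {t} = lev y" if t: "\<bar>t - c\<bar> < \<epsilon>" and y: "y \<in> N" "f y = t" for t y
  proof -
    have "\<forall>x\<in>D. \<exists>A. connected A \<and> A \<subseteq> O' \<inter> f -` {t} \<and> (B z \<union> B x) \<inter> f -` {t} \<subseteq> A"
      using e(2) eps(5) t by force
    then obtain A where A: "\<And>x. x \<in> D \<Longrightarrow> connected (A x) \<and> A x \<subseteq> O' \<inter> f -` {t} \<and>
       (B z \<union> B x) \<inter> f -` {t} \<subseteq> A x" by metis
    have Bz: "B z \<inter> f -` {t} \<noteq> {}" using slice[OF zC] t eps by auto
    have conn: "connected (\<Union>x\<in>D. A x)"
    proof (rule connected_Union)
      obtain b where "b \<in> B z \<inter> f -` {t}" using Bz by auto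
      then have "b \<in> A x" if "x \<in> D" for x using A[OF that] by blast
      then show "\<Inter> (A ` D) \<noteq> {}" by blast
    qed (use A in auto)
    have N_A: "N \<inter> f -` {t} \<subseteq> (\<Union>x\<in>D. A x)"
    proof
      fix x assume x: "x \<in> N \<inter> f -` {t}"
      then obtain i where i: "i \<in> D" "x \<in> B i" by (auto simp: N_def)
      then have "x \<in> A i" using A[OF i(1)] x by blast
      then show "x \<in> (\<Union>x\<in>D. A x)" using i by blast
    qed
    moreover have "(\<Union>x\<in>D. A x) \<subseteq> lev y"
    proof (rule lev_maximal[OF conn])
      have "O' \<subseteq> T" unfolding O'_def using B topen_subset by blast
      have "A i \<subseteq> T" if "i \<in> D" for i using A[OF that] \<open>O' \<subseteq> T\<close> by blast
      then show "(\<Union>x\<in>D. A x) \<subseteq> T" by blast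
      show "y \<in> (\<Union>x\<in>D. A x)" using y N_A by blast
      show "f w = f y" if w: "w \<in> (\<Union>x\<in>D. A x)" for w
      proof -
        obtain i where i: "i \<in> D" "w \<in> A i" using w by blast
        then have "f w = t" using A[OF i(1)] by blast
        then show ?thesis using y by simp
      qed
    qed
    ultimately have sub: "N \<inter> f -` {t} \<subseteq> lev y" by blast
    have "t \<in> f ` (B z \<inter> P)" using r(2) t eps by (auto simp: dist_real_def abs_minus_commute)
    then obtain p where p: "p \<in> B z" "p \<in> P" "f p = t" by auto
    obtain x0 where x0: "x0 \<in> D" using D(3) zC by auto
    have "p \<in> A x0" using A[OF x0] p by blast
    then have "p \<in> lev y" using \<open>(\<Union>x\<in>D. A x) \<subseteq> lev y\<close> x0 by blast
    have "lev y \<subseteq> P \<union> P'"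
    proof
      fix x assume x: "x \<in> lev y"
      then have "x \<in> T" "f x = t" using lev_subset y by auto
      then have "x \<notin> M" using m(2)[of x] t eps by auto
      then show "x \<in> P \<union> P'" using \<open>x \<in> T\<close> by (auto simp: M_def)
    qed
    then have "lev y \<subseteq> P"
      using connectedD[OF connected_lev[of y] P(1,2)] P(5) \<open>p \<in> lev y\<close> p by blast
    then have "lev y \<subseteq> N" using P lev_subset_T by blast
    moreover have "lev y \<subseteq> f -` {t}" using f_lev[of _ y] y(2) by auto
    ultimately show ?thesis using sub by blast
  qed
  define X where "X = N \<inter> f -` {c - \<epsilon><..<c + \<epsilon>}"
  show thesis
  proof
    show "z \<in> X" using N zC eps by (auto simp: X_def c_def)
    show "X \<subseteq> U" using N by (auto simp: X_def)
    show "tube X" unfolding tube_def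
    proof (intro conjI ballI impI)
      show "topen X" unfolding X_def by (rule topen_preimage[OF N(1)]) simp
      show "X \<subseteq> R" using N by (auto simp: X_def)
      have "f ` X = {c - \<epsilon><..<c + \<epsilon>}"
      proof
        show "{c - \<epsilon><..<c + \<epsilon>} \<subseteq> f ` X"
        proof
          fix t assume t: "t \<in> {c - \<epsilon><..<c + \<epsilon>}"
          then have "t \<in> ball c r" using eps by (auto simp: dist_real_def)
          then obtain p where "p \<in> B z" "p \<in> P" "f p = t" using r by auto
          moreover have "p \<in> T" using \<open>p \<in> B z\<close> B[OF zC] topen_subset by blast
          then have "p \<in> N" using \<open>p \<in> P\<close> P(4,5) by blast
          ultimately show "t \<in> f ` X" using t by (auto simp: X_def)
        qed
      qed (auto simp: X_def)
      then show "connected (f ` X)" by simp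
      show "lev y \<subseteq> X" if "y \<in> X" for y
      proof -
        have "lev y = N \<inter> f -` {f y}" using key[of "f y" y] that by (auto simp: X_def abs_less_iff)
        then show ?thesis using that by (auto simp: X_def)
      qed
      show "w \<in> lev y" if "y \<in> X" "w \<in> X" "f y = f w" for y w
      proof -
        have "lev y = N \<inter> f -` {f y}" using key[of "f y" y] that by (auto simp: X_def abs_less_iff)
        then show ?thesis using that by (auto simp: X_def)
      qed
    qed
  qed
qed


lemma tube_lev_eq: "tube X \<Longrightarrow> x \<in> X \<Longrightarrow> w \<in> X \<Longrightarrow> f x = f w \<Longrightarrow> lev x = lev w"
  unfolding tube_def using lev_eq by metis

lemma tube_lev_subset: "tube X \<Longrightarrow> x \<in> X \<Longrightarrow> lev x \<subseteq> X"
  unfolding tube_def by blast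

lemma tubeD: "tube X \<Longrightarrow> topen X" "tube X \<Longrightarrow> X \<subseteq> R" "tube X \<Longrightarrow> connected (f ` X)"
  unfolding tube_def by blast+

lemma R_lev_refl: "x \<in> R \<Longrightarrow> x \<in> lev x"
  using R_subset lev_refl by blast

lemma some_tube:
  assumes "z \<in> R"
  obtains X where "tube X" "z \<in> X"
  by (rule local_tube[OF assms topen_R lev_subset_R[OF assms]]) (rule that)

lemma separate_levels:
  assumes "x \<in> R" "y \<in> R" "f x = t" "f y = t" "lev x \<noteq> lev y"
  obtains X Y where "tube X" "x \<in> X" "tube Y" "y \<in> Y" "X \<inter> Y = {}"
proof -
  have "lev x \<inter> lev y = {}" using assms(5) lev_disjoint by blast
  then obtain P Q where PQ: "open P" "open Q" "lev x \<subseteq> P" "lev y \<subseteq> Q" "P \<inter> Q = {}"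
    using separation_normal[OF closed_lev closed_lev] by metis
  have sub: "lev x \<subseteq> T \<inter> P" "lev y \<subseteq> T \<inter> Q" using PQ(3,4) lev_subset_T by blast+
  obtain X where X: "tube X" "x \<in> X" "X \<subseteq> T \<inter> P"
    by (rule local_tube[OF assms(1) topen_Int_open[OF topen_T PQ(1)] sub(1)])
  obtain Y where Y: "tube Y" "y \<in> Y" "Y \<subseteq> T \<inter> Q"
    by (rule local_tube[OF assms(2) topen_Int_open[OF topen_T PQ(2)] sub(2)])
  show thesis by (rule that[OF X(1,2) Y(1,2)]) (use X(3) Y(3) PQ(5) in blast)
qed

text \<open>The danger is branching: two tubes could share the level components at some common
  values and have different ones at others. In the interval \<open>J\<close> of common values those
  of agreement form an open set because \<open>f\<close> is open, those of disagreement because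
  distinct level components with the same value have disjoint tubes. As \<open>J\<close> is
  connected, one shared level component forces agreement on all of \<open>J\<close>.\<close>

lemma tube_Un:
  assumes X: "tube X" and Y: "tube Y" and meet: "X \<inter> Y \<noteq> {}"
  shows "tube (X \<union> Y)"
proof -
  have op: "open (f ` X)" "open (f ` Y)" "open (f ` (X \<inter> Y))"
    using tubeD X Y by (auto intro!: open_image)
  define J where "J = f ` X \<inter> f ` Y"
  have J: "open J" "connected J"
    using op tubeD(3)[OF X] tubeD(3)[OF Y]
    by (auto simp: J_def is_interval_connected_1 [symmetric] is_interval_Int)
  have opD: "open (J - f ` (X \<inter> Y))"
  proof (rule open_subopen[THEN iffD2], rule ballI)
    fix t assume t: "t \<in> J - f ` (X \<inter> Y)"
    then have "t \<in> f ` X" "t \<in> f ` Y" by (simp_all add: J_def)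
    then obtain x y where xy: "x \<in> X" "f x = t" "y \<in> Y" "f y = t" by auto
    have "lev x \<noteq> lev y"
    proof
      assume "lev x = lev y"
      moreover have "x \<in> lev x" using R_lev_refl[of x] tubeD(2)[OF X] xy(1) by auto
      ultimately have "x \<in> X \<inter> Y" using tube_lev_subset[OF Y xy(3)] xy(1) by auto
      then have "t \<in> f ` (X \<inter> Y)" using xy(2) by auto
      then show False using t by simp
    qed
    then obtain X' Y' where XY': "tube X'" "x \<in> X'" "tube Y'" "y \<in> Y'" "X' \<inter> Y' = {}"
      using separate_levels[of x y t] xy tubeD(2)[OF X] tubeD(2)[OF Y] by (metis subsetD)
    have sub: "topen (X' \<inter> X)" "X' \<inter> X \<subseteq> R" "topen (Y' \<inter> Y)" "Y' \<inter> Y \<subseteq> R"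
      using tubeD(1,2) XY' X Y by blast+
    let ?J = "f ` (X' \<inter> X) \<inter> f ` (Y' \<inter> Y)"
    have "open ?J" using open_image[OF sub(1,2)] open_image[OF sub(3,4)] by (rule open_Int)
    moreover have "t \<in> ?J"
      using image_eqI[of t f x "X' \<inter> X"] image_eqI[of t f y "Y' \<inter> Y"] xy XY' by simp
    moreover have "?J \<subseteq> J - f ` (X \<inter> Y)"
    proof
      fix s assume s: "s \<in> ?J"
      then obtain x' y' where xy': "x' \<in> X'" "x' \<in> X" "f x' = s" "y' \<in> Y'" "y' \<in> Y" "f y' = s" by auto
      have "s \<notin> f ` (X \<inter> Y)"
      proof
        assume "s \<in> f ` (X \<inter> Y)"
        then obtain w where w: "w \<in> X" "w \<in> Y" "f w = s" by auto
        have "lev w = lev x'" "lev w = lev y'"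
          using tube_lev_eq[OF X w(1) xy'(2)] tube_lev_eq[OF Y w(2) xy'(5)] w(3) xy'(3,6) by simp_all
        moreover have "w \<in> lev w" using R_lev_refl[of w] w(1) tubeD(2)[OF X] by auto
        ultimately have "w \<in> X'" "w \<in> Y'"
          using tube_lev_subset[OF XY'(1) xy'(1)] tube_lev_subset[OF XY'(3) xy'(4)] by auto
        then show False using XY'(5) by blast
      qed
      moreover have "s \<in> f ` X" "s \<in> f ` Y" using xy' by (blast intro: image_eqI[OF sym])+
      ultimately show "s \<in> J - f ` (X \<inter> Y)" by (simp add: J_def)
    qed
    ultimately show "\<exists>T. open T \<and> t \<in> T \<and> T \<subseteq> J - f ` (X \<inter> Y)" by (intro exI[of _ ?J] conjI)
  qed
  have sub: "f ` (X \<inter> Y) \<subseteq> J" by (auto simp: J_def)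
  have JE: "J = f ` (X \<inter> Y)"
  proof -
    have "f ` (X \<inter> Y) \<inter> (J - f ` (X \<inter> Y)) \<inter> J = {}" "J \<subseteq> f ` (X \<inter> Y) \<union> (J - f ` (X \<inter> Y))" by auto
    from connectedD[OF J(2) op(3) opD this] have "J - f ` (X \<inter> Y) = {}" using sub meet by auto
    then show ?thesis using sub by auto
  qed
  show ?thesis unfolding tube_def
  proof (intro conjI ballI impI)
    show "topen (X \<union> Y)" "X \<union> Y \<subseteq> R" using tubeD(1,2) X Y by blast+
    have "f ` X \<inter> f ` Y \<noteq> {}" using meet by blast
    then have "connected (f ` X \<union> f ` Y)" using connected_Un tubeD(3)[OF X] tubeD(3)[OF Y] by blast
    then show "connected (f ` (X \<union> Y))" by (simp add: image_Un)
    show "lev z \<subseteq> X \<union> Y" if "z \<in> X \<union> Y" for z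
      using that tube_lev_subset X Y by blast
    have cross: "lev x = lev y" if "x \<in> X" "y \<in> Y" "f x = f y" for x y
    proof -
      have "f x \<in> J" unfolding J_def using that by (metis IntI imageI)
      then obtain w where w: "w \<in> X" "w \<in> Y" "f w = f x" unfolding JE by auto
      have "lev x = lev w" using tube_lev_eq[OF X that(1) w(1)] w by simp
      also have "\<dots> = lev y" using tube_lev_eq[OF Y w(2) that(2)] w that by simp
      finally show ?thesis .
    qed
    fix x y assume xy: "x \<in> X \<union> Y" "y \<in> X \<union> Y" "f x = f y"
    have "lev x = lev y"
      using xy cross[of x y] cross[of y x] tube_lev_eq[OF X, of x y] tube_lev_eq[OF Y, of x y] by auto
    moreover have "y \<in> R" using xy(2) tubeD(2) X Y by blast
    ultimately show "y \<in> lev x" using R_lev_refl by simp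
  qed
qed

text \<open>By \<open>tube_Un\<close> the union \<open>M\<close> of all tubes through
  \<open>z0\<close> is again a tube, and it is clopen in \<open>W\<close> because any tube that
  meets \<open>M\<close> is absorbed by it. So \<open>f\<close> maps each open edge injectively onto
  an interval, and no edge is a circle.\<close>

theorem component_tube:
  assumes W: "W \<in> components R"
  shows "tube W"
proof -
  obtain z0 where z0: "z0 \<in> W" using W in_components_nonempty by blast
  have WR: "W \<subseteq> R" using W in_components_subset by blast
  define \<F> where "\<F> = {X. tube X \<and> z0 \<in> X}"
  have F2: "X \<union> Y \<in> \<F>" if "X \<in> \<F>" "Y \<in> \<F>" for X Y
    using tube_Un[of X Y] that unfolding \<F>_def by blast
  define M where "M = \<Union>\<F>"
  obtain X0 where X0: "X0 \<in> \<F>"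
  proof -
    obtain X where "tube X" "z0 \<in> X" by (rule some_tube[of z0]) (use z0 WR in auto)
    then show thesis using that[of X] by (simp add: \<F>_def)
  qed
  have tM: "tube M" unfolding tube_def
  proof (intro conjI ballI impI)
    show "topen M" unfolding M_def \<F>_def using tubeD(1) by (intro openin_Union) blast
    show "M \<subseteq> R" unfolding M_def \<F>_def using tubeD(2) by blast
    have "connected (\<Union>X\<in>\<F>. f ` X)"
    proof (rule connected_Union)
      show "connected S" if "S \<in> (`) f ` \<F>" for S using that tubeD(3) unfolding \<F>_def by blast
      have "f z0 \<in> \<Inter> ((`) f ` \<F>)" unfolding \<F>_def by blast
      then show "\<Inter> ((`) f ` \<F>) \<noteq> {}" by blast
    qed
    moreover have "f ` M = (\<Union>X\<in>\<F>. f ` X)" unfolding M_def by blast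
    ultimately show "connected (f ` M)" by simp
    show "lev z \<subseteq> M" if z: "z \<in> M" for z
    proof -
      obtain X where X: "X \<in> \<F>" "z \<in> X" using z M_def by blast
      then have "lev z \<subseteq> X" using tube_lev_subset unfolding \<F>_def by blast
      then show ?thesis using X M_def by blast
    qed
    fix z w assume zw: "z \<in> M" "w \<in> M" "f z = f w"
    then obtain X Y where XY: "X \<in> \<F>" "Y \<in> \<F>" "z \<in> X" "w \<in> Y" using M_def by blast
    then have "tube (X \<union> Y)" "z \<in> X \<union> Y" "w \<in> X \<union> Y" using F2 unfolding \<F>_def by blast+
    then show "w \<in> lev z" using zw(3) unfolding tube_def by blast
  qed
  have z0M: "z0 \<in> M" using X0 unfolding M_def \<F>_def by blast
  have "M \<subseteq> W"
    by (rule components_maximal[OF W connected_tube[OF tM] tubeD(2)[OF tM]]) (use z0 z0M in blast)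
  moreover have "W \<subseteq> M"
  proof (rule connected_subset_of_separation)
    show "connected W" using W in_components_connected by blast
    show "topen M" using tM tubeD by blast
    show "topen (\<Union>{X. tube X \<and> X \<inter> M = {}})"
      using tubeD(1) by (intro openin_Union) blast
    show "W \<subseteq> M \<union> \<Union>{X. tube X \<and> X \<inter> M = {}}"
    proof
      fix y assume y: "y \<in> W"
      obtain X where X: "tube X" "y \<in> X"
        by (rule some_tube[of y]) (use y WR in auto)
      show "y \<in> M \<union> \<Union>{X. tube X \<and> X \<inter> M = {}}"
      proof (cases "X \<inter> M = {}")
        case False
        then have "M \<union> X \<in> \<F>" using tube_Un[OF tM X(1)] z0M unfolding \<F>_def by blast
        then show ?thesis using X M_def by blast
      qed (use X in blast)
    qed
    show "M \<inter> W \<noteq> {}" using z0 z0M by blast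
  qed blast
  ultimately show ?thesis using tM by simp
qed

end

section \<open>The ends of an edge\<close>

lemma open_interval_real:
  fixes S :: "real set"
  assumes "open S" "connected S" "bounded S" "S \<noteq> {}"
  obtains a b where "a < b" "S = {a<..<b}"
proof
  have bd: "bdd_above S" "bdd_below S"
    using assms(3) by (auto simp: bounded_imp_bdd_above bounded_imp_bdd_below)
  show S: "S = {Inf S<..<Sup S}"
  proof (intro equalityI subsetI)
    fix x assume x: "x \<in> S"
    then obtain e where e: "e > 0" "ball x e \<subseteq> S" using assms(1) open_contains_ball by blast
    have "x - e/2 \<in> S" "x + e/2 \<in> S" using e by (auto simp: dist_real_def subset_iff)
    then have "Inf S \<le> x - e/2" "x + e/2 \<le> Sup S"
      using bd by (auto intro: cInf_lower cSup_upper)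
    then show "x \<in> {Inf S<..<Sup S}" using e(1) by simp
  next
    fix x assume x: "x \<in> {Inf S<..<Sup S}"
    obtain y where y: "y \<in> S" "y < x" using x cInf_lessD[OF assms(4)] by auto
    obtain z where z: "z \<in> S" "x < z" using x less_cSup_iff[OF assms(4) bd(1)] by auto
    show "x \<in> S" using connectedD_interval[OF assms(2) y(1) z(1)] y z by simp
  qed
  then show "Inf S < Sup S" using assms(4) by force
qed

lemma component_of_clopen:
  assumes "connected G" "G \<noteq> {}" "G \<subseteq> Y" "openin (top_of_set T) G" "openin (top_of_set T) (Y - G)"
  shows "G \<in> components Y"
proof -
  obtain x where x: "x \<in> G" using assms(2) by auto
  have "x \<in> Y" using x assms(3) by blast
  then have "x \<in> connected_component_set Y x" by (simp add: connected_component_refl_eq)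
  then have "connected_component_set Y x \<subseteq> G"
    by (intro connected_subset_of_separation[OF connected_connected_component assms(4,5)])
      (use x connected_component_subset[of Y x] in blast)+
  moreover have "G \<subseteq> connected_component_set Y x"
    using connected_component_maximal[OF x assms(1,3)] .
  ultimately show ?thesis using x assms(3) by (auto simp: components_def)
qed

context level_structure begin

text \<open>Reversing the sign of \<open>f\<close> keeps the level components and exchanges the two
  ends of each edge, so only one end has to be treated.\<close>

lemma level_structure_uminus: "level_structure T (\<lambda>x. - f x) V"
proof
  show "compact T" "connected T" "locally connected T" "finite V"
    using compact_T connected_T locally_connected_T finite_V by blast+
  show "continuous_on T (\<lambda>x. - f x)" using cont by (intro continuous_intros)
  show "V \<subseteq> (\<Union>t. components {z \<in> T. - f z = t})"
  proof
    fix K assume "K \<in> V"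
    then obtain t where "K \<in> components {z \<in> T. f z = t}" using V_levels by auto
    then have "K \<in> components {z \<in> T. - f z = - t}" by simp
    then show "K \<in> (\<Union>t. components {z \<in> T. - f z = t})" by (rule UN_I[OF UNIV_I])
  qed
next
  fix z U assume "z \<in> T - \<Union>V" "topen U" "z \<in> U"
  then obtain B d where B: "topen B" "z \<in> B" "B \<subseteq> U" "0 < d"
    "f ` B = {f z - d<..<f z + d}" "\<And>t. connected (B \<inter> f -` {t})" using box by metis
  have "(\<lambda>x. - f x) ` B = uminus ` (f ` B)" by (simp add: image_image)
  also have "\<dots> = {- f z - d<..<- f z + d}" 
  proof -
    have "- (f z + d) = - f z - d" "- (f z - d) = - f z + d" by simp_all
    then show ?thesis unfolding B(5) image_uminus_greaterThanLessThan by metis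
  qed
  finally have "(\<lambda>x. - f x) ` B = {- f z - d<..<- f z + d}" .
  moreover have "B \<inter> (\<lambda>x. - f x) -` {t} = B \<inter> f -` {- t}" for t by auto
  ultimately show "\<exists>B d. topen B \<and> z \<in> B \<and> B \<subseteq> U \<and> 0 < d \<and>
      (\<lambda>x. - f x) ` B = {- f z - d<..<- f z + d} \<and>
      (\<forall>t. connected (B \<inter> (\<lambda>x. - f x) -` {t}))"
    using B by (intro exI[of _ B] exI[of _ d]) simp
qed

lemma lev_uminus: "level_structure.lev T (\<lambda>x. - f x) = lev"
proof
  interpret neg: level_structure T "\<lambda>x. - f x" V by (rule level_structure_uminus)
  show "neg.lev z = lev z" for z by (simp add: neg.lev_def lev_def)
qed

lemma component_in_R: "W \<in> components R \<Longrightarrow> W \<subseteq> R"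
  by (rule in_components_subset)

lemma topen_component: "W \<in> components R \<Longrightarrow> topen W"
  using topen_R by (rule topen_components)

lemma component_closure:
  assumes "topen Y" "A \<in> components Y" "x \<in> closure A" "x \<in> Y"
  shows "x \<in> A"
proof -
  have "closedin (top_of_set Y) A" using assms(2) by (rule closedin_component)
  then obtain C where "closed C" "A = Y \<inter> C" by (auto simp: closedin_closed)
  then have "closure A \<subseteq> C" by (simp add: closure_minimal)
  then show ?thesis using assms(3,4) \<open>A = Y \<inter> C\<close> by blast
qed

lemma closure_in_T: "A \<subseteq> T \<Longrightarrow> closure A \<subseteq> T"
  by (rule closure_minimal[OF _ closed_T])

lemma closure_meets:
  assumes "x \<in> closure A" "A \<subseteq> T" "topen U" "x \<in> U"
  shows "A \<inter> U \<noteq> {}"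
proof -
  obtain G where G: "open G" "U = T \<inter> G" using assms(3) by (auto simp: openin_open)
  then have "A \<inter> G \<noteq> {}" using assms(1,4) open_Int_closure_eq_empty[of G A] by blast
  then show ?thesis using G assms(2) by blast
qed

text \<open>If a limit point \<open>x\<close> off \<open>W\<close> had the value of some
  \<open>y\<close> in \<open>W\<close>, then points of \<open>W\<close> near \<open>x\<close> would
  have values that \<open>W\<close> also takes in a small tube around \<open>lev y\<close>. Within
  \<open>W\<close> a value determines the level component, so these points would lie in that tube,
  which is chosen away from \<open>x\<close>.\<close>

lemma closure_outside:
  assumes W: "W \<in> components R" and x: "x \<in> closure W" "x \<notin> W"
  shows "f x \<notin> f ` W"
proof
  assume "f x \<in> f ` W"
  then obtain y where y: "y \<in> W" "f y = f x" by (metis imageE)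
  have tW: "tube W" using W by (rule component_tube)
  have WT: "W \<subseteq> T" using component_in_R[OF W] R_subset by blast
  have yR: "y \<in> R" using component_in_R[OF W] y(1) by blast
  have levy: "lev y \<subseteq> W" using tube_lev_subset[OF tW y(1)] .
  then have "lev y \<inter> {x} = {}" using x(2) by blast
  then obtain P Q where PQ: "open P" "open Q" "lev y \<subseteq> P" "{x} \<subseteq> Q" "P \<inter> Q = {}"
    using separation_normal[OF closed_lev closed_singleton] by metis
  have "lev y \<subseteq> T \<inter> P" using PQ(3) lev_subset_T by blast
  then obtain X where X: "tube X" "y \<in> X" "X \<subseteq> T \<inter> P"
    by (rule local_tube[OF yR topen_Int_open[OF topen_T PQ(1)]])
  have "topen (X \<inter> W)" "X \<inter> W \<subseteq> R" using tubeD[OF X(1)] tubeD[OF tW] by blast+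
  then have "open (f ` (X \<inter> W))" by (rule open_image)
  then have "topen (T \<inter> f -` (f ` (X \<inter> W)))" using topen_preimage topen_T by blast
  then have "topen (T \<inter> f -` (f ` (X \<inter> W)) \<inter> Q)" using PQ(2) by (rule topen_Int_open)
  moreover have "x \<in> T \<inter> f -` (f ` (X \<inter> W)) \<inter> Q"
    using PQ(4) closure_in_T[OF WT] x(1) X(2) y by (auto intro!: image_eqI[of _ f y])
  ultimately have "W \<inter> (T \<inter> f -` (f ` (X \<inter> W)) \<inter> Q) \<noteq> {}"
    by (rule closure_meets[OF x(1) WT])
  then obtain w where "w \<in> W \<inter> (T \<inter> f -` (f ` (X \<inter> W)) \<inter> Q)" by (metis ex_in_conv)
  then have w: "w \<in> W" "f w \<in> f ` (X \<inter> W)" "w \<in> Q"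
    by (simp_all only: Int_iff vimage_eq)
  from w(2) obtain p where "f w = f p" "p \<in> X \<inter> W" by (rule imageE)
  then have p: "p \<in> X" "p \<in> W" "f p = f w" by simp_all
  have "lev p = lev w" using tube_lev_eq[OF tW p(2) w(1) p(3)] .
  moreover have "w \<in> lev w" using R_lev_refl component_in_R[OF W] w(1) by blast
  ultimately have "w \<in> X" using tube_lev_subset[OF X(1) p(1)] by blast
  then show False using X(3) w(3) PQ(5) by blast
qed

lemma component_range:
  assumes W: "W \<in> components R"
  obtains a b where "a < b" "f ` W = {a<..<b}"
proof (rule open_interval_real[of "f ` W"])
  show "open (f ` W)" using open_image[OF topen_component[OF W] component_in_R[OF W]] .
  show "connected (f ` W)" using tubeD(3)[OF component_tube[OF W]] .
  have "bounded (f ` T)"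
    using compact_continuous_image[OF cont compact_T] by (rule compact_imp_bounded)
  moreover have "f ` W \<subseteq> f ` T" using component_in_R[OF W] R_subset by blast
  ultimately show "bounded (f ` W)" by (rule bounded_subset)
  show "f ` W \<noteq> {}" using in_components_nonempty[OF W] by blast
qed (rule that)

lemma closure_le:
  assumes "x \<in> closure A" "A \<subseteq> T" "\<And>y. y \<in> A \<Longrightarrow> f y \<le> c"
  shows "f x \<le> c"
proof (rule ccontr)
  assume "\<not> f x \<le> c"
  moreover have "topen (T \<inter> f -` {c<..})" by (rule topen_preimage[OF topen_T]) simp
  moreover have "x \<in> T" using assms(1,2) closure_in_T by blast
  ultimately have "A \<inter> (T \<inter> f -` {c<..}) \<noteq> {}" by (intro closure_meets[OF assms(1,2)]) auto
  then show False using assms(3) by force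
qed

lemma closure_ge:
  assumes "x \<in> closure A" "A \<subseteq> T" "\<And>y. y \<in> A \<Longrightarrow> f y \<ge> c"
  shows "f x \<ge> c"
proof (rule ccontr)
  assume "\<not> f x \<ge> c"
  moreover have "topen (T \<inter> f -` {..<c})" by (rule topen_preimage[OF topen_T]) simp
  moreover have "x \<in> T" using assms(1,2) closure_in_T by blast
  ultimately have "A \<inter> (T \<inter> f -` {..<c}) \<noteq> {}" by (intro closure_meets[OF assms(1,2)]) auto
  then show False using assms(3) by force
qed

text \<open>The closures of the parts of \<open>W\<close> above \<open>l n\<close> form a decreasing
  sequence of compact connected sets, so their intersection \<open>E\<close> is connected and
  nonempty. It lies on the level \<open>b\<close>, a value not attained on \<open>W\<close>, and
  hence in a single vertex.\<close>

lemma upper_end: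
  assumes W: "W \<in> components R" and ab: "a < b" "f ` W = {a<..<b}"
  obtains w where "w \<in> V" "\<forall>x\<in>w. f x = b"
    "\<forall>x\<in>closure W. f x = b \<longrightarrow> x \<in> w"
    "\<forall>c. c < b \<longrightarrow> closure (W \<inter> f -` {c<..}) \<inter> w \<noteq> {}"
proof -
  have tW: "tube W" using W by (rule component_tube)
  have WT: "W \<subseteq> T" using component_in_R[OF W] R_subset by blast
  have fW: "f y < b" if "y \<in> W" for y using imageI[OF that, of f] ab(2) by auto
  \<comment> \<open>These values increase to \<open>b\<close>; the summand 2 in the denominator
    makes already \<open>l 0\<close> larger than \<open>a\<close>.\<close>
  define l where "l n = b - (b - a) / (real n + 2)" for n :: nat
  have l: "a < l n" "l n < b" for n
  proof -
    show "l n < b" using ab by (simp add: l_def)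
    have "(b - a) / (real n + 2) < (b - a) / 1" using ab by (intro divide_strict_left_mono) auto
    then show "a < l n" by (simp add: l_def)
  qed
  have l_mono: "l m \<le> l n" if "m \<le> n" for m n
    unfolding l_def using ab that by (intro diff_left_mono divide_left_mono) auto
  have l_ex: "\<exists>n. c < l n" if "c < b" for c
  proof -
    obtain n where n: "(b - a) / (b - c) < real n" using reals_Archimedean2 by blast
    then have "b - a < real n * (b - c)" using that by (simp add: divide_less_eq)
    also have "\<dots> \<le> (real n + 2) * (b - c)" using that by (intro mult_right_mono) auto
    finally have "(b - a) / (real n + 2) < b - c" by (simp add: divide_less_eq mult.commute)
    then show ?thesis by (intro exI[of _ n]) (simp add: l_def)
  qed
  define A where "A n = W \<inter> f -` {l n<..}" for n
  have AW: "A n \<subseteq> W" "A n \<subseteq> T" for n using WT by (auto simp: A_def)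
  have A_ne: "A n \<noteq> {}" for n
  proof -
    have "(l n + b) / 2 \<in> f ` W" using l[of n] ab(2) by auto
    then show ?thesis using l[of n] by (auto simp: A_def)
  qed
  have A_mono: "A n \<subseteq> A m" if "m \<le> n" for m n using l_mono[OF that] by (auto simp: A_def)
  have cl: "compact (closure (A n))" "connected (closure (A n))" for n
  proof -
    show "compact (closure (A n))"
      using compact_T AW(2) closure_in_T by (meson closed_closure closed_subset closedin_compact)
    show "connected (closure (A n))"
      unfolding A_def by (rule connected_imp_connected_closure) (rule connected_tube_preimage[OF tW], simp)
  qed
  define E where "E = \<Inter> (range (\<lambda>n. closure (A n)))"
  have conE: "connected E"
    unfolding E_def by (rule connected_nest[OF cl closure_mono[OF A_mono]])
  have "E \<noteq> {}"
    unfolding E_def by (rule compact_nest[OF cl(1) _ closure_mono[OF A_mono]]) (simp add: A_ne)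
  then obtain e where e: "e \<in> E" by blast
  have ET: "E \<subseteq> T" unfolding E_def using AW(2)[of 0] closure_in_T by blast
  have EW: "E \<subseteq> closure W" unfolding E_def using closure_mono[OF AW(1)[of 0]] by blast
  have fE: "f x = b" if x: "x \<in> E" for x
  proof -
    have "f x \<le> b" by (rule closure_le[of x W]) (use x EW WT fW in \<open>auto simp: less_imp_le\<close>)
    moreover have "l n \<le> f x" for n
      by (rule closure_ge[of x "A n"]) (use x E_def AW in \<open>auto simp: A_def less_imp_le\<close>)
    ultimately show ?thesis using l_ex[of "f x"] by (metis less_eq_real_def not_less)
  qed
  have "e \<notin> R"
  proof
    assume "e \<in> R"
    then have "e \<in> W" using component_closure[OF topen_R W] EW e by blast
    then have "b \<in> {a<..<b}" using fE[OF e] ab(2) by (metis imageI)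
    then show False by simp
  qed
  then obtain w where w: "w \<in> V" "e \<in> w" using e ET by (auto simp: R_def)
  have w_lev: "w = lev e" using vertex_lev[OF w] .
  have Ew: "E \<subseteq> w" unfolding w_lev by (rule lev_maximal[OF conE ET e]) (simp add: fE e)
  show thesis
  proof (rule that[OF w(1)]; intro ballI allI impI)
    show "f x = b" if "x \<in> w" for x using f_lev[of x e] that w_lev fE[OF e] by simp
    show "x \<in> w" if x: "x \<in> closure W" "f x = b" for x
    proof -
      have "x \<in> T" using closure_in_T[OF WT] x(1) by blast
      have "x \<in> closure (A n)" for n
        unfolding closure_iff_nhds_not_empty
      proof (intro allI impI)
        fix S G assume G: "x \<in> G" "G \<subseteq> S" "open G"
        have "topen (T \<inter> f -` {l n<..} \<inter> G)"
          by (rule topen_Int_open[OF topen_preimage[OF topen_T] G(3)]) simp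
        moreover have "x \<in> T \<inter> f -` {l n<..} \<inter> G" using \<open>x \<in> T\<close> x(2) l(2) G(1) by simp
        ultimately have "W \<inter> (T \<inter> f -` {l n<..} \<inter> G) \<noteq> {}" by (rule closure_meets[OF x(1) WT])
        then show "A n \<inter> S \<noteq> {}" using G(2) by (auto simp: A_def)
      qed
      then show ?thesis using Ew by (auto simp: E_def)
    qed
    show "closure (W \<inter> f -` {c<..}) \<inter> w \<noteq> {}" if cb: "c < b" for c
    proof -
      obtain n where n: "c < l n" using l_ex[OF cb] by auto
      then have "A n \<subseteq> W \<inter> f -` {c<..}" by (auto simp: A_def)
      then have "closure (A n) \<subseteq> closure (W \<inter> f -` {c<..})" by (rule closure_mono)
      then show ?thesis using e E_def Ew by blast
    qed
  qed
qed

lemma lower_end: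
  assumes W: "W \<in> components R" and ab: "a < b" "f ` W = {a<..<b}"
  obtains u where "u \<in> V" "\<forall>x\<in>u. f x = a"
    "\<forall>x\<in>closure W. f x = a \<longrightarrow> x \<in> u"
    "\<forall>c. a < c \<longrightarrow> closure (W \<inter> f -` {..<c}) \<inter> u \<noteq> {}"
proof -
  interpret neg: level_structure T "\<lambda>x. - f x" V by (rule level_structure_uminus)
  have "(\<lambda>x. - f x) ` W = uminus ` (f ` W)" by (simp add: image_image)
  then have im: "(\<lambda>x. - f x) ` W = {-b<..<-a}" by (simp add: ab(2))
  show thesis
  proof (rule neg.upper_end[OF W _ im])
    show "- b < - a" using ab by simp
    fix u assume u: "u \<in> V" "\<forall>x\<in>u. - f x = - a"
      "\<forall>x\<in>closure W. - f x = - a \<longrightarrow> x \<in> u"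
      "\<forall>c. c < - a \<longrightarrow> closure (W \<inter> (\<lambda>x. - f x) -` {c<..}) \<inter> u \<noteq> {}"
    show thesis
    proof (rule that[OF u(1)]; intro ballI allI impI)
      show "f x = a" if "x \<in> u" for x using bspec[OF u(2) that] by simp
      show "x \<in> u" if "x \<in> closure W" "f x = a" for x using bspec[OF u(3) that(1)] that(2) by simp
      fix c assume "a < c"
      then have "closure (W \<inter> (\<lambda>x. - f x) -` {- c<..}) \<inter> u \<noteq> {}" using spec[OF u(4), of "-c"] by simp
      moreover have "W \<inter> (\<lambda>x. - f x) -` {- c<..} = W \<inter> f -` {..<c}" by auto
      ultimately show "closure (W \<inter> f -` {..<c}) \<inter> u \<noteq> {}" by simp
    qed
  qed
qed

text \<open>Edges are oriented by \<open>f\<close>, with \<open>u\<close> at the lower and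
  \<open>w\<close> at the upper end; as \<open>f\<close> differs on them, there are no loops. The
  last clause asks that the part of \<open>W\<close> beyond any of its levels still accumulates at
  the corresponding end; this decides on which side of \<open>lev z\<close> an end lies.\<close>

definition ends :: "'a set \<Rightarrow> 'a set \<Rightarrow> 'a set \<Rightarrow> bool" where
  "ends W u w \<longleftrightarrow> u \<in> V \<and> w \<in> V \<and> closure W \<subseteq> W \<union> u \<union> w \<and>
     (\<exists>a b. a < b \<and> f ` W = {a<..<b} \<and> (\<forall>x\<in>u. f x = a) \<and> (\<forall>x\<in>w. f x = b)) \<and>
     (\<forall>z\<in>W. closure (W \<inter> f -` {..<f z}) \<inter> u \<noteq> {} \<and> closure (W \<inter> f -` {f z<..}) \<inter> w \<noteq> {})"

lemma ends_exist:
  assumes W: "W \<in> components R"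
  obtains u w where "ends W u w"
proof -
  obtain a b where ab: "a < b" "f ` W = {a<..<b}" using component_range[OF W] .
  have WT: "W \<subseteq> T" using component_in_R[OF W] R_subset by blast
  have fW: "a < f z" "f z < b" if "z \<in> W" for z using imageI[OF that, of f] ab(2) by auto
  obtain u where u: "u \<in> V" "\<forall>x\<in>u. f x = a"
    "\<forall>x\<in>closure W. f x = a \<longrightarrow> x \<in> u"
    "\<forall>c. a < c \<longrightarrow> closure (W \<inter> f -` {..<c}) \<inter> u \<noteq> {}"
    by (rule lower_end[OF W ab])
  obtain w where w: "w \<in> V" "\<forall>x\<in>w. f x = b"
    "\<forall>x\<in>closure W. f x = b \<longrightarrow> x \<in> w"
    "\<forall>c. c < b \<longrightarrow> closure (W \<inter> f -` {c<..}) \<inter> w \<noteq> {}"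
    by (rule upper_end[OF W ab])
  have "closure W \<subseteq> W \<union> u \<union> w"
  proof
    fix x assume x: "x \<in> closure W"
    show "x \<in> W \<union> u \<union> w"
    proof (cases "x \<in> W")
      case False
      have "f x \<le> b" by (rule closure_le[OF x WT]) (use fW in \<open>auto simp: less_imp_le\<close>)
      moreover have "a \<le> f x" by (rule closure_ge[OF x WT]) (use fW in \<open>auto simp: less_imp_le\<close>)
      moreover have "f x \<notin> {a<..<b}" using closure_outside[OF W x False] ab(2) by simp
      ultimately have "f x = a \<or> f x = b" by auto
      then show ?thesis using u(3) w(3) x by blast
    qed simp
  qed
  moreover have "\<exists>a b. a < b \<and> f ` W = {a<..<b} \<and> (\<forall>x\<in>u. f x = a) \<and> (\<forall>x\<in>w. f x = b)"
    by (rule exI[of _ a], rule exI[of _ b]) (use u(2) w(2) ab in simp)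
  moreover have "\<forall>z\<in>W. closure (W \<inter> f -` {..<f z}) \<inter> u \<noteq> {} \<and>
      closure (W \<inter> f -` {f z<..}) \<inter> w \<noteq> {}"
    using u(4) w(4) fW by simp
  ultimately have "ends W u w" unfolding ends_def using u(1) w(1) by simp
  then show thesis by (rule that)
qed


section \<open>Sides of a regular level component\<close>

lemma component_eq: "W \<in> components R \<Longrightarrow> z \<in> W \<Longrightarrow> connected_component_set R z = W"
  by (metis components_iff connected_component_eq)

lemma component_T: "W \<in> components R \<Longrightarrow> W \<subseteq> T"
  using component_in_R R_subset by blast

lemma topen_compl_lev: "topen (T - lev z)"
  by (rule topen_diff[OF topen_T closed_lev])

text \<open>Without such a limit point \<open>A\<close> would be clopen in the connected space
  \<open>T\<close>. Hence every component of a complement accumulates at the removed set.\<close>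

lemma open_component_not_closed:
  assumes "A \<in> components Y" "topen Y" "Y \<noteq> T"
  obtains x where "x \<in> closure A" "x \<in> T" "x \<notin> Y"
proof -
  have A: "topen A" "A \<noteq> {}" "A \<subseteq> Y"
    using topen_components[OF assms(2,1)] in_components_nonempty[OF assms(1)]
      in_components_subset[OF assms(1)] by blast+
  have YT: "Y \<subseteq> T" using assms(2) topen_subset by blast
  have "\<exists>x. x \<in> closure A \<and> x \<notin> A"
  proof (rule ccontr)
    assume "\<nexists>x. x \<in> closure A \<and> x \<notin> A"
    then have "closed A" by (metis closure_subset closure_closed closed_closure subsetI subset_antisym)
    then have "topen (T - A)" using topen_diff[OF topen_T] by blast
    then have "T \<subseteq> A"
      using connected_subset_of_separation[OF connected_T A(1), of "T - A"] A YT by blast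
    then show False using A YT assms(3) by blast
  qed
  then obtain x where x: "x \<in> closure A" "x \<notin> A" by blast
  have "x \<in> T" using closure_in_T[of A] A YT x(1) by blast
  moreover have "x \<notin> Y" using component_closure[OF assms(2,1) x(1)] x(2) by blast
  ultimately show thesis using that x(1) by blast
qed

text \<open>Every complementary component accumulates at \<open>lev z\<close> and hence enters its
  neighbourhood \<open>W\<close>. There it meets the part below or the part above
  \<open>lev z\<close>, and each of these is connected. So there are at most two components;
  \<open>A\<close> and \<open>B\<close> may still coincide here.\<close>

lemma level_sides:
  assumes W: "W \<in> components R" and z: "z \<in> W"
  obtains A B where "A \<in> components (T - lev z)" "B \<in> components (T - lev z)"
    "components (T - lev z) = {A, B}"
    "W \<inter> f -` {..<f z} \<noteq> {}" "W \<inter> f -` {f z<..} \<noteq> {}"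
    "W \<inter> f -` {..<f z} \<subseteq> A" "W \<inter> f -` {f z<..} \<subseteq> B"
proof -
  have tW: "tube W" using W by (rule component_tube)
  have WT: "W \<subseteq> T" using W by (rule component_T)
  have zR: "z \<in> R" using component_in_R[OF W] z by blast
  have op: "open (f ` W)" using open_image[OF topen_component[OF W] component_in_R[OF W]] .
  then obtain e where e: "e > 0" "ball (f z) e \<subseteq> f ` W" using z open_contains_ball by blast
  have "f z - e/2 \<in> f ` W" "f z + e/2 \<in> f ` W" using e by (auto simp: dist_real_def subset_iff)
  then obtain x1 x2 where x12: "x1 \<in> W" "f x1 = f z - e/2" "x2 \<in> W" "f x2 = f z + e/2" by (metis imageE)
  have ne: "W \<inter> f -` {..<f z} \<noteq> {}" "W \<inter> f -` {f z<..} \<noteq> {}"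
  proof -
    have "x1 \<in> W \<inter> f -` {..<f z}" using x12(1,2) e(1) by simp
    then show "W \<inter> f -` {..<f z} \<noteq> {}" by blast
    have "x2 \<in> W \<inter> f -` {f z<..}" using x12(3,4) e(1) by simp
    then show "W \<inter> f -` {f z<..} \<noteq> {}" by blast
  qed
  have con: "connected (W \<inter> f -` {..<f z})" "connected (W \<inter> f -` {f z<..})"
    by (rule connected_tube_preimage[OF tW], simp)+
  have sub: "W \<inter> f -` {..<f z} \<subseteq> T - lev z" "W \<inter> f -` {f z<..} \<subseteq> T - lev z"
  proof -
    have "x \<notin> lev z" if "f x \<noteq> f z" for x using f_lev[of x z] that by blast
    then show "W \<inter> f -` {..<f z} \<subseteq> T - lev z" "W \<inter> f -` {f z<..} \<subseteq> T - lev z"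
      using WT by auto
  qed
  have neT: "T - lev z \<noteq> {}" using sub ne by blast
  obtain A where A: "A \<in> components (T - lev z)" "W \<inter> f -` {..<f z} \<subseteq> A"
    using exists_component_superset[OF sub(1) neT con(1)] by blast
  obtain B where B: "B \<in> components (T - lev z)" "W \<inter> f -` {f z<..} \<subseteq> B"
    using exists_component_superset[OF sub(2) neT con(2)] by blast
  have zlev: "z \<in> lev z" using zR by (rule R_lev_refl)
  have only: "C = A \<or> C = B" if C: "C \<in> components (T - lev z)" for C
  proof -
    have "T - lev z \<noteq> T" using zlev zR R_subset by blast
    then obtain x where x: "x \<in> closure C" "x \<in> T" "x \<notin> T - lev z"
      by (rule open_component_not_closed[OF C topen_compl_lev])
    then have xl: "x \<in> lev z" by blast
    have CT: "C \<subseteq> T - lev z" using C by (rule in_components_subset)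
    have "x \<in> W" using xl tube_lev_subset[OF tW z] by blast
    then have "C \<inter> W \<noteq> {}" using closure_meets[OF x(1) _ topen_component[OF W]] CT by blast
    then obtain y where y: "y \<in> C" "y \<in> W" by blast
    have "y \<notin> lev z" using y(1) CT by blast
    then have "f y \<noteq> f z" using tW z y(2) unfolding tube_def by metis
    then have "f y < f z \<or> f z < f y" by linarith
    then have "y \<in> A \<or> y \<in> B" using A(2) B(2) y(2) by fastforce
    then show ?thesis using components_eq[OF C A(1)] components_eq[OF C B(1)] y(1) by blast
  qed
  then have "components (T - lev z) = {A, B}" using A(1) B(1) by blast
  then show thesis using that A B ne by blast
qed

end

section \<open>The descent to the central vertex\<close>

text \<open>For the torus, \<open>bad\<close> will be \<open>essential\<close>. The descent relies
  on three properties: it is monotone, it passes from the union of a chain of open sets to a member,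
  and it holds for exactly one of two different sides of a regular level component. The tree
  hypothesis is present through \<open>finite_components\<close> and
  \<open>level_separates\<close>.\<close>

locale level_tree = level_structure +
  fixes bad :: "'a set \<Rightarrow> bool"
  assumes finite_components: "finite (components (T - \<Union>V))"
    and level_separates: "z \<in> T - \<Union>V \<Longrightarrow>
      \<not> connected (T - connected_component_set {w \<in> T. f w = f z} z)"
    and bad_mono: "A \<subseteq> B \<Longrightarrow> bad A \<Longrightarrow> bad B"
    and bad_Union: "\<lbrakk>\<U> \<noteq> {}; \<And>A. A \<in> \<U> \<Longrightarrow> openin (top_of_set T) A;
      \<And>A B. A \<in> \<U> \<Longrightarrow> B \<in> \<U> \<Longrightarrow> A \<subseteq> B \<or> B \<subseteq> A; bad (\<Union>\<U>)\<rbrakk> \<Longrightarrow> \<exists>A\<in>\<U>. bad A"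
    and bad_sides: "\<lbrakk>z \<in> T - \<Union>V;
      A \<in> components (T - connected_component_set {w \<in> T. f w = f z} z);
      B \<in> components (T - connected_component_set {w \<in> T. f w = f z} z); A \<noteq> B\<rbrakk> \<Longrightarrow> bad A \<noteq> bad B"
begin

lemma finite_edges: "finite (components R)"
  using finite_components by (simp add: R_def)

lemma separates: "z \<in> R \<Longrightarrow> \<not> connected (T - lev z)"
  unfolding R_def lev_def by (rule level_separates)

lemma sides: "z \<in> R \<Longrightarrow> A \<in> components (T - lev z) \<Longrightarrow> B \<in> components (T - lev z) \<Longrightarrow> A \<noteq> B \<Longrightarrow> bad A \<noteq> bad B"
  unfolding R_def lev_def by (rule bad_sides)

lemma level_tree_uminus: "level_tree T (\<lambda>x. - f x) V bad"
proof -
  interpret neg: level_structure T "\<lambda>x. - f x" V by (rule level_structure_uminus)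
  show ?thesis
  proof
    show "finite (components (T - \<Union>V))" by (rule finite_components)
    fix z assume z: "z \<in> T - \<Union>V"
    show "\<not> connected (T - connected_component_set {w \<in> T. - f w = - f z} z)"
      using level_separates[OF z] by simp
    show "bad A \<noteq> bad B"
      if "A \<in> components (T - connected_component_set {w \<in> T. - f w = - f z} z)"
        "B \<in> components (T - connected_component_set {w \<in> T. - f w = - f z} z)" "A \<noteq> B" for A B
      using bad_sides[OF z, of A B] that by simp
  next
    show "bad A \<Longrightarrow> bad B" if "A \<subseteq> B" for A B using bad_mono[OF that] .
  next
    fix \<U> assume "\<U> \<noteq> {}" "\<And>A. A \<in> \<U> \<Longrightarrow> topen A"
      "\<And>A B. A \<in> \<U> \<Longrightarrow> B \<in> \<U> \<Longrightarrow> A \<subseteq> B \<or> B \<subseteq> A" "bad (\<Union>\<U>)"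
    then show "\<exists>A\<in>\<U>. bad A" by (rule bad_Union)
  qed
qed

text \<open>The side of \<open>lev z\<close> entered by descending along the edge through
  \<open>z\<close>. Taking the union of all components met avoids a choice; \<open>two_sides\<close>
  shows that there is only one.\<close>

definition Lo :: "'a \<Rightarrow> 'a set" where
  "Lo z = \<Union>{A \<in> components (T - lev z). A \<inter> (connected_component_set R z \<inter> f -` {..<f z}) \<noteq> {}}"

definition Hi :: "'a \<Rightarrow> 'a set" where
  "Hi z = \<Union>{A \<in> components (T - lev z). A \<inter> (connected_component_set R z \<inter> f -` {f z<..}) \<noteq> {}}"

lemma union_single_component:
  assumes "A \<in> components Y" "X \<subseteq> A" "X \<noteq> {}"
  shows "\<Union>{B \<in> components Y. B \<inter> X \<noteq> {}} = A"
proof -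
  have "{B \<in> components Y. B \<inter> X \<noteq> {}} = {A}"
  proof (intro equalityI subsetI)
    fix B assume B: "B \<in> {B \<in> components Y. B \<inter> X \<noteq> {}}"
    then have "B \<inter> A \<noteq> {}" using assms(2) by blast
    then have "B = A" using B assms(1) components_eq[of B Y A] by blast
    then show "B \<in> {A}" by simp
  qed (use assms in auto)
  then show ?thesis by simp
qed

lemma two_sides:
  assumes W: "W \<in> components R" and z: "z \<in> W"
  shows "Lo z \<in> components (T - lev z)" "Hi z \<in> components (T - lev z)" "Lo z \<noteq> Hi z"
    "W \<inter> f -` {..<f z} \<subseteq> Lo z" "W \<inter> f -` {f z<..} \<subseteq> Hi z" "Lo z \<union> Hi z = T - lev z"
proof -
  obtain A B where A: "A \<in> components (T - lev z)" and B: "B \<in> components (T - lev z)"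
    and AB: "components (T - lev z) = {A, B}"
    and ne: "W \<inter> f -` {..<f z} \<noteq> {}" "W \<inter> f -` {f z<..} \<noteq> {}"
    and sub: "W \<inter> f -` {..<f z} \<subseteq> A" "W \<inter> f -` {f z<..} \<subseteq> B"
    by (rule level_sides[OF W z])
  have cW: "connected_component_set R z = W" using component_eq[OF W z] .
  have zR: "z \<in> R" using component_in_R[OF W] z by blast
  have LA: "Lo z = A" unfolding Lo_def cW by (rule union_single_component[OF A sub(1) ne(1)])
  have HB: "Hi z = B" unfolding Hi_def cW by (rule union_single_component[OF B sub(2) ne(2)])
  show "Lo z \<in> components (T - lev z)" "Hi z \<in> components (T - lev z)"
    "W \<inter> f -` {..<f z} \<subseteq> Lo z" "W \<inter> f -` {f z<..} \<subseteq> Hi z"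
    using LA HB A B sub by simp_all
  have UC: "\<Union>(components (T - lev z)) = T - lev z" by (rule Union_components)
  then show "Lo z \<union> Hi z = T - lev z" using AB LA HB by simp
  show "Lo z \<noteq> Hi z"
  proof
    assume "Lo z = Hi z"
    then have "T - lev z = A" using UC AB LA HB by simp
    then have "connected (T - lev z)" using in_components_connected[OF A] by simp
    then show False using separates[OF zR] by simp
  qed
qed

lemma sides_facts:
  assumes W: "W \<in> components R" and z: "z \<in> W"
  shows "topen (Lo z)" "topen (Hi z)" "connected (Lo z)" "connected (Hi z)" "Lo z \<inter> Hi z = {}"
    "Lo z \<inter> lev z = {}" "Hi z \<inter> lev z = {}" "bad (Lo z) \<noteq> bad (Hi z)" "lev z \<subseteq> W" "z \<in> lev z"
    "Lo z \<subseteq> T" "Hi z \<subseteq> T"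
proof -
  note t = two_sides[OF W z]
  show "topen (Lo z)" "topen (Hi z)"
    using topen_components[OF topen_compl_lev] t(1,2) by blast+
  show "connected (Lo z)" "connected (Hi z)" using t(1,2) in_components_connected by blast+
  show "Lo z \<inter> Hi z = {}" using components_eq[OF t(1,2)] t(3) by blast
  show "Lo z \<inter> lev z = {}" "Hi z \<inter> lev z = {}" "Lo z \<subseteq> T" "Hi z \<subseteq> T" using t(6) by blast+
  have zR: "z \<in> R" using component_in_R[OF W] z by blast
  show "bad (Lo z) \<noteq> bad (Hi z)" using sides[OF zR t(1,2,3)] .
  show "lev z \<subseteq> W" using tube_lev_subset[OF component_tube[OF W] z] .
  show "z \<in> lev z" using zR by (rule R_lev_refl)
qed

text \<open>\<open>Lo z\<close> is connected, avoids \<open>lev z'\<close>, which lies in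
  \<open>Hi z\<close>, and shares the lowest part of the edge with \<open>Lo z'\<close>; so the
  component \<open>Lo z'\<close> contains it. The upper sides behave symmetrically.\<close>

lemma sides_mono:
  assumes W: "W \<in> components R" and z: "z \<in> W" "z' \<in> W" "f z < f z'"
  shows "Lo z \<subseteq> Lo z'" "lev z \<subseteq> Lo z'" "Hi z' \<subseteq> Hi z" "lev z' \<subseteq> Hi z"
proof -
  note t = two_sides[OF W z(1)] and t' = two_sides[OF W z(2)]
  note s = sides_facts[OF W z(1)] and s' = sides_facts[OF W z(2)]
  have lz: "lev z \<subseteq> W \<inter> f -` {..<f z'}" using s(9) f_lev z(3) by fastforce
  then show l: "lev z \<subseteq> Lo z'" using t'(4) by blast
  have lz': "lev z' \<subseteq> W \<inter> f -` {f z<..}" using s'(9) f_lev z(3) by fastforce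
  then show l': "lev z' \<subseteq> Hi z" using t(5) by blast
  have ex: "\<exists>y. y \<in> W \<and> f z < f y \<and> f y < f z'"
  proof -
    have "connected (f ` W)" using tubeD(3)[OF component_tube[OF W]] .
    then have "(f z + f z')/2 \<in> f ` W"
      using connectedD_interval[of "f ` W" "f z" "f z'" "(f z + f z')/2"] z by simp
    then obtain y where "y \<in> W" "f y = (f z + f z')/2" by (metis imageE)
    then show ?thesis using z(3) by (intro exI[of _ y]) simp
  qed
  have below: "W \<inter> f -` {..<f z} \<noteq> {}" "W \<inter> f -` {f z'<..} \<noteq> {}"
  proof -
    obtain a b where ab: "a < b" "f ` W = {a<..<b}" using component_range[OF W] .
    have fz: "a < f z" "f z' < b" using imageI[OF z(1), of f] imageI[OF z(2), of f] ab(2) by auto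
    have "(a + f z)/2 \<in> f ` W" "(f z' + b)/2 \<in> f ` W" using fz z(3) ab(2) by auto
    then obtain p q where "p \<in> W" "f p = (a + f z)/2" "q \<in> W" "f q = (f z' + b)/2" by (metis imageE)
    then have "p \<in> W \<inter> f -` {..<f z}" "q \<in> W \<inter> f -` {f z'<..}" using fz by simp_all
    then show "W \<inter> f -` {..<f z} \<noteq> {}" "W \<inter> f -` {f z'<..} \<noteq> {}" by blast+
  qed
  show "Lo z \<subseteq> Lo z'"
  proof (rule components_maximal[OF t'(1) s(3)])
    show "Lo z \<subseteq> T - lev z'" using s(5,11) l' by blast
    have "W \<inter> f -` {..<f z} \<subseteq> Lo z \<inter> Lo z'" using t(4) t'(4) z(3) by fastforce
    then show "Lo z' \<inter> Lo z \<noteq> {}" using below(1) by blast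
  qed
  show "Hi z' \<subseteq> Hi z"
  proof (rule components_maximal[OF t(2) s'(4)])
    show "Hi z' \<subseteq> T - lev z" using s'(5,12) l by blast
    have "W \<inter> f -` {f z'<..} \<subseteq> Hi z \<inter> Hi z'" using t(5) t'(5) z(3) by fastforce
    then show "Hi z \<inter> Hi z' \<noteq> {}" using below(2) by blast
  qed
qed

lemma sides_cong:
  assumes W: "W \<in> components R" and z: "z \<in> W" "z' \<in> W" "f z = f z'"
  shows "Lo z = Lo z'" "Hi z = Hi z'"
proof -
  have "lev z = lev z'" using tube_lev_eq[OF component_tube[OF W] z] .
  then show "Lo z = Lo z'" "Hi z = Hi z'"
    unfolding Lo_def Hi_def using component_eq[OF W z(1)] component_eq[OF W z(2)] z(3) by simp_all
qed

text \<open>A vertex is connected and disjoint from \<open>lev z\<close>, so it lies on one side;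
  the part of the edge that accumulates at it decides on which.\<close>

lemma ends_sides:
  assumes W: "W \<in> components R" and e: "ends W u w" and z: "z \<in> W"
  shows "u \<subseteq> Lo z" "w \<subseteq> Hi z"
proof -
  note t = two_sides[OF W z] and s = sides_facts[OF W z]
  have uw: "u \<in> V" "w \<in> V" using e by (auto simp: ends_def)
  have lR: "lev z \<subseteq> R" using s(9) component_in_R[OF W] by blast
  have sub: "u \<subseteq> Lo z \<union> Hi z" "w \<subseteq> Lo z \<union> Hi z"
    using vertex_subset_T[OF uw(1)] vertex_subset_T[OF uw(2)] uw lR unfolding t(6) R_def by blast+
  have WT: "W \<inter> f -` J \<subseteq> T" for J using component_T[OF W] by blast
  have cl: "closure (W \<inter> f -` {..<f z}) \<inter> u \<noteq> {}" "closure (W \<inter> f -` {f z<..}) \<inter> w \<noteq> {}"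
    using e z unfolding ends_def by blast+
  obtain x where x: "x \<in> closure (W \<inter> f -` {..<f z})" "x \<in> u" using cl(1) by blast
  have "x \<notin> Hi z"
  proof
    assume "x \<in> Hi z"
    from closure_meets[OF x(1) WT s(2) this] show False using t(4) s(5) by blast
  qed
  then have "Lo z \<inter> u \<noteq> {}" using x(2) sub(1) by blast
  then show "u \<subseteq> Lo z"
    using connected_subset_of_separation[OF connected_vertex[OF uw(1)] s(1,2) sub(1)] s(5) by blast
  obtain y where y: "y \<in> closure (W \<inter> f -` {f z<..})" "y \<in> w" using cl(2) by blast
  have "y \<notin> Lo z"
  proof
    assume "y \<in> Lo z"
    from closure_meets[OF y(1) WT s(1) this] show False using t(5) s(5) by blast
  qed
  then have "Hi z \<inter> w \<noteq> {}" using y(2) sub(2) by blast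
  then show "w \<subseteq> Hi z"
    using connected_subset_of_separation[OF connected_vertex[OF uw(2)] s(2,1)] sub(2) s(5) by blast
qed

text \<open>Whatever lay between two levels of the edge but off the edge would be clopen in
  \<open>T\<close>: the closure of \<open>W\<close> adds only the ends, which lie outside the
  region, and the rest of \<open>T\<close> is the union of the open sets \<open>Hi z'\<close>,
  \<open>Lo z\<close> and \<open>W\<close>.\<close>

lemma between_sides:
  assumes W: "W \<in> components R" and z: "z \<in> W" "z' \<in> W" "f z < f z'"
  shows "Lo z' \<inter> Hi z \<subseteq> W"
proof (rule ccontr)
  note t = two_sides[OF W z(1)] and t' = two_sides[OF W z(2)]
  note s = sides_facts[OF W z(1)] and s' = sides_facts[OF W z(2)]
  obtain u w where e: "ends W u w" using ends_exist[OF W] .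
  have uw: "u \<in> V" "w \<in> V" "closure W \<subseteq> W \<union> u \<union> w" using e by (auto simp: ends_def)
  have cl: "closed (closure W \<union> u \<union> w)" using closed_vertex uw(1,2) by blast
  define Z where "Z = Lo z' \<inter> Hi z - W"
  assume "\<not> Lo z' \<inter> Hi z \<subseteq> W"
  then have Zne: "Z \<noteq> {}" by (auto simp: Z_def)
  have "Z = Lo z' \<inter> Hi z - (closure W \<union> u \<union> w)"
    using ends_sides[OF W e z(1)] ends_sides[OF W e z(2)] s(5) s'(5) uw(3) closure_subset[of W]
    unfolding Z_def by blast
  moreover have "topen (Lo z' \<inter> Hi z)" using s'(1) s(2) by (rule openin_Int)
  ultimately have oZ: "topen Z" using topen_diff[OF _ cl] by simp
  have "T - Z = Hi z' \<union> Lo z \<union> W"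
  proof -
    have "T = Lo z \<union> Hi z \<union> lev z" "T = Lo z' \<union> Hi z' \<union> lev z'"
      using t(6) t'(6) lev_subset_T by blast+
    moreover have "Lo z' \<inter> Hi z' = {}" "Lo z \<inter> Hi z = {}" "lev z \<subseteq> W" "lev z' \<subseteq> W"
      using s s' by blast+
    moreover have "W \<subseteq> T" using component_T[OF W] .
    ultimately show ?thesis unfolding Z_def by blast
  qed
  moreover have "topen (Hi z' \<union> Lo z \<union> W)"
    using s'(2) s(1) topen_component[OF W] by (intro openin_Un)
  ultimately have "topen (T - Z)" by simp
  then have "T \<subseteq> Z"
    using connected_subset_of_separation[OF connected_T oZ, of "T - Z"] Zne topen_subset[OF oZ] by blast
  then show False using z(1) component_T[OF W] by (auto simp: Z_def)
qed


lemma higher_lower: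
  assumes W: "W \<in> components R" and z: "z \<in> W"
  obtains x y where "x \<in> W" "f x < f z" "y \<in> W" "f z < f y"
proof -
  obtain a b where ab: "a < b" "f ` W = {a<..<b}" using component_range[OF W] .
  have fz: "a < f z" "f z < b" using imageI[OF z, of f] ab(2) by auto
  then have "(a + f z)/2 \<in> f ` W" "(f z + b)/2 \<in> f ` W" using ab(2) by auto
  then obtain p q where "p \<in> W" "f p = (a + f z)/2" "q \<in> W" "f q = (f z + b)/2" by (metis imageE)
  then show thesis using that[of p q] fz by simp
qed

text \<open>While \<open>z\<close> climbs towards the upper end \<open>w\<close>, the growing sets
  \<open>Lo z\<close> exhaust the component of the complement of \<open>w\<close> that contains the
  edge. The union is clopen in that complement because, by \<open>between_sides\<close>, beyond a
  fixed \<open>z0\<close> it gains nothing but points of the edge and the lower end lies in it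
  already.\<close>

lemma Lo_Union_component:
  assumes W: "W \<in> components R" and e: "ends W u w"
  shows "(\<Union>z\<in>W. Lo z) \<in> components (T - w)" "W \<subseteq> (\<Union>z\<in>W. Lo z)" "topen (\<Union>z\<in>W. Lo z)"
proof -
  let ?G = "\<Union>z\<in>W. Lo z"
  have uw: "u \<in> V" "w \<in> V" "closure W \<subseteq> W \<union> u \<union> w" using e by (auto simp: ends_def)
  have cl: "closed (closure W \<union> u \<union> w)" using closed_vertex uw(1,2) by blast
  obtain z0 where z0: "z0 \<in> W" using in_components_nonempty[OF W] by blast
  show WG: "W \<subseteq> ?G"
  proof
    fix y assume y: "y \<in> W"
    obtain x z where "z \<in> W" "f y < f z" using higher_lower[OF W y] .
    then have "y \<in> Lo z" using two_sides(4)[OF W \<open>z \<in> W\<close>] y by auto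
    then show "y \<in> ?G" using \<open>z \<in> W\<close> by blast
  qed
  show oG: "topen ?G" using sides_facts(1)[OF W] by (intro openin_Union) blast
  have conG: "connected (\<Union>z\<in>W. Lo z \<union> W)"
  proof (rule connected_Union)
    fix S assume "S \<in> (\<lambda>z. Lo z \<union> W) ` W"
    then obtain z where z: "z \<in> W" "S = Lo z \<union> W" by blast
    obtain x y where "x \<in> W" "f x < f z" using higher_lower[OF W z(1)] .
    then have "x \<in> Lo z" using two_sides(4)[OF W z(1)] by auto
    then have "Lo z \<inter> W \<noteq> {}" using \<open>x \<in> W\<close> by blast
    then show "connected S" unfolding z(2)
      using connected_Un[OF sides_facts(3)[OF W z(1)] in_components_connected[OF W]] by blast
  qed (use z0 in blast)
  have "(\<Union>z\<in>W. Lo z \<union> W) = ?G" using WG by blast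
  then have con: "connected ?G" using conG by simp
  have disj: "?G \<inter> w = {}"
    using ends_sides(2)[OF W e] sides_facts(5)[OF W] by blast
  have GT: "?G \<subseteq> T" using sides_facts(11)[OF W] by blast
  have "T - w - ?G = Hi z0 - (closure W \<union> u \<union> w)"
  proof (intro equalityI subsetI)
    fix x assume x: "x \<in> T - w - ?G"
    then have "x \<notin> W" "x \<notin> Lo z0" using WG z0 by blast+
    then have "x \<notin> lev z0" using sides_facts(9)[OF W z0] by blast
    then have "x \<in> Hi z0" using two_sides(6)[OF W z0] x \<open>x \<notin> Lo z0\<close> by blast
    moreover have "x \<notin> u" using ends_sides(1)[OF W e z0] \<open>x \<notin> Lo z0\<close> by blast
    ultimately show "x \<in> Hi z0 - (closure W \<union> u \<union> w)" using x \<open>x \<notin> W\<close> uw(3) by blast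
  next
    fix x assume x: "x \<in> Hi z0 - (closure W \<union> u \<union> w)"
    then have xW: "x \<notin> W" using closure_subset by blast
    have "x \<notin> Lo z" if z: "z \<in> W" for z
    proof (cases "f z0 < f z")
      case True
      then show ?thesis using between_sides[OF W z0 z True] x xW by blast
    next
      case False
      then have "Lo z \<subseteq> Lo z0"
        using sides_mono(1)[OF W z z0] sides_cong(1)[OF W z z0] by fastforce
      then show ?thesis using x sides_facts(5)[OF W z0] by blast
    qed
    then show "x \<in> T - w - ?G" using x sides_facts(12)[OF W z0] by blast
  qed
  then have "topen (T - w - ?G)" using topen_diff[OF sides_facts(2)[OF W z0] cl] by simp
  moreover have "?G \<noteq> {}" using WG z0 by blast
  moreover have "?G \<subseteq> T - w" using GT disj by blast
  ultimately show "?G \<in> components (T - w)" by (intro component_of_clopen[OF con _ _ oG])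
qed

lemma Lo_uminus: "level_tree.Lo T (\<lambda>x. - f x) V = Hi" "level_tree.Hi T (\<lambda>x. - f x) V = Lo"
proof -
  interpret neg: level_tree T "\<lambda>x. - f x" V bad by (rule level_tree_uminus)
  have "(\<lambda>x. - f x) -` {..<- f z} = f -` {f z<..}" "(\<lambda>x. - f x) -` {- f z<..} = f -` {..<f z}" for z
    by auto
  then show "neg.Lo = Hi" "neg.Hi = Lo"
    unfolding neg.Lo_def neg.Hi_def Lo_def Hi_def lev_uminus by (intro ext, simp)+
qed

lemma ends_uminus: "level_structure.ends (\<lambda>x. - f x) V W w u \<longleftrightarrow> ends W u w"
proof -
  interpret neg: level_structure T "\<lambda>x. - f x" V by (rule level_structure_uminus)
  have im: "(\<lambda>x. - f x) ` W = {-b<..<-a} \<longleftrightarrow> f ` W = {a<..<b}" for a b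
  proof -
    have "(\<lambda>x. - f x) ` W = uminus ` f ` W" "f ` W = uminus ` (\<lambda>x. - f x) ` W"
      by (simp_all add: image_image)
    then show ?thesis by (metis image_uminus_greaterThanLessThan minus_minus)
  qed
  have e1: "(\<exists>a b. a < b \<and> (\<lambda>x. - f x) ` W = {a<..<b} \<and> (\<forall>x\<in>w. - f x = a) \<and> (\<forall>x\<in>u. - f x = b)) \<longleftrightarrow>
    (\<exists>a b. a < b \<and> f ` W = {a<..<b} \<and> (\<forall>x\<in>u. f x = a) \<and> (\<forall>x\<in>w. f x = b))" (is "?l \<longleftrightarrow> ?r")
  proof
    assume ?l
    then obtain a b where h: "a < b" "(\<lambda>x. - f x) ` W = {a<..<b}" "\<forall>x\<in>w. - f x = a" "\<forall>x\<in>u. - f x = b"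
      by blast
    have "f ` W = {-b<..<-a}" using im[where a="-b" and b="-a"] h(2) by simp
    moreover have "f x = - b" if "x \<in> u" for x using bspec[OF h(4) that] by linarith
    moreover have "f x = - a" if "x \<in> w" for x using bspec[OF h(3) that] by linarith
    ultimately have "-b < -a \<and> f ` W = {-b<..<-a} \<and> (\<forall>x\<in>u. f x = -b) \<and> (\<forall>x\<in>w. f x = -a)"
      using h(1) by simp
    then show ?r by blast
  next
    assume ?r
    then obtain a b where "a < b" "f ` W = {a<..<b}" "\<forall>x\<in>u. f x = a" "\<forall>x\<in>w. f x = b" by blast
    then have "-b < -a \<and> (\<lambda>x. - f x) ` W = {-b<..<-a} \<and> (\<forall>x\<in>w. - f x = -b) \<and> (\<forall>x\<in>u. - f x = -a)"
      using im[where a=a and b=b] by simp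
    then show ?l by blast
  qed
  have e2: "(\<lambda>x. - f x) -` {..<- f z} = f -` {f z<..}" "(\<lambda>x. - f x) -` {- f z<..} = f -` {..<f z}" for z
    by auto
  show ?thesis unfolding neg.ends_def ends_def e1 e2 by (simp only: Un_ac conj_ac)
qed

lemma Hi_Union_component:
  assumes W: "W \<in> components R" and e: "ends W u w"
  shows "(\<Union>z\<in>W. Hi z) \<in> components (T - u)" "W \<subseteq> (\<Union>z\<in>W. Hi z)"
proof -
  interpret neg: level_tree T "\<lambda>x. - f x" V bad by (rule level_tree_uminus)
  have "neg.ends W w u" using e ends_uminus by simp
  from neg.Lo_Union_component[OF W this] show "(\<Union>z\<in>W. Hi z) \<in> components (T - u)" "W \<subseteq> (\<Union>z\<in>W. Hi z)"
    unfolding Lo_uminus by blast+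
qed

text \<open>\<open>Lo z\<close> is covered by the sets \<open>Lo z'\<close> at lower levels of the
  same edge, which form a chain of open sets, so one of them is already bad. This is what makes
  badness of the lower side an open condition on the value of \<open>f\<close>.\<close>

lemma Lo_approx:
  assumes W: "W \<in> components R" and z: "z \<in> W" and b: "bad (Lo z)"
  obtains z' where "z' \<in> W" "f z' < f z" "bad (Lo z')"
proof -
  let ?U = "Lo ` {z' \<in> W. f z' < f z}"
  obtain z1 y where z1: "z1 \<in> W" "f z1 < f z" using higher_lower[OF W z] .
  have "Lo z \<subseteq> \<Union>?U"
  proof
    fix x assume x: "x \<in> Lo z"
    show "x \<in> \<Union>?U"
    proof (cases "x \<in> Lo z1")
      case True then show ?thesis using z1 by blast
    next
      case False
      have xT: "x \<in> T" using x sides_facts(11)[OF W z] by blast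
      have "x \<in> W"
      proof (cases "x \<in> lev z1")
        case True then show ?thesis using sides_facts(9)[OF W z1(1)] by blast
      next
        case F: False
        then have "x \<in> Hi z1" using two_sides(6)[OF W z1(1)] xT False by blast
        then show ?thesis using between_sides[OF W z1(1) z z1(2)] x by blast
      qed
      have "x \<notin> lev z" "x \<notin> Hi z" using x sides_facts(5,6)[OF W z] by blast+
      then have "f x \<noteq> f z"
        using component_tube[OF W] z \<open>x \<in> W\<close> unfolding tube_def by metis
      moreover have "\<not> f z < f x" using \<open>x \<notin> Hi z\<close> two_sides(5)[OF W z] \<open>x \<in> W\<close> by auto
      ultimately have "f x < f z" by simp
      then have "(f x + f z)/2 \<in> f ` W"
        using connectedD_interval[OF tubeD(3)[OF component_tube[OF W]], of "f x" "f z" "(f x + f z)/2"]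
          \<open>x \<in> W\<close> z by simp
      then obtain y where y: "y \<in> W" "f y = (f x + f z)/2" by (metis imageE)
      then have "x \<in> Lo y" using two_sides(4)[OF W y(1)] \<open>x \<in> W\<close> \<open>f x < f z\<close> by auto
      then show ?thesis using y \<open>f x < f z\<close> by auto
    qed
  qed
  then have "bad (\<Union>?U)" using bad_mono b by blast
  moreover have "?U \<noteq> {}" using z1 by blast
  moreover have "topen A" if "A \<in> ?U" for A using that sides_facts(1)[OF W] by blast
  moreover have "A \<subseteq> B \<or> B \<subseteq> A" if AB: "A \<in> ?U" "B \<in> ?U" for A B
  proof -
    obtain p q where pq: "A = Lo p" "B = Lo q" "p \<in> W" "q \<in> W" using AB by blast
    consider "f p < f q" | "f q < f p" | "f p = f q" by linarith
    then show ?thesis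
      using sides_mono(1)[OF W] sides_cong(1)[OF W] pq by cases (metis order_refl)+
  qed
  ultimately have "\<exists>A\<in>?U. bad A" by (intro bad_Union)
  then show thesis using that by blast
qed

lemma Hi_approx:
  assumes W: "W \<in> components R" and z: "z \<in> W" and b: "bad (Hi z)"
  obtains z' where "z' \<in> W" "f z < f z'" "bad (Hi z')"
proof -
  interpret neg: level_tree T "\<lambda>x. - f x" V bad by (rule level_tree_uminus)
  show thesis
    by (rule neg.Lo_approx[OF W z, unfolded Lo_uminus, OF b]) (use that in simp)
qed

lemma Lo_bad_chain:
  assumes W: "W \<in> components R" and b: "bad (\<Union>z\<in>W. Lo z)"
  obtains z where "z \<in> W" "bad (Lo z)"
proof -
  have "\<exists>A\<in>Lo ` W. bad A"
  proof (rule bad_Union)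
    show "Lo ` W \<noteq> {}" using in_components_nonempty[OF W] by blast
    show "topen A" if "A \<in> Lo ` W" for A using that sides_facts(1)[OF W] by blast
    show "A \<subseteq> B \<or> B \<subseteq> A" if AB: "A \<in> Lo ` W" "B \<in> Lo ` W" for A B
    proof -
      obtain p q where pq: "A = Lo p" "B = Lo q" "p \<in> W" "q \<in> W" using AB by blast
      consider "f p < f q" | "f q < f p" | "f p = f q" by linarith
      then show ?thesis
        using sides_mono(1)[OF W] sides_cong(1)[OF W] pq by cases (metis order_refl)+
    qed
  qed (rule b)
  then show thesis using that by blast
qed

lemma Hi_bad_chain:
  assumes W: "W \<in> components R" and b: "bad (\<Union>z\<in>W. Hi z)"
  obtains z where "z \<in> W" "bad (Hi z)"
proof -
  interpret neg: level_tree T "\<lambda>x. - f x" V bad by (rule level_tree_uminus)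
  show thesis
    by (rule neg.Lo_bad_chain[OF W, unfolded Lo_uminus, OF b]) (rule that)
qed

text \<open>Both alternatives along an edge are open conditions on the value of \<open>f\<close>, so only one of them
  occurs.\<close>

lemma not_both_bad:
  assumes W: "W \<in> components R"
  shows "\<not> (bad (\<Union>z\<in>W. Lo z) \<and> bad (\<Union>z\<in>W. Hi z))"
proof
  assume "bad (\<Union>z\<in>W. Lo z) \<and> bad (\<Union>z\<in>W. Hi z)"
  then obtain z1 z2 where z12: "z1 \<in> W" "bad (Lo z1)" "z2 \<in> W" "bad (Hi z2)"
    using Lo_bad_chain[OF W] Hi_bad_chain[OF W] by metis
  \<comment> \<open>By \<open>Lo_approx\<close> each value with a bad lower side lies strictly above
    another such value and thus belongs to the open set \<open>?A\<close>; \<open>Hi_approx\<close>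
    does the same for \<open>?B\<close>.\<close>
  let ?A = "\<Union>z\<in>{z\<in>W. bad (Lo z)}. {f z<..}" and ?B = "\<Union>z\<in>{z\<in>W. bad (Hi z)}. {..<f z}"
  have con: "connected (f ` W)" using tubeD(3)[OF component_tube[OF W]] .
  have inA: "f z \<in> ?A" if z: "z \<in> W" "bad (Lo z)" for z
  proof -
    obtain z' where "z' \<in> W" "f z' < f z" "bad (Lo z')" by (rule Lo_approx[OF W z])
    then show ?thesis by blast
  qed
  have inB: "f z \<in> ?B" if z: "z \<in> W" "bad (Hi z)" for z
  proof -
    obtain z' where "z' \<in> W" "f z < f z'" "bad (Hi z')" by (rule Hi_approx[OF W z])
    then show ?thesis by blast
  qed
  have cover: "f ` W \<subseteq> ?A \<union> ?B"
  proof
    fix t assume "t \<in> f ` W"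
    then obtain z where z: "z \<in> W" "t = f z" by blast
    have "bad (Lo z) \<or> bad (Hi z)" using sides_facts(8)[OF W z(1)] by blast
    then show "t \<in> ?A \<union> ?B" using inA inB z by blast
  qed
  have dj: "?A \<inter> ?B \<inter> f ` W = {}"
  proof (rule ccontr)
    assume "?A \<inter> ?B \<inter> f ` W \<noteq> {}"
    then obtain z p q where zpq: "z \<in> W" "p \<in> W" "q \<in> W" "bad (Lo p)" "f p < f z" "bad (Hi q)" "f z < f q"
      by blast
    have "bad (Lo z)" using bad_mono[OF sides_mono(1)[OF W zpq(2,1,5)] zpq(4)] .
    moreover have "bad (Hi z)" using bad_mono[OF sides_mono(3)[OF W zpq(1,3,7)] zpq(6)] .
    ultimately show False using sides_facts(8)[OF W zpq(1)] by blast
  qed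
  have oAB: "open ?A" "open ?B" by auto
  have mem: "f z1 \<in> ?A \<inter> f ` W" "f z2 \<in> ?B \<inter> f ` W"
    using inA[OF z12(1,2)] inB[OF z12(3,4)] z12(1,3) by simp_all
  from connectedD[OF con oAB dj cover] show False
  proof
    assume e: "?A \<inter> f ` W = {}"
    show False using mem(1) unfolding e by (rule emptyE)
  next
    assume e: "?B \<inter> f ` W = {}"
    show False using mem(2) unfolding e by (rule emptyE)
  qed
qed

text \<open>\<open>U\<close> is the bad component behind the edge \<open>W\<close> as seen from
  \<open>u\<close>, and the next vertex is the other end \<open>w\<close>. By
  \<open>not_both_bad\<close> the component of the complement of \<open>w\<close> that contains
  \<open>W\<close> is not bad, so each bad one lies beyond \<open>w\<close>, inside
  \<open>U\<close>. That \<open>w\<close> itself is in \<open>U\<close> but not in \<open>U'\<close>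
  makes the number of enclosed vertices drop.\<close>

lemma descent_step:
  assumes W: "W \<in> components R" and e: "ends W u w" and U: "U \<in> components (T - u)" "bad U" "W \<subseteq> U"
  shows "\<exists>L\<in>V. \<forall>U'\<in>components (T - L). bad U' \<longrightarrow> U' \<subseteq> U \<and> L \<subseteq> U \<and> L \<inter> U' = {}"
proof (rule bexI, intro ballI impI)
  show wV: "w \<in> V" using e by (simp add: ends_def)
  let ?F = "\<Union>z\<in>W. Hi z" and ?G = "\<Union>z\<in>W. Lo z"
  obtain z where z: "z \<in> W" using in_components_nonempty[OF W] by blast
  have UF: "U = ?F"
  proof -
    have "z \<in> U \<inter> ?F" using U(3) Hi_Union_component(2)[OF W e] z by blast
    then show ?thesis using components_nonoverlap[OF U(1) Hi_Union_component(1)[OF W e]] by (metis empty_iff)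
  qed
  have nG: "\<not> bad ?G" using not_both_bad[OF W] U(2) UF by blast
  fix U' assume U': "U' \<in> components (T - w)" "bad U'"
  have "U' \<noteq> ?G" using nG U'(2) by metis
  then have disj: "U' \<inter> ?G = {}"
    using components_nonoverlap[OF U'(1) Lo_Union_component(1)[OF W e]] by simp
  have sub: "U' \<subseteq> T - w" using in_components_subset[OF U'(1)] .
  have "T \<subseteq> ?F \<union> ?G"
  proof
    fix x assume x: "x \<in> T"
    have "x \<in> lev z \<Longrightarrow> x \<in> ?G" using sides_facts(9)[OF W z] Lo_Union_component(2)[OF W e] by blast
    moreover have "x \<in> Lo z \<union> Hi z \<union> lev z" using two_sides(6)[OF W z] x by auto
    ultimately show "x \<in> ?F \<union> ?G" using z by auto
  qed
  then have "U' \<subseteq> U" unfolding UF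
  proof (intro subsetI)
    fix x assume x: "x \<in> U'"
    then have "x \<in> T" "x \<notin> ?G" using sub disj by blast+
    then show "x \<in> ?F" using \<open>T \<subseteq> ?F \<union> ?G\<close> by (metis UnE subsetD)
  qed
  moreover have "w \<subseteq> U" unfolding UF using ends_sides(2)[OF W e z] z by auto
  ultimately show "U' \<subseteq> U \<and> w \<subseteq> U \<and> w \<inter> U' = {}" using sub by blast
qed

text \<open>Some limit point \<open>x\<close> of \<open>U\<close> lies on \<open>K\<close>. The
  edges and vertices inside \<open>U\<close> are finite in number, so \<open>x\<close> is in the
  closure of one of them; it is not a vertex, because vertices are closed and those inside
  \<open>U\<close> are disjoint from \<open>K\<close>.\<close>

lemma edge_at_vertex:
  assumes K: "K \<in> V" and U: "U \<in> components (T - K)"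
  obtains W where "W \<in> components R" "W \<subseteq> U" "closure W \<inter> K \<noteq> {}"
proof -
  have oK: "topen (T - K)" using topen_diff[OF topen_T closed_vertex[OF K]] .
  have "T - K \<noteq> T" using vertex_nonempty[OF K] vertex_subset_T[OF K] by blast
  then obtain x where x: "x \<in> closure U" "x \<in> T" "x \<notin> T - K"
    by (rule open_component_not_closed[OF U oK])
  have UT: "U \<subseteq> T - K" using in_components_subset[OF U] .
  let ?E = "{W \<in> components R. W \<subseteq> U}" and ?L = "{L \<in> V. L \<subseteq> U}"
  have "U \<subseteq> \<Union>?E \<union> \<Union>?L"
  proof
    fix y assume y: "y \<in> U"
    show "y \<in> \<Union>?E \<union> \<Union>?L"
    proof (cases "y \<in> R")
      case True
      define W where "W = connected_component_set R y"
      have W: "W \<in> components R" "y \<in> W"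
        using True by (auto simp: W_def components_def connected_component_refl_eq)
      have "W \<subseteq> T - K" using component_in_R[OF W(1)] K by (auto simp: R_def)
      then have "W \<subseteq> U"
        using components_maximal[OF U in_components_connected[OF W(1)]] y W(2) by blast
      then show ?thesis using W by blast
    next
      case False
      then obtain L where L: "L \<in> V" "y \<in> L" using y UT by (auto simp: R_def)
      have "L \<inter> K = {}" using vertices_disjoint[OF L(1) K] y L UT by blast
      then have "L \<subseteq> T - K" using vertex_subset_T[OF L(1)] by blast
      then have "L \<subseteq> U"
        using components_maximal[OF U connected_vertex[OF L(1)]] y L(2) by blast
      then show ?thesis using L by blast
    qed
  qed
  then have "U \<subseteq> \<Union>(closure ` ?E) \<union> \<Union>(closure ` ?L)"
    using Un_mono[OF Union_subset_Union_closure Union_subset_Union_closure] by (rule subset_trans)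
  moreover have "closed (\<Union>(closure ` ?E) \<union> \<Union>(closure ` ?L))"
    using finite_edges finite_V by (intro closed_Un closed_Union) auto
  ultimately have "closure U \<subseteq> \<Union>(closure ` ?E) \<union> \<Union>(closure ` ?L)" by (rule closure_minimal)
  then have "x \<in> \<Union>(closure ` ?E) \<union> \<Union>(closure ` ?L)" using x(1) by (rule subsetD)
  moreover have "x \<notin> closure L" if L: "L \<in> ?L" for L
  proof -
    have "closure L = L" using closed_vertex L by simp
    then show ?thesis using L UT x(2,3) by blast
  qed
  ultimately obtain W where W: "W \<in> ?E" "x \<in> closure W" by auto
  then have "closure W \<inter> K \<noteq> {}" using x(2,3) by blast
  then show thesis using that[of W] W(1) by simp
qed

lemma descent:
  assumes K: "K \<in> V" and U: "U \<in> components (T - K)" "bad U"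
  shows "\<exists>L\<in>V. \<forall>U'\<in>components (T - L). bad U' \<longrightarrow> U' \<subseteq> U \<and> L \<subseteq> U \<and> L \<inter> U' = {}"
proof -
  obtain W where W: "W \<in> components R" "W \<subseteq> U" "closure W \<inter> K \<noteq> {}"
    using edge_at_vertex[OF K U(1)] .
  obtain u w where e: "ends W u w" using ends_exist[OF W(1)] .
  have uw: "u \<in> V" "w \<in> V" "closure W \<subseteq> W \<union> u \<union> w" using e by (auto simp: ends_def)
  have "W \<inter> K = {}" using component_in_R[OF W(1)] K by (auto simp: R_def)
  then have "K \<inter> u \<noteq> {} \<or> K \<inter> w \<noteq> {}" using W(3) uw(3) by blast
  then have "K = u \<or> K = w" using vertices_disjoint[OF K] uw(1,2) by blast
  then show ?thesis
  proof
    assume "K = u"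
    then show ?thesis using descent_step[OF W(1) e _ U(2) W(2)] U(1) by blast
  next
    assume "K = w"
    interpret neg: level_tree T "\<lambda>x. - f x" V bad by (rule level_tree_uminus)
    have "neg.ends W w u" using e ends_uminus by simp
    then show ?thesis using neg.descent_step[OF W(1) _ _ U(2) W(2)] U(1) \<open>K = w\<close> by blast
  qed
qed

theorem exists_vertex_no_bad:
  assumes "V \<noteq> {}"
  shows "\<exists>K\<in>V. \<forall>U\<in>components (T - K). \<not> bad U"
proof (rule ccontr)
  assume no: "\<not> (\<exists>K\<in>V. \<forall>U\<in>components (T - K). \<not> bad U)"
  have main: "K \<in> V \<Longrightarrow> U \<in> components (T - K) \<Longrightarrow> bad U \<Longrightarrow> False" for K U
  proof (induction "card {L \<in> V. L \<subseteq> U}" arbitrary: K U rule: less_induct)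
    case less
    obtain L where L: "L \<in> V"
      "\<forall>U'\<in>components (T - L). bad U' \<longrightarrow> U' \<subseteq> U \<and> L \<subseteq> U \<and> L \<inter> U' = {}"
      using descent[OF less.prems] by blast
    obtain U' where U': "U' \<in> components (T - L)" "bad U'" using no L(1) by blast
    have *: "U' \<subseteq> U" "L \<subseteq> U" "L \<inter> U' = {}" using L(2) U' by blast+
    have "L \<noteq> {}" using vertex_nonempty[OF L(1)] .
    then have "{M \<in> V. M \<subseteq> U'} \<subset> {M \<in> V. M \<subseteq> U}" using * L(1) by blast
    then have "card {M \<in> V. M \<subseteq> U'} < card {M \<in> V. M \<subseteq> U}"
      using finite_V by (intro psubset_card_mono) auto
    then show False using less.hyps L(1) U' by blast
  qed
  show False using assms no main by blast
qed

end

section \<open>Cycles in the graph\<close>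

text \<open>After shortening the path to one without repeated vertices, \<open>e0\<close> closes it
  to a cycle. The edges are distinct because an edge determines its pair of ends and a simple path
  has pairwise different pairs of consecutive vertices.\<close>

lemma graph_cycle_from_path:
  assumes path: "(u, w) \<in> {(x, y). x \<in> V \<and> y \<in> V \<and> (\<exists>e\<in>E - {e0}. J e x y)}\<^sup>*"
    and uw: "u \<in> V" "u \<noteq> w" and e0: "e0 \<in> E" "J e0 w u"
    and ends: "\<And>e x y x' y'. J e x y \<Longrightarrow> J e x' y' \<Longrightarrow> {x, y} = {x', y'}"
  shows "\<exists>vs es. graph_cycle V E J vs es"
proof -
  define Q where "Q x y \<longleftrightarrow> x \<in> V \<and> y \<in> V \<and> (\<exists>e\<in>E - {e0}. J e x y)" for x y
  have "Q\<^sup>*\<^sup>* u w" using path by (simp add: Q_def Enum.rtranclp_rtrancl_eq)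
  then obtain xs0 where "rtrancl_path Q u xs0 w" by (auto simp: rtranclp_eq_rtrancl_path)
  then obtain xs where xs: "rtrancl_path Q u xs w" "distinct (u # xs)"
    by (rule rtrancl_path_distinct)
  have ne: "xs \<noteq> []" using xs(1) uw(2) by (auto elim: rtrancl_path.cases)
  define n where "n = length xs"
  define vs where "vs = u # xs"
  have step: "Q (vs ! i) (vs ! Suc i)" if "i < n" for i
    using rtrancl_path_nth[OF xs(1)] that by (simp add: vs_def n_def)
  have last: "vs ! n = w"
    using rtrancl_path_last[OF xs(1) ne] ne by (simp add: vs_def n_def last_conv_nth)
  have "\<forall>i\<in>{..<n}. \<exists>e. e \<in> E - {e0} \<and> J e (vs ! i) (vs ! Suc i)"
    using step by (auto simp: Q_def)
  from bchoice[OF this] obtain g where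
    g: "\<forall>i\<in>{..<n}. g i \<in> E - {e0} \<and> J (g i) (vs ! i) (vs ! Suc i)" ..
  define es where "es = map g [0..<n] @ [e0]"
  have len: "length vs = Suc n" "length es = Suc n" by (simp_all add: vs_def es_def n_def)
  have dv: "distinct vs" using xs(2) by (simp add: vs_def)
  have ginj: "i = j" if ij: "i < n" "j < n" "g i = g j" for i j
  proof -
    have "{vs ! i, vs ! Suc i} = {vs ! j, vs ! Suc j}"
      using ends[of "g i"] g ij by (metis lessThan_iff)
    moreover have "vs ! a = vs ! b \<longleftrightarrow> a = b" if "a \<le> n" "b \<le> n" for a b
      using nth_eq_iff_index_eq[OF dv] len that by simp
    ultimately show ?thesis using ij by (auto simp: doubleton_eq_iff)
  qed
  have "graph_cycle V E J vs es"
    unfolding graph_cycle_def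
  proof (intro conjI allI impI)
    show "es \<noteq> []" "length vs = length es" using len by (auto simp: es_def)
    show "distinct vs" by (rule dv)
    show "set vs \<subseteq> V"
    proof
      fix x assume "x \<in> set vs"
      then obtain i where i: "i < Suc n" "x = vs ! i" using len by (metis in_set_conv_nth)
      show "x \<in> V"
      proof (cases i)
        case 0 then show ?thesis using i uw by (simp add: vs_def)
      next
        case (Suc k) then show ?thesis using i step[of k] by (simp add: Q_def)
      qed
    qed
    show "set es \<subseteq> E" using g e0(1) by (auto simp: es_def)
    have "inj_on g {0..<n}" using ginj by (auto intro!: inj_onI)
    then show "distinct es" using g by (auto simp: es_def distinct_map)
    fix i assume "i < length es"
    then consider "i < n" | "i = n" using len by linarith
    then show "J (es ! i) (vs ! i) (vs ! (Suc i mod length vs))"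
    proof cases
      case 1
      then have "Suc i mod length vs = Suc i" "es ! i = g i" using len by (simp_all add: es_def nth_append)
      then show ?thesis using g 1 by simp
    next
      case 2
      then have "Suc i mod length vs = 0" "es ! i = e0" using len by (simp_all add: es_def nth_append)
      then show ?thesis using 2 last e0(2) by (simp add: vs_def)
    qed
  qed
  then show ?thesis by blast
qed

context level_structure begin

text \<open>Adjacency in the graph with the edge \<open>W\<close> deleted, symmetrised because
  \<open>ends\<close> is oriented. Acyclicity is used in the form that the ends of \<open>W\<close>
  are not linked by the reflexive transitive closure of this relation.\<close>

definition other_edges :: "'a set \<Rightarrow> ('a set \<times> 'a set) set" where
  "other_edges W = {(x, y). \<exists>W'\<in>components R - {W}. ends W' x y \<or> ends W' y x}"

lemma ends_in_V: "ends W x y \<Longrightarrow> x \<in> V" "ends W x y \<Longrightarrow> y \<in> V"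
  by (auto simp: ends_def)

text \<open>Two parallel edges would form a cycle, so an edge is determined by its pair of ends, for
  which there are finitely many choices.\<close>

lemma finite_components_if_acyclic:
  assumes acyc: "\<And>W u w. W \<in> components R \<Longrightarrow> ends W u w \<Longrightarrow> (u, w) \<notin> (other_edges W)\<^sup>*"
  shows "finite (components R)"
proof -
  have "\<forall>W\<in>components R. \<exists>p. ends W (fst p) (snd p)" using ends_exist by (metis fst_conv snd_conv)
  from bchoice[OF this] obtain p where p: "\<forall>W\<in>components R. ends W (fst (p W)) (snd (p W))" ..
  have "inj_on p (components R)"
  proof (rule inj_onI, rule ccontr)
    fix W W' assume W: "W \<in> components R" "W' \<in> components R" "p W = p W'" "W \<noteq> W'"
    have "ends W' (fst (p W)) (snd (p W))" using p W(2,3) by simp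
    then have "(fst (p W), snd (p W)) \<in> other_edges W" unfolding other_edges_def using W by auto
    then show False using acyc[OF W(1)] p W(1) by blast
  qed
  moreover have "p ` components R \<subseteq> V \<times> V"
  proof (rule image_subsetI)
    fix W assume "W \<in> components R"
    then have "ends W (fst (p W)) (snd (p W))" using p by blast
    then show "p W \<in> V \<times> V" using ends_in_V by (simp add: mem_Times_iff)
  qed
  then have "finite (p ` components R)" using finite_V by (meson finite_SigmaI finite_subset)
  ultimately show ?thesis by (metis finite_imageD)
qed

text \<open>Deleting \<open>lev z\<close> splits the space into the vertices reachable from
  \<open>u\<close> without \<open>W\<close>, their edges and the lower half of \<open>W\<close>, and
  the rest with the upper half. Both parts are finite unions of pieces whose closures add only
  points of the same part or of \<open>lev z\<close>, so each part is relatively closed.\<close>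

lemma separates_if_acyclic:
  assumes acyc: "\<And>W u w. W \<in> components R \<Longrightarrow> ends W u w \<Longrightarrow> (u, w) \<notin> (other_edges W)\<^sup>*"
    and z: "z \<in> R"
  shows "\<not> connected (T - lev z)"
proof
  assume con: "connected (T - lev z)"
  define W where "W = connected_component_set R z"
  have W: "W \<in> components R" "z \<in> W"
    using z by (auto simp: W_def components_def connected_component_refl_eq)
  obtain u w where e: "ends W u w" using ends_exist[OF W(1)] .
  have uwV: "u \<in> V" "w \<in> V" using ends_in_V[OF e] .
  have tW: "tube W" using component_tube[OF W(1)] .
  define Vu where "Vu = {x \<in> V. (u, x) \<in> (other_edges W)\<^sup>*}"
  have step: "y \<in> Vu" if "x \<in> Vu" "(x, y) \<in> other_edges W" for x y
  proof -
    have "y \<in> V" using that(2) ends_in_V unfolding other_edges_def by auto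
    moreover have "(u, y) \<in> (other_edges W)\<^sup>*"
      using that unfolding Vu_def by (auto intro: rtrancl_into_rtrancl)
    ultimately show ?thesis by (simp add: Vu_def)
  qed
  have uVu: "u \<in> Vu" using uwV by (simp add: Vu_def)
  have wVu: "w \<notin> Vu" using acyc[OF W(1) e] by (simp add: Vu_def)
  define Eu where "Eu = {W' \<in> components R - {W}. \<exists>x y. ends W' x y \<and> x \<in> Vu}"
  define Ew where "Ew = components R - {W} - Eu"
  define A where "A = \<Union>Vu \<union> \<Union>Eu \<union> (W \<inter> f -` {..<f z})"
  define B where "B = \<Union>(V - Vu) \<union> \<Union>Ew \<union> (W \<inter> f -` {f z<..})"
  have fin: "finite Vu" "finite (V - Vu)" "finite Eu" "finite Ew"
    using finite_V finite_components_if_acyclic[OF acyc] by (simp_all add: Vu_def Eu_def Ew_def)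
  have WT: "W \<inter> J \<subseteq> T" for J using component_in_R[OF W(1)] R_subset by blast
  obtain a b where ab: "a < f z" "f z < b" "\<forall>x\<in>u. f x = a" "\<forall>x\<in>w. f x = b"
    and cW: "closure W \<subseteq> W \<union> u \<union> w"
  proof -
    obtain a b where *: "f ` W = {a<..<b}" "\<forall>x\<in>u. f x = a" "\<forall>x\<in>w. f x = b"
      using e unfolding ends_def by blast
    then have "a < f z" "f z < b" using imageI[OF W(2), of f] by auto
    then show thesis using that * e unfolding ends_def by blast
  qed
  have levz: "x \<in> lev z" if "x \<in> W" "f x = f z" for x
    using tW W(2) that unfolding tube_def by metis
  have "closure (W \<inter> f -` {..<f z}) \<subseteq> A \<union> lev z"
  proof
    fix x assume x: "x \<in> closure (W \<inter> f -` {..<f z})"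
    have "f x \<le> f z" by (rule closure_le[OF x WT]) simp
    then have "x \<notin> w" using ab by fastforce
    moreover have "x \<in> closure W" using x closure_mono[of "W \<inter> f -` {..<f z}" W] by blast
    ultimately have "x \<in> W \<or> x \<in> u" using cW by blast
    then show "x \<in> A \<union> lev z"
    proof
      assume "x \<in> W"
      then show ?thesis using levz[of x] \<open>f x \<le> f z\<close> by (cases "f x = f z") (auto simp: A_def)
    next
      assume "x \<in> u" then show ?thesis using uVu by (auto simp: A_def)
    qed
  qed
  moreover have "closure W' \<subseteq> A" if W': "W' \<in> Eu" for W'
  proof -
    obtain x y where xy: "ends W' x y" "x \<in> Vu" "W' \<in> components R - {W}" using W' by (auto simp: Eu_def)
    then have "y \<in> Vu" using step[of x y] by (auto simp: other_edges_def)
    moreover have "closure W' \<subseteq> W' \<union> x \<union> y" using xy(1) by (simp add: ends_def)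
    ultimately show ?thesis using W' xy(2) by (auto simp: A_def)
  qed
  moreover have "K \<subseteq> A" "closed K" if "K \<in> Vu" for K
    using that closed_vertex by (auto simp: A_def Vu_def)
  ultimately have CA: "\<Union>Vu \<union> \<Union>(closure ` Eu) \<union> closure (W \<inter> f -` {..<f z}) \<subseteq> A \<union> lev z"
    and clA: "closed (\<Union>Vu \<union> \<Union>(closure ` Eu) \<union> closure (W \<inter> f -` {..<f z}))" (is "closed ?CA")
    using fin by (blast, intro closed_Un closed_Union) auto
  have "closure (W \<inter> f -` {f z<..}) \<subseteq> B \<union> lev z"
  proof
    fix x assume x: "x \<in> closure (W \<inter> f -` {f z<..})"
    have "f x \<ge> f z" by (rule closure_ge[OF x WT]) simp
    then have "x \<notin> u" using ab by fastforce
    moreover have "x \<in> closure W" using x closure_mono[of "W \<inter> f -` {f z<..}" W] by blast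
    ultimately have "x \<in> W \<or> x \<in> w" using cW by blast
    then show "x \<in> B \<union> lev z"
    proof
      assume "x \<in> W"
      then show ?thesis using levz[of x] \<open>f x \<ge> f z\<close> by (cases "f x = f z") (auto simp: B_def)
    next
      assume "x \<in> w" then show ?thesis using wVu uwV by (auto simp: B_def)
    qed
  qed
  moreover have "closure W' \<subseteq> B" if W': "W' \<in> Ew" for W'
  proof -
    have WR: "W' \<in> components R - {W}" "W' \<notin> Eu" using W' by (auto simp: Ew_def)
    obtain x y where xy: "ends W' x y" using ends_exist WR(1) by blast
    have "x \<notin> Vu" using WR xy by (auto simp: Eu_def)
    moreover have "y \<notin> Vu"
    proof
      assume "y \<in> Vu"
      moreover have "(y, x) \<in> other_edges W" using WR(1) xy by (auto simp: other_edges_def)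
      ultimately show False using step \<open>x \<notin> Vu\<close> by blast
    qed
    moreover have "closure W' \<subseteq> W' \<union> x \<union> y" using xy by (simp add: ends_def)
    ultimately show ?thesis using W' ends_in_V[OF xy] by (auto simp: B_def)
  qed
  moreover have "K \<subseteq> B" "closed K" if "K \<in> V - Vu" for K
    using that closed_vertex by (auto simp: B_def)
  ultimately have CB: "\<Union>(V - Vu) \<union> \<Union>(closure ` Ew) \<union> closure (W \<inter> f -` {f z<..}) \<subseteq> B \<union> lev z"
    and clB: "closed (\<Union>(V - Vu) \<union> \<Union>(closure ` Ew) \<union> closure (W \<inter> f -` {f z<..}))" (is "closed ?CB")
    using fin by (blast, intro closed_Un closed_Union) auto
  have subC: "A \<subseteq> ?CA" "B \<subseteq> ?CB"
    unfolding A_def B_def by (intro Un_mono order_refl Union_subset_Union_closure closure_subset)+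
  have disj: "A \<inter> B = {}"
  proof -
    have dR: "X \<inter> K = {}" if "X \<in> components R" "K \<in> V" for X K
      using component_in_R[OF that(1)] that(2) by (auto simp: R_def)
    have dE: "X \<inter> Y = {}" if "X \<in> components R" "Y \<in> components R" "X \<noteq> Y" for X Y
      using components_nonoverlap[OF that(1,2)] that(3) by simp
    have V0: "\<Union>Vu \<inter> \<Union>(V - Vu) = {}"
    proof -
      have "K \<inter> L = {}" if "K \<in> Vu" "L \<in> V - Vu" for K L
        using vertices_disjoint[of K L] that by (auto simp: Vu_def)
      then show ?thesis by blast
    qed
    have V1: "\<Union>Vu \<inter> \<Union>Ew = {}" "\<Union>Vu \<inter> W = {}" "\<Union>Eu \<inter> \<Union>(V - Vu) = {}" "W \<inter> \<Union>(V - Vu) = {}"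
      using dR W(1) by (fastforce simp: Vu_def Ew_def Eu_def)+
    have V2: "\<Union>Eu \<inter> \<Union>Ew = {}" "\<Union>Eu \<inter> W = {}" "\<Union>Ew \<inter> W = {}"
      using dE W(1) by (fastforce simp: Ew_def Eu_def)+
    have V3: "f -` {..<f z} \<inter> f -` {f z<..} = {}" by auto
    have aux: "(P1 \<union> P2 \<union> (W \<inter> P3)) \<inter> (Q1 \<union> Q2 \<union> (W \<inter> Q3)) = {}"
      if "P1 \<inter> Q1 = {}" "P1 \<inter> Q2 = {}" "P1 \<inter> W = {}" "P2 \<inter> Q1 = {}" "W \<inter> Q1 = {}"
        "P2 \<inter> Q2 = {}" "P2 \<inter> W = {}" "Q2 \<inter> W = {}" "P3 \<inter> Q3 = {}" for P1 P2 P3 Q1 Q2 Q3 :: "'a set"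
      using that by blast
    show ?thesis unfolding A_def B_def by (rule aux[OF V0 V1 V2 V3])
  qed
  have cover: "T - lev z \<subseteq> A \<union> B"
  proof
    fix x assume x: "x \<in> T - lev z"
    show "x \<in> A \<union> B"
    proof (cases "x \<in> R")
      case False
      then obtain K where "K \<in> V" "x \<in> K" using x by (auto simp: R_def)
      then show ?thesis by (auto simp: A_def B_def)
    next
      case True
      define X where "X = connected_component_set R x"
      have X: "X \<in> components R" "x \<in> X"
        using True by (auto simp: X_def components_def connected_component_refl_eq)
      show ?thesis
      proof (cases "X = W")
        case True
        then have "f x \<noteq> f z" using levz x X(2) by blast
        then show ?thesis using True X(2) by (auto simp: A_def B_def)
      next
        case False
        then have "X \<in> Eu \<or> X \<in> Ew" using X(1) by (auto simp: Ew_def)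
        then show ?thesis using X(2) by (auto simp: A_def B_def)
      qed
    qed
  qed
  have levW: "lev z \<subseteq> W" using tube_lev_subset[OF tW W(2)] .
  have "K \<inter> lev z = {}" if "K \<in> V" for K
    using that levW component_in_R[OF W(1)] by (auto simp: R_def)
  then have uw: "u \<inter> lev z = {}" "w \<inter> lev z = {}" using uwV by blast+
  obtain x y where xy: "x \<in> u" "y \<in> w" using vertex_nonempty uwV by (metis ex_in_conv)
  have xA: "x \<in> A" "x \<in> T - lev z" and yB: "y \<in> B" "y \<in> T - lev z"
    using xy uw uVu wVu uwV vertex_subset_T by (auto simp: A_def B_def)
  have c1: "?CA \<inter> ?CB \<inter> (T - lev z) = {}"
  proof -
    have "?CA \<inter> (T - lev z) \<subseteq> A" "?CB \<inter> (T - lev z) \<subseteq> B" using CA CB by auto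
    then show ?thesis using disj by auto
  qed
  have c2: "T - lev z \<subseteq> ?CA \<union> ?CB" using cover subC by (meson Un_mono subset_trans)
  from connected_closedD[OF con c1 c2 clA clB] show False
  proof
    assume e: "?CA \<inter> (T - lev z) = {}"
    have "x \<in> ?CA \<inter> (T - lev z)" using subsetD[OF subC(1) xA(1)] xA(2) by (rule IntI)
    then show False unfolding e by (rule emptyE)
  next
    assume e: "?CB \<inter> (T - lev z) = {}"
    have "y \<in> ?CB \<inter> (T - lev z)" using subsetD[OF subC(2) yB(1)] yB(2) by (rule IntI)
    then show False unfolding e by (rule emptyE)
  qed
qed

end

section \<open>Critical points are isolated\<close>

lemma poly_fun2_eq: "poly_fun2 P (x, y) = poly (map_poly (\<lambda>p. poly p x) P) y"
  unfolding poly_fun2_def by (induction P) (auto simp: map_poly_pCons)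

lemma poly_poly_eq_poly_fun2: "poly (poly P a) x = poly_fun2 P (x, poly a x)"
  unfolding poly_fun2_def by (induction P) auto

lemma poly_fun2_scale:
  assumes "\<And>i j. coeff (coeff P j) i \<noteq> 0 \<Longrightarrow> i + j = n"
  shows "poly_fun2 P (s * x, s * y) = s ^ n * poly_fun2 P (x, y)"
proof -
  have sum: "poly_fun2 P (a, b) = (\<Sum>j\<le>degree P. \<Sum>i\<le>degree (coeff P j). coeff (coeff P j) i * a ^ i * b ^ j)"
    for a b
    unfolding poly_fun2_def
    by (simp add: poly_altdef[of P] poly_sum poly_altdef[of "coeff P _"] poly_power sum_distrib_left mult_ac)
  have summand: "coeff (coeff P j) i * (s * x) ^ i * (s * y) ^ j = s ^ n * (coeff (coeff P j) i * x ^ i * y ^ j)" for i j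
  proof (cases "coeff (coeff P j) i = 0")
    case False
    then have "n = i + j" using assms by simp
    then show ?thesis by (simp add: power_mult_distrib power_add mult_ac)
  qed simp
  show ?thesis unfolding sum sum_distrib_left by (intro sum.cong refl summand)
qed

lemma pderiv_map_poly_eval:
  "map_poly (\<lambda>p. poly p x) (pderiv P) = pderiv (map_poly (\<lambda>p. poly p (x::real)) P)"
  by (rule poly_eqI) (simp add: coeff_map_poly coeff_pderiv)

lemma DERIV_poly_fun2: "((\<lambda>y. poly_fun2 P (x, y)) has_real_derivative poly_fun2 (pderiv P) (x, y)) (at y)"
  unfolding poly_fun2_eq pderiv_map_poly_eval by (rule poly_DERIV)

text \<open>By homogeneity the i-th power of X occurs only together with the power n - i of Y, so
  fixing Y merely rescales each coefficient.\<close>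

lemma coeff_poly_const:
  fixes y :: real
  assumes "\<And>i j. coeff (coeff P j) i \<noteq> 0 \<Longrightarrow> i + j = n"
  shows "coeff (poly P [:y:]) i = (if i \<le> n then coeff (coeff P (n - i)) i * y ^ (n - i) else 0)"
proof -
  have pw: "[:y:] ^ j = [:y ^ j:]" for j by (induction j) (auto simp: one_pCons)
  have "coeff (poly P [:y:]) i = (\<Sum>j\<le>degree P. coeff (coeff P j) i * y ^ j)"
    by (simp add: poly_altdef coeff_sum pw mult.commute)
  also have "\<dots> = (\<Sum>j\<le>degree P. if j = n - i \<and> i \<le> n then coeff (coeff P (n - i)) i * y ^ (n - i) else 0)"
  proof (rule sum.cong[OF refl])
    fix j
    show "coeff (coeff P j) i * y ^ j =
        (if j = n - i \<and> i \<le> n then coeff (coeff P (n - i)) i * y ^ (n - i) else 0)"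
      using assms[of j i] by (cases "coeff (coeff P j) i = 0") auto
  qed
  also have "\<dots> = (if i \<le> n then coeff (coeff P (n - i)) i * y ^ (n - i) else 0)"
    by (auto simp: sum.delta not_le coeff_eq_0)
  finally show ?thesis .
qed

lemma continuous_poly_fun2: "continuous_on A (poly_fun2 P)"
proof -
  have "poly_fun2 P = (\<lambda>z. \<Sum>j\<le>degree P. poly (coeff P j) (fst z) * snd z ^ j)"
    by (rule ext) (auto simp: poly_fun2_def poly_altdef[of P] poly_sum poly_power split: prod.splits)
  then show ?thesis by (auto intro!: continuous_intros)
qed

text \<open>By Euler's identity a critical point off the origin is a zero, and the corresponding linear form
  divides both the polynomial and its derivative.\<close>

lemma homogeneous2_noncritical:
  assumes "homogeneous2 P" "squarefree P" and P0: "poly_fun2 P 0 = 0" and ne: "(a, b) \<noteq> 0"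
    and der: "(poly_fun2 P has_derivative (\<lambda>_. 0)) (at (a, b))"
  shows False
proof -
  obtain n where n: "\<And>i j. coeff (coeff P j) i \<noteq> 0 \<Longrightarrow> i + j = n"
    using assms(1) unfolding homogeneous2_def by blast
  have scale: "poly_fun2 P (s * x, s * y) = s ^ n * poly_fun2 P (x, y)" for s x y
    by (rule poly_fun2_scale[OF n])
  have nP: "i + j = n - 1" if "coeff (coeff (pderiv P) j) i \<noteq> 0" for i j
  proof -
    have "coeff (coeff P (Suc j)) i \<noteq> 0" using that by (auto simp: coeff_pderiv of_nat_poly simp del: of_nat_Suc)
    then show ?thesis using n[of "Suc j" i] by simp
  qed
  have F0: "poly_fun2 P (a, b) = 0"
  proof (cases "n = 0")
    case True
    then show ?thesis using scale[of 0 a b] P0 by (simp add: zero_prod_def)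
  next
    case False
    have "((\<lambda>s::real. (s * a, s * b)) has_derivative (\<lambda>s. (s * a, s * b))) (at 1)"
      by (auto intro!: derivative_eq_intros)
    then have "((\<lambda>s. poly_fun2 P (s * a, s * b)) has_derivative (\<lambda>_. 0)) (at 1)"
      using has_derivative_compose[of "\<lambda>s::real. (s * a, s * b)" _ 1 UNIV "poly_fun2 P" "\<lambda>_. 0"] der by simp
    then have "((\<lambda>s. poly_fun2 P (s * a, s * b)) has_real_derivative 0) (at 1)"
      by (rule has_derivative_imp_has_field_derivative) simp
    moreover have "((\<lambda>s. poly_fun2 P (s * a, s * b)) has_real_derivative of_nat n * poly_fun2 P (a, b)) (at 1)"
      unfolding scale by (auto intro!: derivative_eq_intros)
    ultimately have "of_nat n * poly_fun2 P (a, b) = 0" by (rule DERIV_unique[symmetric])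
    then show ?thesis using False by simp
  qed
  show False
  proof (cases "a = 0")
    case False
    define t where "t = b / a"
    have ab: "a * t = b" using False by (simp add: t_def)
    have "((\<lambda>y::real. (a, y)) has_derivative (\<lambda>y. (0, y))) (at b)"
      by (auto intro!: derivative_eq_intros)
    then have "((\<lambda>y. poly_fun2 P (a, y)) has_derivative (\<lambda>_. 0)) (at b)"
      using has_derivative_compose[of "\<lambda>y::real. (a, y)" _ b UNIV "poly_fun2 P" "\<lambda>_. 0"] der by simp
    then have "((\<lambda>y. poly_fun2 P (a, y)) has_real_derivative 0) (at b)"
      by (rule has_derivative_imp_has_field_derivative) simp
    then have G0: "poly_fun2 (pderiv P) (a, b) = 0"
      using DERIV_poly_fun2[of P a b] DERIV_unique by blast
    \<comment> \<open>\<open>?l\<close> is the polynomial tX, where the line Y = tX passes through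
      (a, b). Homogeneity turns the zeros of \<open>P\<close> and of its Y-derivative at (a, b) into
      zeros along the whole line, so Y - tX divides \<open>P\<close> twice.\<close>
    let ?l = "[:0, t:]"
    have zero: "poly Q ?l = 0" if "poly_fun2 Q (a, b) = 0" "\<And>i j. coeff (coeff Q j) i \<noteq> 0 \<Longrightarrow> i + j = m"
      for Q m
    proof -
      have "poly_fun2 Q (1, t) = 0"
        using poly_fun2_scale[of Q m a 1 t] that ab False by simp
      then have "poly (poly Q ?l) x = 0" for x
        using poly_fun2_scale[of Q m x 1 t] that(2) by (simp add: poly_poly_eq_poly_fun2)
      then show ?thesis using poly_all_0_iff_0 by blast
    qed
    have z1: "poly P ?l = 0" by (rule zero[OF F0 n])
    then obtain Q where Q: "P = [:- ?l, 1:] * Q" by (auto simp: poly_eq_0_iff_dvd elim: dvdE)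
    have "pderiv P = [:- ?l, 1:] * pderiv Q + Q"
      unfolding Q pderiv_mult by (simp add: pderiv_pCons)
    moreover have "poly (pderiv P) ?l = 0" by (rule zero[OF G0 nP])
    ultimately have "poly Q ?l = 0" by simp
    then obtain Q' where "Q = [:- ?l, 1:] * Q'" by (auto simp: poly_eq_0_iff_dvd elim: dvdE)
    then have "P = [:- ?l, 1:]\<^sup>2 * Q'" using Q by (simp only: power2_eq_square mult.assoc)
    then have "[:- ?l, 1:]\<^sup>2 dvd P" by simp
    then have "[:- ?l, 1:] dvd 1" using assms(2) by (simp add: squarefree_def)
    then have "degree [:- ?l, 1:] \<le> degree (1 :: real poly poly)" by (rule dvd_imp_degree_le) simp
    then show False by simp
  next
    \<comment> \<open>On the axis the double factor is X, a constant of the outer polynomial ring;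
      so the square of X is shown to divide every coefficient of \<open>P\<close>.\<close>
    case True
    then have b: "b \<noteq> 0" using ne by (simp add: zero_prod_def)
    let ?q = "poly P [:b:]"
    have q: "poly_fun2 P (x, b) = poly ?q x" for x by (simp add: poly_fun2_def)
    have "((\<lambda>x::real. (x, b)) has_derivative (\<lambda>x. (x, 0))) (at 0)"
      by (auto intro!: derivative_eq_intros)
    then have "((\<lambda>x. poly_fun2 P (x, b)) has_derivative (\<lambda>_. 0)) (at 0)"
      using has_derivative_compose[of "\<lambda>x::real. (x, b)" _ 0 UNIV "poly_fun2 P" "\<lambda>_. 0"] der True by simp
    then have "((\<lambda>x. poly ?q x) has_real_derivative 0) (at 0)"
      unfolding q by (rule has_derivative_imp_has_field_derivative) simp
    then have "poly (pderiv ?q) 0 = 0" using poly_DERIV DERIV_unique by blast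
    then have q1: "coeff ?q 1 = 0" by (simp add: poly_0_coeff_0 coeff_pderiv)
    have q0: "coeff ?q 0 = 0" using F0 True q[of 0] by (simp add: poly_0_coeff_0)
    have c: "coeff (coeff P j) i = 0" if "i \<le> 1" for i j
    proof (rule ccontr)
      assume nz: "coeff (coeff P j) i \<noteq> 0"
      then have "i + j = n" by (rule n)
      moreover have "coeff ?q i = 0" using q0 q1 that by (cases "i = 0") (auto simp: le_Suc_eq)
      ultimately show False using nz b coeff_poly_const[OF n, where y = b and i = i] by auto
    qed
    have "[:0, 1:]\<^sup>2 dvd coeff P j" for j
    proof -
      obtain a' r where r: "coeff P j = pCons a' r" by (cases "coeff P j")
      obtain b' r' where r': "r = pCons b' r'" by (cases r)
      have "a' = 0" "b' = 0" using c[of 0 j] c[of 1 j] by (simp_all add: r r')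
      then have "coeff P j = [:0, 1:]\<^sup>2 * r'" by (simp add: r r' power2_eq_square)
      then show ?thesis by simp
    qed
    then have "[:[:0, 1:]\<^sup>2:] dvd P" by (simp add: const_poly_dvd_iff)
    moreover have "[:[:0, 1::real:]\<^sup>2:] = [:[:0, 1:]:]\<^sup>2" by (simp add: power2_eq_square)
    ultimately have "[:[:0, 1::real:]:] dvd 1" using assms(2) unfolding squarefree_def by metis
    then have "[:0, 1::real:] dvd 1" using is_unit_const_poly_iff by blast
    then have "degree [:0, 1::real:] \<le> degree (1 :: real poly)" by (rule dvd_imp_degree_le) simp
    then show False by simp
  qed
qed

lemma smooth_on_differentiable: "smooth_on S f \<Longrightarrow> x \<in> S \<Longrightarrow> f differentiable (at x)"
  unfolding smooth_on_def using diff_k_on.simps(2) by blast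

lemma smooth_on_continuous_on: "smooth_on S f \<Longrightarrow> continuous_on S f"
  unfolding smooth_on_def using diff_k_on.simps(1) by blast

lemma smooth_on_continuous_derivative:
  "smooth_on S f \<Longrightarrow> continuous_on S (\<lambda>x. frechet_derivative f (at x) v)"
  unfolding smooth_on_def using diff_k_on.simps by blast

text \<open>A critical point \<open>q\<close> of \<open>F\<close> near \<open>p\<close> pulls back
  along \<open>h\<close> to a critical point of the composite of \<open>\<phi>\<close> and the
  polynomial, and applying the inverse \<open>k'\<close> of \<open>\<phi>\<close> removes
  \<open>\<phi>\<close>. The result is a critical point of the polynomial different from 0, since
  \<open>h 0 = 0\<close> and \<open>q\<close> is not \<open>p\<close>.\<close>

lemma isolated_critical_of_germ:
  fixes F :: "real \<times> real \<Rightarrow> real"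
  assumes P: "homogeneous2 P" "squarefree P"
    and equiv: "smoothly_equivalent (\<lambda>u. F (p + u) - F p) (poly_fun2 P)"
  obtains U where "open U" "p \<in> U" "\<And>q. q \<in> U \<Longrightarrow> q \<noteq> p \<Longrightarrow> \<not> (F has_derivative (\<lambda>_. 0)) (at q)"
proof -
  obtain h \<phi> where g0: "poly_fun2 P 0 = 0" and h: "diffeo_germ h" and \<phi>: "diffeo_germ \<phi>"
    and ev: "eventually (\<lambda>x. \<phi> (poly_fun2 P x) = F (p + h x) - F p) (nhds 0)"
    using equiv unfolding smoothly_equivalent_def smooth_germ_def by blast
  obtain U V k where UV: "open U" "0 \<in> U" "open V" "homeomorphism U V h k" "smooth_on U h" "h 0 = 0"
    using h unfolding diffeo_germ_def by blast
  obtain U' V' k' where UV': "open U'" "0 \<in> U'" "open V'" "homeomorphism U' V' \<phi> k'" "smooth_on U' \<phi>"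
    "smooth_on V' k'"
    using \<phi> unfolding diffeo_germ_def by blast
  obtain N where N: "open N" "0 \<in> N" "\<And>x. x \<in> N \<Longrightarrow> \<phi> (poly_fun2 P x) = F (p + h x) - F p"
    using ev unfolding eventually_nhds by blast
  define M where "M = N \<inter> U \<inter> poly_fun2 P -` U'"
  have oM: "open M" unfolding M_def
    using N(1) UV(1) open_vimage[OF UV'(1) continuous_poly_fun2] by blast
  have M0: "0 \<in> M" using N UV UV' g0 by (simp add: M_def)
  have k: "continuous_on V k" "\<And>x. x \<in> U \<Longrightarrow> k (h x) = x" "\<And>y. y \<in> V \<Longrightarrow> h (k y) = y"
    "\<And>x. x \<in> U \<Longrightarrow> h x \<in> V"
    using UV(4) unfolding homeomorphism_def by auto
  have k': "\<And>x. x \<in> U' \<Longrightarrow> k' (\<phi> x) = x" "\<And>x. x \<in> U' \<Longrightarrow> \<phi> x \<in> V'"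
    using UV'(4) unfolding homeomorphism_def by auto
  define X where "X = V \<inter> k -` M"
  have oX: "open X" unfolding X_def using continuous_open_preimage[OF k(1) UV(3) oM] .
  have X0: "0 \<in> X" using k(2)[OF UV(2)] k(4)[OF UV(2)] UV(6) M0 by (simp add: X_def)
  show thesis
  proof
    show "open ((\<lambda>u. u - p) -` X)" using oX by (intro open_vimage continuous_intros)
    show "p \<in> (\<lambda>u. u - p) -` X" using X0 by simp
    fix q assume q: "q \<in> (\<lambda>u. u - p) -` X" "q \<noteq> p"
    show "\<not> (F has_derivative (\<lambda>_. 0)) (at q)"
    proof
      assume der: "(F has_derivative (\<lambda>_. 0)) (at q)"
      define x where "x = k (q - p)"
      have x: "x \<in> M" "h x = q - p" using q(1) k(3) by (auto simp: X_def x_def)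
      have xn: "x \<noteq> 0" using x(2) UV(6) q(2) by auto
      have xU: "x \<in> U" "poly_fun2 P x \<in> U'" using x(1) by (auto simp: M_def)
      obtain D where D: "(h has_derivative D) (at x)"
        using smooth_on_differentiable[OF UV(5) xU(1)] by (auto simp: differentiable_def)
      have "((\<lambda>x. p + h x) has_derivative D) (at x)"
        using D by (auto intro!: derivative_eq_intros)
      then have "((\<lambda>x. F (p + h x)) has_derivative (\<lambda>_. 0)) (at x)"
        using has_derivative_compose[of "\<lambda>x. p + h x" D x UNIV F "\<lambda>_. 0"] der x(2) by simp
      then have "((\<lambda>x. F (p + h x) - F p) has_derivative (\<lambda>_. 0)) (at x)"
        by (auto intro!: derivative_eq_intros)
      then have 1: "((\<lambda>x. \<phi> (poly_fun2 P x)) has_derivative (\<lambda>_. 0)) (at x)"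
        by (rule has_derivative_transform_within_open[OF _ oM x(1)]) (simp add: N(3) M_def)
      obtain D' where D': "(k' has_derivative D') (at (\<phi> (poly_fun2 P x)))"
        using smooth_on_differentiable[OF UV'(6) k'(2)[OF xU(2)]] by (auto simp: differentiable_def)
      have "D' 0 = 0" using D' has_derivative_linear linear_0 by blast
      then have "((\<lambda>x. k' (\<phi> (poly_fun2 P x))) has_derivative (\<lambda>_. 0)) (at x)"
        using has_derivative_compose[OF 1 D'] by simp
      then have "(poly_fun2 P has_derivative (\<lambda>_. 0)) (at x)"
        by (rule has_derivative_transform_within_open[OF _ oM x(1)]) (simp add: k'(1) M_def)
      then show False
        using homogeneous2_noncritical[OF P g0, of "fst x" "snd x"] xn by simp
    qed
  qed
qed

section \<open>Boxes at noncritical points\<close>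

text \<open>By monotonicity the level sets of \<open>G\<close> near the origin are graphs of continuous functions of the
  first coordinate.\<close>

lemma monotone_box:
  fixes G :: "real \<times> real \<Rightarrow> real"
  assumes cont: "continuous_on UNIV G" and r: "r > 0"
    and mono: "\<And>s t t'. \<bar>s\<bar> \<le> r \<Longrightarrow> \<bar>t\<bar> \<le> r \<Longrightarrow> \<bar>t'\<bar> \<le> r \<Longrightarrow> t < t' \<Longrightarrow> G (s, t) < G (s, t')"
  obtains B d where "open B" "0 \<in> B" "B \<subseteq> {-r..r} \<times> {-r..r}" "0 < d" "G ` B = {G 0 - d<..<G 0 + d}"
    "\<And>t. connected (B \<inter> G -` {t})"
proof -
  define c where "c = G 0"
  have lt: "G (0, -r) < c" "c < G (0, r)" using mono[of 0 "-r" 0] mono[of 0 0 r] r by (auto simp: c_def zero_prod_def)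
  \<comment> \<open>Half of the smaller gap: values within \<open>d\<close> of \<open>c\<close> then
    lie strictly between those of \<open>G\<close> at the bottom and at the top of the square, for
    first coordinate 0 and by continuity nearby.\<close>
  define d where "d = min (c - G (0, -r)) (G (0, r) - c) / 2"
  have d: "d > 0" "G (0, -r) < c - d" "c + d < G (0, r)"
  proof -
    show "d > 0" using lt by (simp add: d_def)
    have "d \<le> (c - G (0, -r)) / 2" "d \<le> (G (0, r) - c) / 2" by (simp_all add: d_def)
    then show "G (0, -r) < c - d" "c + d < G (0, r)" using lt by argo+
  qed
  have contl: "continuous_on UNIV (\<lambda>s. G (s, t))" for t
    by (rule continuous_on_compose2[OF cont]) (auto intro!: continuous_intros)
  have contr: "continuous_on UNIV (\<lambda>t. G (s, t))" for s
    by (rule continuous_on_compose2[OF cont]) (auto intro!: continuous_intros)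
  have lim: "((\<lambda>s. G (s, t)) \<longlongrightarrow> G (s0, t)) (at s0)" for s0 t
    using contl[of t] by (simp add: continuous_on_def)
  have "\<forall>\<^sub>F s in nhds 0. G (s, -r) < c - d \<and> c + d < G (s, r)"
    using order_tendstoD(2)[OF lim[of "-r" 0] d(2)] order_tendstoD(1)[OF lim[of r 0] d(3)] d
    by (simp add: eventually_nhds_conv_at eventually_conj)
  then obtain e where e: "e > 0" "\<And>s. \<bar>s\<bar> < e \<Longrightarrow> G (s, -r) < c - d \<and> c + d < G (s, r)"
    unfolding eventually_nhds_metric by (auto simp: dist_real_def)
  define s0 where "s0 = min e r"
  have s0: "s0 > 0" "s0 \<le> r" "s0 \<le> e" using e(1) r by (simp_all add: s0_def)
  define B where "B = {x. \<bar>fst x\<bar> < s0 \<and> \<bar>snd x\<bar> < r \<and> \<bar>G x - c\<bar> < d}"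
  have oB: "open B" unfolding B_def
    by (intro open_Collect_conj open_Collect_less continuous_intros cont)
  have slice: "B \<inter> G -` {\<tau>} \<noteq> {} \<and> connected (B \<inter> G -` {\<tau>})" if \<tau>: "\<bar>\<tau> - c\<bar> < d" for \<tau>
  proof -
    have "\<exists>t. \<bar>t\<bar> < r \<and> G (s, t) = \<tau>" if s: "\<bar>s\<bar> < s0" for s
    proof -
      have b: "G (s, -r) < \<tau>" "\<tau> < G (s, r)" using e(2)[of s] s s0 \<tau> by (auto simp: abs_less_iff)
      obtain t where t: "-r \<le> t" "t \<le> r" "G (s, t) = \<tau>"
        using IVT'[of "\<lambda>t. G (s, t)" "-r" \<tau> r] b r continuous_on_subset[OF contr[of s]] by auto
      have "t \<noteq> r" "t \<noteq> - r" using t(3) b by auto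
      then show ?thesis using t by (intro exI[of _ t]) auto
    qed
    then have "\<forall>s\<in>{-s0<..<s0}. \<exists>t. \<bar>t\<bar> < r \<and> G (s, t) = \<tau>" by (auto simp: abs_less_iff)
    from bchoice[OF this] obtain m where m: "\<forall>s\<in>{-s0<..<s0}. \<bar>m s\<bar> < r \<and> G (s, m s) = \<tau>" ..
    have eq: "B \<inter> G -` {\<tau>} = (\<lambda>s. (s, m s)) ` {-s0<..<s0}"
    proof (intro equalityI subsetI)
      fix x assume x: "x \<in> B \<inter> G -` {\<tau>}"
      obtain s t where st: "x = (s, t)" by (cases x)
      have s: "s \<in> {-s0<..<s0}" "\<bar>s\<bar> \<le> r" "\<bar>t\<bar> < r" "G (s, t) = \<tau>" using x st s0 by (auto simp: B_def)
      have ms: "\<bar>m s\<bar> < r" "G (s, m s) = \<tau>" using bspec[OF m s(1)] by simp_all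
      have "\<not> t < m s" "\<not> m s < t" using mono[of s t "m s"] mono[of s "m s" t] s ms by auto
      then show "x \<in> (\<lambda>s. (s, m s)) ` {-s0<..<s0}" using s(1) st by auto
    next
      fix x assume "x \<in> (\<lambda>s. (s, m s)) ` {-s0<..<s0}"
      then show "x \<in> B \<inter> G -` {\<tau>}" using m \<tau> by (auto simp: B_def)
    qed
    \<comment> \<open>A test height \<open>a'\<close> below \<open>m s\<close> has
      \<open>G (s, a')\<close> below \<open>\<tau>\<close>; by continuity this persists for nearby
      \<open>y\<close>, and monotonicity then keeps \<open>m y\<close> above \<open>a'\<close>.
      Heights above \<open>m s\<close> are treated in the same way.\<close>
    have "(m \<longlongrightarrow> m s) (at s within {-s0<..<s0})" if s: "s \<in> {-s0<..<s0}" for s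
    proof (rule order_tendstoI)
      have sr: "\<bar>m s\<bar> < r" "G (s, m s) = \<tau>" "\<bar>s\<bar> \<le> r" using m s s0 by auto
      fix a assume a: "a < m s"
      define a' where "a' = max a (- r)"
      have a': "a' < m s" "\<bar>a'\<bar> \<le> r" "a \<le> a'" using a sr by (auto simp: a'_def)
      have "G (s, a') < \<tau>" using mono[of s a' "m s"] a' sr by simp
      then have "\<forall>\<^sub>F y in at s. G (y, a') < \<tau>" by (rule order_tendstoD(2)[OF lim])
      then show "\<forall>\<^sub>F y in at s within {-s0<..<s0}. a < m y"
        unfolding eventually_at_filter
      proof (rule eventually_mono, intro impI)
        fix y assume y: "y \<noteq> s \<longrightarrow> y \<in> UNIV \<longrightarrow> G (y, a') < \<tau>" "y \<noteq> s" "y \<in> {-s0<..<s0}"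
        have my: "\<bar>m y\<bar> < r" "G (y, m y) = \<tau>" using bspec[OF m y(3)] by simp_all
        have yr: "\<bar>y\<bar> \<le> r" using y(3) s0(2) by auto
        have "\<not> m y \<le> a'" using mono[of y "m y" a', OF yr] my y a'(2) by (auto simp: le_less)
        then show "a < m y" using a'(3) by simp
      qed
    next
      have sr: "\<bar>m s\<bar> < r" "G (s, m s) = \<tau>" "\<bar>s\<bar> \<le> r" using m s s0 by auto
      fix a assume a: "m s < a"
      define a' where "a' = min a r"
      have a': "m s < a'" "\<bar>a'\<bar> \<le> r" "a' \<le> a" using a sr by (auto simp: a'_def)
      have "\<tau> < G (s, a')" using mono[of s "m s" a'] a' sr by simp
      then have "\<forall>\<^sub>F y in at s. \<tau> < G (y, a')" by (rule order_tendstoD(1)[OF lim])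
      then show "\<forall>\<^sub>F y in at s within {-s0<..<s0}. m y < a"
        unfolding eventually_at_filter
      proof (rule eventually_mono, intro impI)
        fix y assume y: "y \<noteq> s \<longrightarrow> y \<in> UNIV \<longrightarrow> \<tau> < G (y, a')" "y \<noteq> s" "y \<in> {-s0<..<s0}"
        have my: "\<bar>m y\<bar> < r" "G (y, m y) = \<tau>" using bspec[OF m y(3)] by simp_all
        have yr: "\<bar>y\<bar> \<le> r" using y(3) s0(2) by auto
        have "\<not> a' \<le> m y" using mono[of y a' "m y", OF yr] my y a'(2) by (auto simp: le_less)
        then show "m y < a" using a'(3) by simp
      qed
    qed
    then have "continuous_on {-s0<..<s0} m" by (simp add: continuous_on_def)
    then have "connected ((\<lambda>s. (s, m s)) ` {-s0<..<s0})"
      by (intro connected_continuous_image continuous_intros) auto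
    then show ?thesis using eq s0 by auto
  qed
  show thesis
  proof (rule that[OF oB _ _ d(1)])
    show "0 \<in> B" using s0 r d by (simp add: B_def c_def)
    show "B \<subseteq> {-r..r} \<times> {-r..r}" using s0 by (auto simp: B_def abs_less_iff)
    show "G ` B = {G 0 - d<..<G 0 + d}"
    proof
      show "{G 0 - d<..<G 0 + d} \<subseteq> G ` B"
      proof
        fix \<tau> assume "\<tau> \<in> {G 0 - d<..<G 0 + d}"
        then have "\<bar>\<tau> - c\<bar> < d" by (auto simp: c_def abs_less_iff)
        then show "\<tau> \<in> G ` B" using slice by blast
      qed
    qed (auto simp: B_def c_def)
    show "connected (B \<inter> G -` {\<tau>})" for \<tau>
    proof (cases "\<bar>\<tau> - c\<bar> < d")
      case False
      then have "B \<inter> G -` {\<tau>} = {}" by (auto simp: B_def)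
      then show ?thesis by simp
    qed (use slice in blast)
  qed
qed

lemma noncritical_direction:
  fixes F :: "real \<times> real \<Rightarrow> real"
  assumes "smooth_on UNIV F" "\<not> (F has_derivative (\<lambda>_. 0)) (at z)"
  obtains v where "frechet_derivative F (at z) v > 0"
proof -
  have D: "(F has_derivative frechet_derivative F (at z)) (at z)"
    using smooth_on_differentiable[OF assms(1)] frechet_derivative_works by blast
  then obtain v where v: "frechet_derivative F (at z) v \<noteq> 0"
    using assms(2) by (metis ext)
  have "frechet_derivative F (at z) (- v) = - frechet_derivative F (at z) v"
    using has_derivative_linear[OF D] by (rule linear_neg)
  then show thesis using that[of v] that[of "- v"] v by (cases "frechet_derivative F (at z) v > 0") auto
qed

text \<open>Near \<open>z\<close> the derivative of \<open>F\<close> along some \<open>v\<close> is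
  positive. In linear coordinates whose second axis is \<open>v\<close> and whose first axis
  \<open>w\<close> is perpendicular to it, \<open>F\<close> is strictly increasing in the second
  coordinate, as \<open>monotone_box\<close> requires.\<close>

lemma noncritical_box:
  fixes F :: "real \<times> real \<Rightarrow> real"
  assumes F: "smooth_on UNIV F" and z: "\<not> (F has_derivative (\<lambda>_. 0)) (at z)"
    and O': "open O'" "z \<in> O'"
  obtains B d where "open B" "z \<in> B" "B \<subseteq> O'" "0 < d" "F ` B = {F z - d<..<F z + d}"
    "\<forall>t. connected (B \<inter> F -` {t})"
proof -
  obtain v where v: "frechet_derivative F (at z) v > 0" using noncritical_direction[OF F z] .
  define Dx where "Dx x = frechet_derivative F (at x) v" for x
  have contD: "continuous_on UNIV Dx"
    unfolding Dx_def using smooth_on_continuous_derivative[OF F] .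
  have "open (O' \<inter> {x. 0 < Dx x})"
    by (intro open_Int O' open_Collect_less contD continuous_intros)
  then obtain e where e: "e > 0" "ball z e \<subseteq> O' \<inter> {x. 0 < Dx x}"
    using open_contains_ball O'(2) v by (metis Dx_def IntI mem_Collect_eq)
  define w where "w = (- snd v, fst v)"
  define \<psi> where "\<psi> x = z + fst x *\<^sub>R w + snd x *\<^sub>R v" for x :: "real \<times> real"
  define N where "N = (fst v)\<^sup>2 + (snd v)\<^sup>2"
  \<comment> \<open>The inverse of \<open>\<psi>\<close>: orthogonal projections of
    \<open>x - z\<close> to \<open>w\<close> and \<open>v\<close>, both of which have squared length
    \<open>N\<close>.\<close>
  define \<sigma> where "\<sigma> x = ((fst v * snd (x - z) - snd v * fst (x - z)) / N,
    (fst v * fst (x - z) + snd v * snd (x - z)) / N)" for x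
  have "v \<noteq> 0"
  proof
    assume "v = 0"
    then have "frechet_derivative F (at z) v = 0"
      using smooth_on_differentiable[OF F] frechet_derivative_works has_derivative_linear linear_0 by blast
    then show False using v by simp
  qed
  then have N: "N > 0" unfolding N_def by (metis prod.collapse sum_power2_gt_zero_iff zero_prod_def)
  have \<psi>\<sigma>: "\<psi> (\<sigma> x) = x" for x
  proof -
    have comb: "(A / N) * B + (C / N) * E = (A * B + C * E) / N" for A B C E
      by (simp add: add_divide_distrib)
    have "fst (\<psi> (\<sigma> x)) = fst z + ((fst v * snd (x - z) - snd v * fst (x - z)) * (- snd v) +
        (fst v * fst (x - z) + snd v * snd (x - z)) * fst v) / N"
      unfolding \<psi>_def \<sigma>_def w_def comb[symmetric] by simp
    also have "\<dots> = fst z + N * fst (x - z) / N"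
      unfolding N_def by (simp add: algebra_simps power2_eq_square)
    finally have "fst (\<psi> (\<sigma> x)) = fst z + N * fst (x - z) / N" .
    moreover have "snd (\<psi> (\<sigma> x)) = snd z + ((fst v * snd (x - z) - snd v * fst (x - z)) * fst v +
        (fst v * fst (x - z) + snd v * snd (x - z)) * snd v) / N"
      unfolding \<psi>_def \<sigma>_def w_def comb[symmetric] by simp
    moreover have "\<dots> = snd z + N * snd (x - z) / N"
      unfolding N_def by (simp add: algebra_simps power2_eq_square)
    ultimately show ?thesis using N by (simp add: prod_eq_iff)
  qed
  have \<sigma>\<psi>: "\<sigma> (\<psi> x) = x" for x
  proof -
    have "fst (\<sigma> (\<psi> x)) = N * fst x / N" "snd (\<sigma> (\<psi> x)) = N * snd x / N"
      unfolding \<psi>_def \<sigma>_def w_def N_def by (simp_all add: algebra_simps power2_eq_square)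
    then show ?thesis using N by (simp add: prod_eq_iff)
  qed
  have cont\<sigma>: "continuous_on UNIV \<sigma>" unfolding \<sigma>_def using N by (intro continuous_intros) auto
  have cont\<psi>: "continuous_on A \<psi>" for A unfolding \<psi>_def by (intro continuous_intros)
  \<comment> \<open>For this \<open>r\<close> the coordinate square of half-width \<open>r\<close>
    is mapped into the ball of radius \<open>e\<close>; the summand 1 makes the estimate
    strict.\<close>
  define r where "r = e / (norm w + norm v + 1)"
  have r: "r > 0" using e(1) by (simp add: r_def add_nonneg_pos)
  have in_ball: "\<psi> (s, t) \<in> ball z e" if "\<bar>s\<bar> \<le> r" "\<bar>t\<bar> \<le> r" for s t
  proof -
    have "norm (s *\<^sub>R w + t *\<^sub>R v) \<le> \<bar>s\<bar> * norm w + \<bar>t\<bar> * norm v"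
      by (rule order_trans[OF norm_triangle_ineq]) simp
    also have "\<dots> \<le> r * norm w + r * norm v" using that by (intro add_mono mult_right_mono) auto
    also have "\<dots> < r * (norm w + norm v + 1)" using r by (simp add: algebra_simps)
    also have "\<dots> = e"
    proof -
      have "norm w + norm v + 1 > 0" by (simp add: add_nonneg_pos)
      then show ?thesis by (simp add: r_def)
    qed
    finally have "norm (s *\<^sub>R w + t *\<^sub>R v) < e" .
    moreover have "dist z (z + q) = norm q" for q
      by (metis add_diff_cancel_left' dist_norm norm_minus_commute)
    then have "dist z (\<psi> (s, t)) = norm (s *\<^sub>R w + t *\<^sub>R v)"
      by (simp add: \<psi>_def add.assoc)
    ultimately show ?thesis by simp
  qed
  define G where "G = F \<circ> \<psi>"
  have contF: "continuous_on UNIV F" using smooth_on_continuous_on[OF F] .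
  have contG: "continuous_on UNIV G"
    unfolding G_def by (rule continuous_on_compose[OF cont\<psi>]) (rule continuous_on_subset[OF contF], simp)
  have der: "((\<lambda>t. G (s, t)) has_real_derivative Dx (\<psi> (s, t))) (at t)" for s t
  proof (rule has_derivative_imp_has_field_derivative)
    have D: "(F has_derivative frechet_derivative F (at (\<psi> (s, t)))) (at (\<psi> (s, t)))"
      using smooth_on_differentiable[OF F] frechet_derivative_works by blast
    have "((\<lambda>t. \<psi> (s, t)) has_derivative (\<lambda>h. h *\<^sub>R v)) (at t)"
      unfolding \<psi>_def by (auto intro!: derivative_eq_intros)
    from has_derivative_compose[OF this D]
    show "((\<lambda>t. G (s, t)) has_derivative (\<lambda>h. frechet_derivative F (at (\<psi> (s, t))) (h *\<^sub>R v))) (at t)"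
      by (simp add: G_def)
    show "h * Dx (\<psi> (s, t)) = frechet_derivative F (at (\<psi> (s, t))) (h *\<^sub>R v)" for h
      using linear_scale[OF has_derivative_linear[OF D], of h v] by (simp add: Dx_def)
  qed
  have mono: "G (s, t) < G (s, t')" if "\<bar>s\<bar> \<le> r" "\<bar>t\<bar> \<le> r" "\<bar>t'\<bar> \<le> r" "t < t'" for s t t'
  proof (rule DERIV_pos_imp_increasing[OF that(4)])
    fix x assume "t \<le> x" "x \<le> t'"
    then have "\<bar>x\<bar> \<le> r" using that by auto
    then have "Dx (\<psi> (s, x)) > 0" using in_ball[OF that(1)] e(2) by blast
    then show "\<exists>y. DERIV (\<lambda>t. G (s, t)) x :> y \<and> y > 0" using der by blast
  qed
  have \<psi>0: "\<psi> 0 = z" by (simp add: \<psi>_def)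
  obtain B d where B: "open B" "0 \<in> B" "B \<subseteq> {-r..r} \<times> {-r..r}" "0 < d" "G ` B = {G 0 - d<..<G 0 + d}"
    "\<And>t. connected (B \<inter> G -` {t})"
    by (rule monotone_box[OF contG r mono]) auto
  have im: "\<psi> ` B = \<sigma> -` B" using \<psi>\<sigma> \<sigma>\<psi> by (auto simp: image_iff) metis
  show thesis
  proof (rule that; (intro allI)?)
    show "open (\<psi> ` B)" unfolding im using open_vimage[OF B(1) cont\<sigma>] .
    show "z \<in> \<psi> ` B" using B(2) \<psi>0 by (metis imageI)
    show "\<psi> ` B \<subseteq> O'"
    proof (rule image_subsetI)
      fix x assume "x \<in> B"
      then have "x \<in> {-r..r} \<times> {-r..r}" using B(3) by blast
      then have "\<bar>fst x\<bar> \<le> r" "\<bar>snd x\<bar> \<le> r" by (auto simp: mem_Times_iff abs_le_iff)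
      then show "\<psi> x \<in> O'" using in_ball[of "fst x" "snd x"] e(2) by auto
    qed
    show "0 < d" by (rule B)
    show "F ` \<psi> ` B = {F z - d<..<F z + d}" using B(5) \<psi>0 by (simp add: G_def image_comp)
    show "connected (\<psi> ` B \<inter> F -` {t})" for t
    proof -
      have "\<psi> ` B \<inter> F -` {t} = \<psi> ` (B \<inter> G -` {t})" by (auto simp: G_def)
      then show ?thesis using connected_continuous_image[OF cont\<psi> B(6)] by simp
    qed
  qed
qed

section \<open>Periods and the finiteness of the critical set\<close>

definition period :: "int \<Rightarrow> int \<Rightarrow> real \<times> real" where
  "period m n = (2 * pi * of_int m, 2 * pi * of_int n)"

lemma torus_cover_period: "torus_cover (x + period m n) = torus_cover x"
  by (cases x) (simp add: torus_cover_def period_def cis_mult[symmetric] cis_multiple_2pi)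

lemma period_reduce:
  obtains m n where "p + period m n \<in> cbox (0, 0) (2 * pi, 2 * pi)"
proof -
  have "\<exists>m. 0 \<le> x + 2 * pi * of_int m \<and> x + 2 * pi * of_int m \<le> 2 * pi" for x :: real
  proof -
    obtain k :: int where k: "of_int k \<le> x / (2 * pi)" "x / (2 * pi) \<le> of_int k + 1"
      using of_int_floor_le[of "x / (2 * pi)"] real_of_int_floor_add_one_ge[of "x / (2 * pi)"] by blast
    then have "of_int k * (2 * pi) \<le> x" "x \<le> (of_int k + 1) * (2 * pi)"
      by (simp_all add: field_simps)
    then show ?thesis by (intro exI[of _ "- k"]) (simp add: algebra_simps)
  qed
  then obtain m n where "0 \<le> fst p + 2 * pi * of_int m \<and> fst p + 2 * pi * of_int m \<le> 2 * pi"
    "0 \<le> snd p + 2 * pi * of_int n \<and> snd p + 2 * pi * of_int n \<le> 2 * pi" by metis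
  then show thesis using that[of m n] by (cases p) (simp add: period_def cbox_Pair_eq)
qed

text \<open>Every point of the plane has a neighbourhood without critical points except possibly
  itself: at a critical point by the germ condition, elsewhere because a positive directional
  derivative stays positive. By periodicity all critical points of \<open>f\<close> come from a
  compact square.\<close>

lemma finite_critical_points:
  assumes "f \<in> class_F"
  shows "finite {z. critical_point f z}"
proof -
  define F where "F = f \<circ> torus_cover"
  define crit where "crit p \<longleftrightarrow> (F has_derivative (\<lambda>_. 0)) (at p)" for p
  have F: "smooth_on UNIV F" using assms by (simp add: class_F_def F_def)
  have "\<forall>p. \<exists>U. open U \<and> p \<in> U \<and> (\<forall>q\<in>U. q \<noteq> p \<longrightarrow> \<not> crit q)"
  proof
    fix p
    show "\<exists>U. open U \<and> p \<in> U \<and> (\<forall>q\<in>U. q \<noteq> p \<longrightarrow> \<not> crit q)"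
    proof (cases "crit p")
      case True
      then have "critical_point f (torus_cover p)"
        unfolding critical_point_def crit_def F_def by blast
      then obtain P where P: "homogeneous2 P" "squarefree P"
        "smoothly_equivalent (\<lambda>u. f (torus_cover (p + u)) - f (torus_cover p)) (poly_fun2 P)"
        using assms unfolding class_F_def by blast
      then have "smoothly_equivalent (\<lambda>u. F (p + u) - F p) (poly_fun2 P)" by (simp add: F_def)
      from isolated_critical_of_germ[OF P(1,2) this] show ?thesis unfolding crit_def by metis
    next
      case False
      then obtain v where v: "frechet_derivative F (at p) v > 0"
        using noncritical_direction[OF F, of p] unfolding crit_def by blast
      have "open {x. 0 < frechet_derivative F (at x) v}"
        by (intro open_Collect_less smooth_on_continuous_derivative[OF F] continuous_intros)
      moreover have "\<not> crit q" if "0 < frechet_derivative F (at q) v" for q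
      proof
        assume "crit q"
        then have "frechet_derivative F (at q) = (\<lambda>_. 0)"
          unfolding crit_def by (rule frechet_derivative_at[symmetric])
        then show False using that by simp
      qed
      ultimately show ?thesis using v by (intro exI[of _ "{x. 0 < frechet_derivative F (at x) v}"]) auto
    qed
  qed
  from choice[OF this] obtain U where
    U: "\<forall>p. open (U p) \<and> p \<in> U p \<and> (\<forall>q\<in>U p. q \<noteq> p \<longrightarrow> \<not> crit q)" ..
  let ?K = "cbox (0, 0) (2 * pi, 2 * pi) :: (real \<times> real) set"
  obtain D where D: "D \<subseteq> ?K" "finite D" "?K \<subseteq> (\<Union>p\<in>D. U p)"
    using compactE_image[OF compact_cbox, of ?K U "(0,0)" "(2*pi,2*pi)"] U by blast
  have fin: "finite {p \<in> ?K. crit p}"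
  proof (rule finite_subset[OF _ D(2)], rule subsetI)
    fix p assume p: "p \<in> {p \<in> ?K. crit p}"
    then obtain d where d: "d \<in> D" "p \<in> U d" using D(3) by auto
    have "p = d" using spec[OF U, of d] p d(2) by auto
    then show "p \<in> D" using d(1) by simp
  qed
  have "{z. critical_point f z} \<subseteq> torus_cover ` {p \<in> ?K. crit p}"
  proof
    fix z assume "z \<in> {z. critical_point f z}"
    then obtain p where p: "torus_cover p = z" "crit p"
      unfolding critical_point_def crit_def F_def by blast
    obtain m n where mn: "p + period m n \<in> ?K" using period_reduce .
    let ?\<mu> = "period (- m) (- n)"
    have "period m n + ?\<mu> = 0" by (simp add: period_def zero_prod_def)
    then have pp: "(p + period m n) + ?\<mu> = p" by (simp add: add.assoc)
    have "((\<lambda>x. x + ?\<mu>) has_derivative (\<lambda>h. h)) (at (p + period m n))"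
      by (auto intro!: derivative_eq_intros)
    moreover have "(F has_derivative (\<lambda>_. 0)) (at ((p + period m n) + ?\<mu>))"
      using p(2) unfolding pp crit_def .
    ultimately have "((\<lambda>x. F (x + ?\<mu>)) has_derivative (\<lambda>_. 0)) (at (p + period m n))"
      by (rule has_derivative_compose)
    moreover have "(\<lambda>x. F (x + ?\<mu>)) = F" by (simp add: F_def fun_eq_iff torus_cover_period)
    ultimately have "crit (p + period m n)" unfolding crit_def by simp
    then show "z \<in> torus_cover ` {p \<in> ?K. crit p}"
      using mn p(1) torus_cover_period[of p m n] by (intro image_eqI[of _ _ "p + period m n"]) auto
  qed
  then show ?thesis using fin by (meson finite_imageI finite_subset)
qed

section \<open>The universal covering of the torus\<close>

definition periods :: "(real \<times> real) set" where
  "periods = {period m n | m n. True}"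

lemma period_add: "period m n + period m' n' = period (m + m') (n + n')"
  by (simp add: period_def algebra_simps)

lemma period_uminus: "- period m n = period (- m) (- n)"
  by (simp add: period_def)

lemma periods_add: "\<nu> \<in> periods \<Longrightarrow> \<mu> \<in> periods \<Longrightarrow> \<nu> + \<mu> \<in> periods"
  unfolding periods_def using period_add by blast

lemma periods_uminus: "\<nu> \<in> periods \<Longrightarrow> - \<nu> \<in> periods"
  unfolding periods_def using period_uminus by blast

lemma periods_diff: "\<nu> \<in> periods \<Longrightarrow> \<mu> \<in> periods \<Longrightarrow> \<nu> - \<mu> \<in> periods"
  using periods_add[of \<nu> "- \<mu>"] periods_uminus by simp

lemma torus_cover_shift: "\<nu> \<in> periods \<Longrightarrow> torus_cover (x + \<nu>) = torus_cover x"
  unfolding periods_def using torus_cover_period by blast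

lemma torus_cover_in_torus: "torus_cover x \<in> torus"
  using torus_cover_range by blast

lemma torus_coverE:
  assumes "z \<in> torus"
  obtains x where "torus_cover x = z"
  using assms that unfolding torus_cover_range[symmetric] by blast

lemma cis_eqE:
  assumes "cis s = cis t"
  obtains k :: int where "t = s + 2 * pi * of_int k"
proof -
  have "exp (\<i> * complex_of_real t) = exp (\<i> * complex_of_real s)" using assms by (simp add: cis_conv_exp)
  then obtain k :: int where "\<i> * complex_of_real t = \<i> * complex_of_real s + of_int (2 * k) * pi * \<i>"
    using exp_eq by blast
  then have "Im (\<i> * complex_of_real t) = Im (\<i> * complex_of_real s + of_int (2 * k) * pi * \<i>)" by simp
  then have "t = s + 2 * pi * of_int k" by simp
  then show thesis by (rule that)
qed

lemma torus_cover_eqE: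
  assumes "torus_cover x = torus_cover y"
  obtains \<nu> where "\<nu> \<in> periods" "y = x + \<nu>"
proof -
  have "cis (fst x) = cis (fst y)" "cis (snd x) = cis (snd y)"
    using assms by (auto simp: torus_cover_def split: prod.splits)
  then obtain m n :: int where "fst y = fst x + 2 * pi * of_int m" "snd y = snd x + 2 * pi * of_int n"
    by (metis cis_eqE)
  then have "y = x + period m n" by (simp add: period_def prod_eq_iff)
  then show thesis using that unfolding periods_def by blast
qed

lemma continuous_torus_cover: "continuous_on A torus_cover"
proof -
  have eq: "torus_cover x = (cis (fst x), cis (snd x))" for x
    by (cases x) (simp add: torus_cover_def)
  have "continuous_on A (\<lambda>x. (cis (fst x), cis (snd x)))" by (intro continuous_intros)
  then show ?thesis by (rule continuous_on_eq) (simp add: eq)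
qed

lemma torus_cover_square: "torus_cover ` cbox (0, 0) (2 * pi, 2 * pi) = torus"
proof
  show "torus \<subseteq> torus_cover ` cbox (0, 0) (2 * pi, 2 * pi)"
  proof
    fix z assume "z \<in> torus"
    then obtain p where p: "torus_cover p = z" by (rule torus_coverE)
    obtain m n where "p + period m n \<in> cbox (0, 0) (2 * pi, 2 * pi)" using period_reduce .
    then show "z \<in> torus_cover ` cbox (0, 0) (2 * pi, 2 * pi)"
      using p torus_cover_period[of p m n] by (metis imageI)
  qed
qed (use torus_cover_in_torus in blast)

lemma compact_torus: "compact torus"
  using compact_continuous_image[OF continuous_torus_cover compact_cbox] torus_cover_square by metis

lemma connected_torus: "connected torus"
  using connected_continuous_image[OF continuous_torus_cover connected_UNIV] torus_cover_range by metis

lemma vimage_image_torus_cover: "torus_cover -` (torus_cover ` A) = (\<Union>\<nu>\<in>periods. (\<lambda>x. x + \<nu>) ` A)"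
proof (intro equalityI subsetI)
  fix x assume "x \<in> torus_cover -` (torus_cover ` A)"
  then obtain a where a: "a \<in> A" "torus_cover a = torus_cover x" by auto
  obtain \<nu> where "\<nu> \<in> periods" "x = a + \<nu>" using torus_cover_eqE[OF a(2)] .
  then show "x \<in> (\<Union>\<nu>\<in>periods. (\<lambda>x. x + \<nu>) ` A)" using a(1) by blast
next
  fix x assume "x \<in> (\<Union>\<nu>\<in>periods. (\<lambda>x. x + \<nu>) ` A)"
  then obtain \<nu> a where "\<nu> \<in> periods" "a \<in> A" "x = a + \<nu>" by auto
  then show "x \<in> torus_cover -` (torus_cover ` A)" using torus_cover_shift[of \<nu> a] by simp
qed

text \<open>The covering is a quotient map: if the preimage of \<open>A\<close> is open, the
  complement of \<open>A\<close> is the image of a compact part of the fundamental square and hence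
  closed.\<close>

lemma openin_torus_iff:
  assumes "A \<subseteq> torus"
  shows "openin (top_of_set torus) A \<longleftrightarrow> open (torus_cover -` A)"
proof
  assume "openin (top_of_set torus) A"
  then obtain G where "open G" "A = torus \<inter> G" by (auto simp: openin_open)
  then have "torus_cover -` A = torus_cover -` G" using torus_cover_in_torus by blast
  then show "open (torus_cover -` A)" using open_vimage[OF \<open>open G\<close> continuous_torus_cover] by simp
next
  assume op: "open (torus_cover -` A)"
  let ?K = "cbox (0, 0) (2 * pi, 2 * pi) :: (real \<times> real) set"
  have "torus - A = torus_cover ` (?K - torus_cover -` A)"
  proof (intro equalityI subsetI)
    fix z assume z: "z \<in> torus - A"
    then have "z \<in> torus_cover ` ?K" using torus_cover_square by simp
    then obtain x where "z = torus_cover x" "x \<in> ?K" by (rule imageE)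
    then show "z \<in> torus_cover ` (?K - torus_cover -` A)" using z by blast
  next
    fix z assume "z \<in> torus_cover ` (?K - torus_cover -` A)"
    then show "z \<in> torus - A" using torus_cover_in_torus by blast
  qed
  moreover have "compact (?K - torus_cover -` A)" using compact_diff[OF compact_cbox op] .
  ultimately have "compact (torus - A)"
    using compact_continuous_image[OF continuous_torus_cover] by metis
  then have "open (- (torus - A))" using compact_imp_closed by blast
  moreover have "A = torus \<inter> - (torus - A)" using assms by blast
  ultimately show "openin (top_of_set torus) A" by (metis openin_open)
qed

lemma open_torus_cover_image:
  assumes "open G"
  shows "openin (top_of_set torus) (torus_cover ` G)"
proof -
  have "open (\<Union>\<nu>\<in>periods. (\<lambda>x. x + \<nu>) ` G)"
    using open_translation[OF assms] by (intro open_UN ballI) (simp add: add.commute)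
  then have "open (torus_cover -` (torus_cover ` G))" unfolding vimage_image_torus_cover .
  then show ?thesis using openin_torus_iff torus_cover_in_torus by (metis image_subset_iff)
qed

lemma path_component_translate:
  fixes S :: "(real \<times> real) set"
  assumes pc: "path_component S a b" and sh: "\<And>z. z \<in> S \<Longrightarrow> z + \<mu> \<in> S"
  shows "path_component S (a + \<mu>) (b + \<mu>)"
proof -
  obtain g where g: "path g" "path_image g \<subseteq> S" "pathstart g = a" "pathfinish g = b"
    using pc unfolding path_component_def by blast
  have "path (\<lambda>t. g t + \<mu>)" using g(1) unfolding path_def by (intro continuous_intros)
  moreover have "path_image (\<lambda>t. g t + \<mu>) \<subseteq> S"
    unfolding path_image_def
  proof (rule image_subsetI)
    fix t :: real assume "t \<in> {0..1}"
    then have "g t \<in> S" using g(2) unfolding path_image_def by blast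
    then show "g t + \<mu> \<in> S" by (rule sh)
  qed
  moreover have "pathstart (\<lambda>t. g t + \<mu>) = a + \<mu>" "pathfinish (\<lambda>t. g t + \<mu>) = b + \<mu>"
    using g by (simp_all add: pathstart_def pathfinish_def)
  ultimately show ?thesis unfolding path_component_def by blast
qed

lemma path_component_shift:
  assumes "path_component (torus_cover -` X) a b" "\<nu> \<in> periods"
  shows "path_component (torus_cover -` X) (a + \<nu>) (b + \<nu>)"
  by (rule path_component_translate[OF assms(1)]) (simp only: vimage_eq torus_cover_shift[OF assms(2)])

text \<open>Deck translations permute the path components of the preimage of \<open>X\<close>. Their
  images in \<open>X\<close> are open, and any two are equal or disjoint, so connectedness of
  \<open>X\<close> leaves only one image: the translations act transitively on the path
  components.\<close>

lemma path_component_transitive_cover: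
  assumes X: "openin (top_of_set torus) X" "connected X" and xy: "torus_cover x \<in> X" "torus_cover y \<in> X"
  obtains \<nu> where "\<nu> \<in> periods" "path_component (torus_cover -` X) x (y + \<nu>)"
proof -
  let ?P = "torus_cover -` X"
  have oP: "open ?P" using X(1) openin_torus_iff openin_imp_subset by blast
  have opc: "openin (top_of_set torus) (torus_cover ` path_component_set ?P a)" for a
    by (rule open_torus_cover_image) (rule open_path_component[OF oP])
  let ?Y = "{a \<in> ?P. \<nexists>\<nu>. \<nu> \<in> periods \<and> path_component ?P x (a + \<nu>)}"
  define A where "A = torus_cover ` path_component_set ?P x"
  define B where "B = (\<Union>a\<in>?Y. torus_cover ` path_component_set ?P a)"
  have "X \<subseteq> A"
  proof (rule connected_subset_of_separation[OF X(2)])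
    show "openin (top_of_set torus) A" unfolding A_def by (rule opc)
    show "openin (top_of_set torus) B" unfolding B_def using opc by (intro openin_Union) blast
    show "X \<subseteq> A \<union> B"
    proof
      fix z assume z: "z \<in> X"
      then have "z \<in> torus" using X(1) openin_imp_subset by blast
      then obtain a where a: "torus_cover a = z" by (rule torus_coverE)
      then have aP: "a \<in> ?P" using z by simp
      show "z \<in> A \<union> B"
      proof (cases "a \<in> ?Y")
        case True
        have "a \<in> path_component_set ?P a" using aP by (simp add: path_component_refl_eq)
        then show ?thesis using True a B_def by blast
      next
        case False
        then obtain \<nu> where \<nu>: "\<nu> \<in> periods" "path_component ?P x (a + \<nu>)" using aP by blast
        then have "z \<in> A" unfolding A_def using torus_cover_shift[OF \<nu>(1), of a] a
          by (metis imageI mem_Collect_eq)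
        then show ?thesis by simp
      qed
    qed
    show "A \<inter> B \<inter> X = {}"
    proof (rule ccontr)
      assume "A \<inter> B \<inter> X \<noteq> {}"
      then obtain z where "z \<in> A" "z \<in> B" by blast
      then obtain a c d where acd: "a \<in> ?Y" "path_component ?P x c" "path_component ?P a d"
        "torus_cover d = torus_cover c"
        unfolding A_def B_def by auto
      obtain \<nu> where \<nu>: "\<nu> \<in> periods" "c = d + \<nu>" using torus_cover_eqE[OF acd(4)] .
      have "path_component ?P (a + \<nu>) c" using path_component_shift[OF acd(3) \<nu>(1)] \<nu>(2) by simp
      then have "path_component ?P x (a + \<nu>)" using acd(2) path_component_sym path_component_trans by blast
      then show False using acd(1) \<nu>(1) by blast
    qed
    show "A \<inter> X \<noteq> {}"
    proof -
      have "x \<in> path_component_set ?P x" using xy(1) by (simp add: path_component_refl_eq)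
      then have "torus_cover x \<in> A" unfolding A_def by (rule imageI)
      then show ?thesis using xy(1) by blast
    qed
  qed
  then obtain c where c: "path_component ?P x c" "torus_cover y = torus_cover c"
    using xy(2) unfolding A_def by auto
  obtain \<nu> where "\<nu> \<in> periods" "c = y + \<nu>" using torus_cover_eqE[OF c(2)] .
  then show thesis using that c(1) by blast
qed

section \<open>Essential subsets of the torus\<close>

text \<open>\<open>wraps X \<nu>\<close>: some loop in \<open>X\<close> represents the class of \<open>\<nu>\<close> in the fundamental group of the torus.\<close>

definition wraps :: "(complex \<times> complex) set \<Rightarrow> real \<times> real \<Rightarrow> bool" where
  "wraps X \<nu> \<longleftrightarrow> \<nu> \<in> periods \<and> (\<exists>x. path_component (torus_cover -` X) x (x + \<nu>))"

definition essential :: "(complex \<times> complex) set \<Rightarrow> bool" where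
  "essential X \<longleftrightarrow> (\<exists>\<nu>. \<nu> \<noteq> 0 \<and> wraps X \<nu>)"

lemma wraps_mono: "A \<subseteq> B \<Longrightarrow> wraps A \<nu> \<Longrightarrow> wraps B \<nu>"
  unfolding wraps_def by (meson path_component_of_subset vimage_mono)

lemma essential_mono: "A \<subseteq> B \<Longrightarrow> essential A \<Longrightarrow> essential B"
  unfolding essential_def using wraps_mono by blast

text \<open>A path is compact, so finitely many members of the chain cover the lifted loop, and the
  largest of them contains it.\<close>

lemma essential_Union:
  assumes "\<U> \<noteq> {}" "\<And>A. A \<in> \<U> \<Longrightarrow> openin (top_of_set torus) A"
    and chain: "\<And>A B. A \<in> \<U> \<Longrightarrow> B \<in> \<U> \<Longrightarrow> A \<subseteq> B \<or> B \<subseteq> A" and "essential (\<Union>\<U>)"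
  shows "\<exists>A\<in>\<U>. essential A"
proof -
  obtain \<nu> x where \<nu>: "\<nu> \<noteq> 0" "\<nu> \<in> periods" "path_component (torus_cover -` \<Union>\<U>) x (x + \<nu>)"
    using assms(4) unfolding essential_def wraps_def by blast
  obtain g where g: "path g" "path_image g \<subseteq> torus_cover -` \<Union>\<U>" "pathstart g = x" "pathfinish g = x + \<nu>"
    using \<nu>(3) unfolding path_component_def by blast
  have op: "open (torus_cover -` A)" if "A \<in> \<U>" for A
    using assms(2)[OF that] openin_torus_iff openin_imp_subset by blast
  have "path_image g \<subseteq> (\<Union>A\<in>\<U>. torus_cover -` A)" using g(2) by blast
  then obtain \<D> where D: "\<D> \<subseteq> \<U>" "finite \<D>" "path_image g \<subseteq> (\<Union>A\<in>\<D>. torus_cover -` A)"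
    using compactE_image[OF compact_path_image[OF g(1)], of \<U> "\<lambda>A. torus_cover -` A"] op by metis
  have "\<D> \<noteq> {}" using D(3) by auto
  moreover have "subset.chain \<U> \<D>" using D(1) chain unfolding subset.chain_def by blast
  ultimately have "\<Union>\<D> \<in> \<D>" using D(2) Union_in_chain by blast
  moreover have "path_image g \<subseteq> torus_cover -` \<Union>\<D>" using D(3) by blast
  then have "wraps (\<Union>\<D>) \<nu>" unfolding wraps_def path_component_def using \<nu>(2) g by blast
  ultimately show ?thesis using D(1) \<nu>(1) unfolding essential_def by blast
qed

section \<open>Loops with independent classes cross\<close>

lemma path_component_multiple:
  assumes "path_component S x (x + \<nu>)" and inv: "\<And>z. z \<in> S \<Longrightarrow> z + \<nu> \<in> S" "\<And>z. z \<in> S \<Longrightarrow> z - \<nu> \<in> S"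
  shows "path_component S (x - of_nat k *\<^sub>R \<nu>) (x + of_nat k *\<^sub>R (\<nu> :: real \<times> real))"
proof -
  have up: "path_component S (x + of_nat k *\<^sub>R \<nu>) (x + of_nat (Suc k) *\<^sub>R \<nu>)" for k
  proof (induction k)
    case (Suc k)
    show ?case using path_component_translate[OF Suc inv(1)] by (simp add: algebra_simps scaleR_2)
  qed (use assms(1) in simp)
  have down: "path_component S (x - of_nat (Suc k) *\<^sub>R \<nu>) (x - of_nat k *\<^sub>R \<nu>)" for k
  proof (induction k)
    case 0
    show ?case using path_component_translate[OF assms(1), of "- \<nu>"] inv(2) by simp
  next
    case (Suc k)
    show ?case using path_component_translate[OF Suc, of "- \<nu>"] inv(2) by (simp add: algebra_simps scaleR_2)
  qed
  have xS: "x \<in> S" using assms(1) path_component_mem by blast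
  show ?thesis
  proof (induction k)
    case (Suc k)
    then show ?case using up[of k] down[of k] path_component_trans by blast
  qed (use xS in \<open>simp add: path_component_refl_eq\<close>)
qed

text \<open>On \<open>periods\<close> this is, up to the factor \<open>(2 * pi)^2\<close>, the
  algebraic intersection number of the corresponding classes of loops.\<close>

definition det2 :: "real \<times> real \<Rightarrow> real \<times> real \<Rightarrow> real" where
  "det2 x y = fst x * snd y - snd x * fst y"

lemma bounded_linear_det2: "bounded_linear (\<lambda>x. det2 x y)" "bounded_linear (det2 x)"
  unfolding det2_def
  by (intro bounded_linear_sub bounded_linear_mult_const bounded_linear_const_mult
      bounded_linear_fst bounded_linear_snd bounded_linear_ident)+

lemma det2_add: "det2 (x + y) z = det2 x z + det2 y z" "det2 z (x + y) = det2 z x + det2 z y"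
  by (simp_all add: det2_def algebra_simps)

lemma det2_scale: "det2 (r *\<^sub>R x) z = r * det2 x z" "det2 z (r *\<^sub>R x) = r * det2 z x"
  by (simp_all add: det2_def algebra_simps)

lemma det2_self: "det2 x x = 0"
  by (simp add: det2_def)

lemma det2_diff: "det2 (x - y) z = det2 x z - det2 y z" "det2 z (x - y) = det2 z x - det2 z y"
  by (simp_all add: det2_def algebra_simps)

lemma continuous_det2: "continuous_on A (\<lambda>x. det2 x y)" "continuous_on A (det2 y)"
  by (rule linear_continuous_on, rule bounded_linear_det2)+

text \<open>Translates of the lifted loop by multiples of \<open>\<nu>\<close> are concatenated. The
  function \<open>det2 \<nu>\<close> is invariant under these translations and so stays bounded,
  while \<open>det2 z \<mu> / det2 \<nu> \<mu>\<close> grows by 1 with each of them.\<close>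

lemma long_path:
  assumes pc: "path_component (torus_cover -` X) x (x + \<nu>)" and \<nu>: "\<nu> \<in> periods"
    and d: "det2 \<nu> \<mu> \<noteq> 0"
  obtains R where "R \<ge> 0"
    "\<And>M. \<exists>q. path q \<and> path_image q \<subseteq> torus_cover -` X \<and> (\<forall>z\<in>path_image q. \<bar>det2 \<nu> z\<bar> \<le> R) \<and>
      det2 (pathstart q) \<mu> / det2 \<nu> \<mu> \<le> - M \<and> M \<le> det2 (pathfinish q) \<mu> / det2 \<nu> \<mu>"
proof -
  obtain g where g: "path g" "path_image g \<subseteq> torus_cover -` X" "pathstart g = x" "pathfinish g = x + \<nu>"
    using pc unfolding path_component_def by blast
  have "compact (det2 \<nu> ` path_image g)"
    by (rule compact_continuous_image[OF continuous_det2(2) compact_path_image[OF g(1)]])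
  then have "bounded (det2 \<nu> ` path_image g)" by (rule compact_imp_bounded)
  then obtain R where R: "\<And>z. z \<in> path_image g \<Longrightarrow> \<bar>det2 \<nu> z\<bar> \<le> R"
    unfolding bounded_iff by (metis imageI real_norm_def)
  have R0: "R \<ge> 0" using R[OF pathstart_in_path_image] abs_ge_zero order_trans by blast
  define S where "S = torus_cover -` X \<inter> {z. \<bar>det2 \<nu> z\<bar> \<le> R}"
  have gS: "path_image g \<subseteq> S" using g(2) R by (auto simp: S_def)
  have pS: "path_component S x (x + \<nu>)" unfolding path_component_def using g gS by blast
  have inv: "z + \<nu> \<in> S" "z - \<nu> \<in> S" if "z \<in> S" for z
    using that torus_cover_shift[OF \<nu>, of z] torus_cover_shift[OF periods_uminus[OF \<nu>], of z]
    by (simp_all add: S_def det2_add det2_diff det2_self)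
  show thesis
  proof (rule that[OF R0])
    fix M :: real
    obtain k :: nat where k: "M + \<bar>det2 x \<mu> / det2 \<nu> \<mu>\<bar> \<le> of_nat k" using real_arch_simple by blast
    have "path_component S (x - of_nat k *\<^sub>R \<nu>) (x + of_nat k *\<^sub>R \<nu>)"
      by (rule path_component_multiple[OF pS inv])
    then obtain q where q: "path q" "path_image q \<subseteq> S" "pathstart q = x - of_nat k *\<^sub>R \<nu>"
      "pathfinish q = x + of_nat k *\<^sub>R \<nu>"
      unfolding path_component_def by blast
    have "det2 (pathstart q) \<mu> / det2 \<nu> \<mu> = det2 x \<mu> / det2 \<nu> \<mu> - of_nat k"
      "det2 (pathfinish q) \<mu> / det2 \<nu> \<mu> = det2 x \<mu> / det2 \<nu> \<mu> + of_nat k"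
      using d by (simp_all add: q det2_add det2_diff det2_scale field_simps)
    then have "det2 (pathstart q) \<mu> / det2 \<nu> \<mu> \<le> - M" "M \<le> det2 (pathfinish q) \<mu> / det2 \<nu> \<mu>"
      using k by linarith+
    moreover have "path_image q \<subseteq> torus_cover -` X" "\<forall>z\<in>path_image q. \<bar>det2 \<nu> z\<bar> \<le> R"
      using q(2) by (auto simp: S_def)
    ultimately show "\<exists>q. path q \<and> path_image q \<subseteq> torus_cover -` X \<and> (\<forall>z\<in>path_image q. \<bar>det2 \<nu> z\<bar> \<le> R) \<and>
      det2 (pathstart q) \<mu> / det2 \<nu> \<mu> \<le> - M \<and> M \<le> det2 (pathfinish q) \<mu> / det2 \<nu> \<mu>"
      using q(1) by blast
  qed
qed

text \<open>In coordinates dual to \<open>\<nu>\<close> and \<open>\<mu>\<close> the lifts of the two loops are a roughly horizontal and a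
  roughly vertical line, and the Fashoda theorem applies after clamping to a large square.\<close>

lemma wraps_crossing:
  assumes A: "wraps A \<nu>" and B: "wraps B \<mu>" and d: "det2 \<nu> \<mu> \<noteq> 0"
  shows "A \<inter> B \<noteq> {}"
proof -
  obtain x where x: "\<nu> \<in> periods" "path_component (torus_cover -` A) x (x + \<nu>)"
    using A unfolding wraps_def by blast
  obtain y where y: "\<mu> \<in> periods" "path_component (torus_cover -` B) y (y + \<mu>)"
    using B unfolding wraps_def by blast
  have d': "det2 \<mu> \<nu> = - det2 \<nu> \<mu>" by (simp add: det2_def)
  then have dn: "det2 \<mu> \<nu> \<noteq> 0" using d by simp
  obtain R1 where R1: "R1 \<ge> 0" "\<And>M. \<exists>q. path q \<and> path_image q \<subseteq> torus_cover -` A \<and>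
      (\<forall>z\<in>path_image q. \<bar>det2 \<nu> z\<bar> \<le> R1) \<and>
      det2 (pathstart q) \<mu> / det2 \<nu> \<mu> \<le> - M \<and> M \<le> det2 (pathfinish q) \<mu> / det2 \<nu> \<mu>"
    by (rule long_path[OF x(2,1) d]) blast
  obtain R2 where R2: "R2 \<ge> 0" "\<And>M. \<exists>q. path q \<and> path_image q \<subseteq> torus_cover -` B \<and>
      (\<forall>z\<in>path_image q. \<bar>det2 \<mu> z\<bar> \<le> R2) \<and>
      det2 (pathstart q) \<nu> / det2 \<mu> \<nu> \<le> - M \<and> M \<le> det2 (pathfinish q) \<nu> / det2 \<mu> \<nu>"
    by (rule long_path[OF y(2,1) dn]) blast
  define D where "D = det2 \<nu> \<mu>"
  \<comment> \<open>Coordinates by Cramer's rule: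
    \<open>z = l1 z *\<^sub>R \<nu> + l2 z *\<^sub>R \<mu>\<close>.\<close>
  define l1 where "l1 z = det2 z \<mu> / D" for z
  define l2 where "l2 z = det2 \<nu> z / D" for z
  have l2': "det2 z \<nu> / det2 \<mu> \<nu> = l2 z" for z
  proof -
    have "det2 z \<nu> = - det2 \<nu> z" by (simp add: det2_def)
    then show ?thesis unfolding l2_def d' D_def by (simp only: minus_divide_divide)
  qed
  have l1': "l1 z = det2 \<mu> z / det2 \<mu> \<nu>" for z
  proof -
    have "det2 \<mu> z = - det2 z \<mu>" by (simp add: det2_def)
    then show ?thesis unfolding l1_def d' D_def by (simp only: minus_divide_divide)
  qed
  \<comment> \<open>Larger than both \<open>R1 / \<bar>D\<bar>\<close> and
    \<open>R2 / \<bar>D\<bar>\<close>, so that clamping to the interval from \<open>- M\<close> to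
    \<open>M\<close> changes neither \<open>l2\<close> on the first path nor \<open>l1\<close> on
    the second.\<close>
  define M where "M = (R1 + R2) / \<bar>D\<bar> + 1"
  have D0: "D \<noteq> 0" using d by (simp add: D_def)
  have M: "M > 0" "R1 / \<bar>D\<bar> < M" "R2 / \<bar>D\<bar> < M"
  proof -
    have h: "R1 / \<bar>D\<bar> \<ge> 0" "R2 / \<bar>D\<bar> \<ge> 0" using R1(1) R2(1) by simp_all
    show "M > 0" "R1 / \<bar>D\<bar> < M" "R2 / \<bar>D\<bar> < M"
      unfolding M_def add_divide_distrib using h by linarith+
  qed
  obtain p where p: "path p" "path_image p \<subseteq> torus_cover -` A" "\<forall>z\<in>path_image p. \<bar>det2 \<nu> z\<bar> \<le> R1"
    "l1 (pathstart p) \<le> - M" "M \<le> l1 (pathfinish p)"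
    using R1(2)[of M] unfolding l1_def D_def by blast
  obtain q where q: "path q" "path_image q \<subseteq> torus_cover -` B" "\<forall>z\<in>path_image q. \<bar>det2 \<mu> z\<bar> \<le> R2"
    "l2 (pathstart q) \<le> - M" "M \<le> l2 (pathfinish q)"
    using R2(2)[of M] unfolding l2' by blast
  have bp: "\<bar>l2 z\<bar> < M" if "z \<in> path_image p" for z
  proof -
    have "\<bar>l2 z\<bar> \<le> R1 / \<bar>D\<bar>" using p(3) that by (simp add: l2_def divide_right_mono)
    then show ?thesis using M by simp
  qed
  have bq: "\<bar>l1 z\<bar> < M" if "z \<in> path_image q" for z
  proof -
    have "\<bar>l1 z\<bar> \<le> R2 / \<bar>D\<bar>" using q(3) that by (simp add: l1' d' D_def divide_right_mono)
    then show ?thesis using M by simp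
  qed
  define cl where "cl t = max (- M) (min M t)" for t
  define V2 :: "real \<times> real \<Rightarrow> real^2" where "V2 z = (\<chi> i. if i = 1 then cl (l1 z) else cl (l2 z))" for z
  have contV: "continuous_on S V2" for S
    unfolding V2_def
  proof (rule continuous_on_vec_lambda)
    fix i :: 2
    have "continuous_on S (\<lambda>z. cl (l1 z))" "continuous_on S (\<lambda>z. cl (l2 z))"
      unfolding cl_def l1_def l2_def using D0
      by (intro continuous_intros continuous_det2 continuous_on_max continuous_on_min; simp)+
    then show "continuous_on S (\<lambda>z. if i = 1 then cl (l1 z) else cl (l2 z))" by (cases "i = 1") auto
  qed
  let ?a = "(\<chi> i. - M) :: real^2" and ?b = "(\<chi> i. M) :: real^2"
  have box: "V2 z \<in> cbox ?a ?b" for z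
    unfolding mem_box_cart V2_def cl_def using M(1) by auto
  obtain z0 where z0: "z0 \<in> path_image (V2 \<circ> p)" "z0 \<in> path_image (V2 \<circ> q)"
  proof (rule fashoda[of "V2 \<circ> p" "V2 \<circ> q" ?a ?b])
    show "path (V2 \<circ> p)" "path (V2 \<circ> q)" using p(1) q(1) contV by (intro path_continuous_image; blast)+
    show "path_image (V2 \<circ> p) \<subseteq> cbox ?a ?b" "path_image (V2 \<circ> q) \<subseteq> cbox ?a ?b"
      unfolding path_image_compose by (rule image_subsetI, rule box)+
    show "pathstart (V2 \<circ> p) $ 1 = ?a $ 1" "pathfinish (V2 \<circ> p) $ 1 = ?b $ 1"
      using p(4,5) M(1) by (simp_all add: pathstart_compose pathfinish_compose V2_def cl_def)
    show "pathstart (V2 \<circ> q) $ 2 = ?a $ 2" "pathfinish (V2 \<circ> q) $ 2 = ?b $ 2"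
      using q(4,5) M(1) by (simp_all add: pathstart_compose pathfinish_compose V2_def cl_def)
  qed (rule that)
  obtain a where a: "z0 = V2 a" "a \<in> path_image p" using z0(1) unfolding path_image_compose by (rule imageE)
  obtain b where b: "z0 = V2 b" "b \<in> path_image q" using z0(2) unfolding path_image_compose by (rule imageE)
  have ab: "a \<in> path_image p" "b \<in> path_image q" "V2 a = V2 b" using a b by simp_all
  have "cl (l1 a) = cl (l1 b)" using arg_cong[OF ab(3), of "\<lambda>v :: real^2. v $ 1"] by (simp add: V2_def)
  \<comment> \<open>The clamped values agree and \<open>l1 b\<close> lies strictly inside the
    interval, so \<open>l1 a\<close> has not been clamped either.\<close>
  then have e1: "l1 a = l1 b" using bq[OF ab(2)] by (auto simp: cl_def max_def min_def split: if_splits)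
  have "cl (l2 a) = cl (l2 b)" using arg_cong[OF ab(3), of "\<lambda>v :: real^2. v $ 2"] by (simp add: V2_def)
  then have e2: "l2 a = l2 b" using bp[OF ab(1)] by (auto simp: cl_def max_def min_def split: if_splits)
  have rep: "D *\<^sub>R z = det2 z \<mu> *\<^sub>R \<nu> + det2 \<nu> z *\<^sub>R \<mu>" for z
    by (simp add: D_def det2_def prod_eq_iff algebra_simps)
  have "det2 a \<mu> = det2 b \<mu>" "det2 \<nu> a = det2 \<nu> b" using e1 e2 D0 by (simp_all add: l1_def l2_def)
  then have "D *\<^sub>R a = D *\<^sub>R b" using rep[of a] rep[of b] by simp
  then have "a = b" using D0 by simp
  then show ?thesis using ab p(2) q(2) by blast
qed

text \<open>\<open>\<Phi>\<close> is a primitive of the class \<open>L\<close> over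
  \<open>X\<close>: a point that can be joined to \<open>x0 + \<nu>\<close> over \<open>X\<close>
  receives the value \<open>L \<nu>\<close>. Two choices of \<open>\<nu>\<close> differ by the class
  of a loop in \<open>X\<close>, which \<open>L\<close> kills.\<close>

lemma component_index:
  fixes L :: "real \<times> real \<Rightarrow> real"
  assumes X: "openin (top_of_set torus) X" "connected X"
    and lin: "linear L" and L: "\<And>\<nu>. wraps X \<nu> \<Longrightarrow> L \<nu> = 0"
  obtains \<Phi> where "\<forall>x y. path_component (torus_cover -` X) x y \<longrightarrow> \<Phi> x = \<Phi> y"
    "\<forall>x. \<forall>\<mu>\<in>periods. torus_cover x \<in> X \<longrightarrow> \<Phi> (x + \<mu>) = \<Phi> x + L \<mu>"
proof (cases "X = {}")
  case True
  then have "\<not> path_component (torus_cover -` X) x y" for x y using path_component_mem(1) by blast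
  then show ?thesis using that[of "\<lambda>_. 0"] True by simp
next
  case False
  then obtain z where "z \<in> X" by blast
  moreover have "z \<in> torus" using X(1) openin_imp_subset \<open>z \<in> X\<close> by blast
  ultimately obtain x0 where x0: "torus_cover x0 \<in> X" by (metis torus_coverE)
  let ?P = "torus_cover -` X"
  define Q where "Q x \<nu> \<longleftrightarrow> \<nu> \<in> periods \<and> path_component ?P x (x0 + \<nu>)" for x \<nu>
  define \<Phi> where "\<Phi> x = L (SOME \<nu>. Q x \<nu>)" for x
  have ex: "\<exists>\<nu>. Q x \<nu>" if x: "torus_cover x \<in> X" for x
    using path_component_transitive_cover[OF X x x0] unfolding Q_def by metis
  have uniq: "L \<nu> = L \<nu>'" if "Q x \<nu>" "Q x \<nu>'" for x \<nu> \<nu>'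
  proof -
    have "path_component ?P (x0 + \<nu>) (x0 + \<nu>')"
      using that path_component_sym path_component_trans unfolding Q_def by blast
    then have "path_component ?P (x0 + \<nu>) ((x0 + \<nu>) + (\<nu>' - \<nu>))" by simp
    moreover have "\<nu>' - \<nu> \<in> periods" using that periods_diff unfolding Q_def by blast
    ultimately have "wraps X (\<nu>' - \<nu>)" unfolding wraps_def by blast
    then have "L (\<nu>' - \<nu>) = 0" by (rule L)
    then show ?thesis using linear_diff[OF lin] by simp
  qed
  have \<Phi>: "\<Phi> x = L \<nu>" if "Q x \<nu>" for x \<nu>
    unfolding \<Phi>_def by (rule uniq[OF someI[of "Q x", OF that] that])
  show ?thesis
  proof (rule that[of \<Phi>]; intro allI ballI impI)
    fix x y assume xy: "path_component ?P x y"
    then have "torus_cover x \<in> X" using path_component_mem(1) by blast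
    then obtain \<nu> where \<nu>: "Q x \<nu>" using ex by blast
    then have "Q y \<nu>" using xy path_component_sym path_component_trans unfolding Q_def by blast
    then show "\<Phi> x = \<Phi> y" using \<Phi> \<nu> by metis
  next
    fix x \<mu> assume \<mu>: "\<mu> \<in> periods" and x: "torus_cover x \<in> X"
    obtain \<nu> where \<nu>: "Q x \<nu>" using ex[OF x] by blast
    then have "path_component ?P (x + \<mu>) ((x0 + \<nu>) + \<mu>)"
      using path_component_shift \<mu> unfolding Q_def by blast
    then have "Q (x + \<mu>) (\<nu> + \<mu>)" using \<nu> \<mu> periods_add unfolding Q_def by (simp add: add.assoc)
    then show "\<Phi> (x + \<mu>) = \<Phi> x + L \<mu>" using \<Phi>[OF \<nu>] \<Phi> linear_add[OF lin] by metis
  qed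
qed

lemma index_constant:
  fixes S Y :: "(real \<times> real) set"
  assumes "\<And>x y. path_component S x y \<Longrightarrow> \<Phi> x = \<Phi> y" "open Y" "connected Y" "Y \<subseteq> S" "a \<in> Y" "b \<in> Y"
  shows "\<Phi> a = (\<Phi> b :: real)"
proof -
  have "path_component Y a b"
    using connected_open_path_connected[OF assms(2,3)] assms(5,6) path_connected_component by blast
  then have "path_component S a b" using assms(4) path_component_of_subset by blast
  then show ?thesis by (rule assms(1))
qed

text \<open>The indices of the two sides are glued across \<open>C\<close>: their jump is a continuous function on \<open>C\<close>,
  hence constant, so that they combine to a locally constant function on the plane.\<close>

lemma no_functional_kills_both_sides:
  fixes L :: "real \<times> real \<Rightarrow> real"
  assumes A: "openin (top_of_set torus) A" "connected A" "A \<noteq> {}"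
    and B: "openin (top_of_set torus) B" "connected B"
    and C: "connected C" and cover: "A \<union> B \<union> C = torus"
    and dis: "A \<inter> B = {}"
    and cl: "\<And>z. torus_cover z \<in> C \<Longrightarrow> z \<in> closure (torus_cover -` A) \<and> z \<in> closure (torus_cover -` B)"
    and loc: "\<And>z. torus_cover z \<in> C \<Longrightarrow> \<exists>G. open G \<and> z \<in> G \<and> connected (G \<inter> torus_cover -` A) \<and>
      connected (G \<inter> torus_cover -` B)"
    and lin: "linear L" and LA: "\<And>\<nu>. wraps A \<nu> \<Longrightarrow> L \<nu> = 0" and LB: "\<And>\<nu>. wraps B \<nu> \<Longrightarrow> L \<nu> = 0"
    and \<mu>: "\<mu> \<in> periods"
  shows "L \<mu> = 0"
proof -
  let ?A = "torus_cover -` A" and ?B = "torus_cover -` B" and ?C = "torus_cover -` C"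
  have op: "open ?A" "open ?B" using A B openin_torus_iff openin_imp_subset by blast+
  obtain \<Phi> where \<Phi>0: "\<forall>x y. path_component ?A x y \<longrightarrow> \<Phi> x = \<Phi> y"
    "\<forall>x. \<forall>\<mu>\<in>periods. torus_cover x \<in> A \<longrightarrow> \<Phi> (x + \<mu>) = \<Phi> x + L \<mu>"
    by (rule component_index[OF A(1,2) lin LA])
  have \<Phi>: "path_component ?A x y \<Longrightarrow> \<Phi> x = \<Phi> y"
    "\<mu> \<in> periods \<Longrightarrow> torus_cover x \<in> A \<Longrightarrow> \<Phi> (x + \<mu>) = \<Phi> x + L \<mu>" for x y \<mu>
    using \<Phi>0 by blast+
  obtain \<Psi> where \<Psi>0: "\<forall>x y. path_component ?B x y \<longrightarrow> \<Psi> x = \<Psi> y"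
    "\<forall>x. \<forall>\<mu>\<in>periods. torus_cover x \<in> B \<longrightarrow> \<Psi> (x + \<mu>) = \<Psi> x + L \<mu>"
    by (rule component_index[OF B lin LB])
  have \<Psi>: "path_component ?B x y \<Longrightarrow> \<Psi> x = \<Psi> y"
    "\<mu> \<in> periods \<Longrightarrow> torus_cover x \<in> B \<Longrightarrow> \<Psi> (x + \<mu>) = \<Psi> x + L \<mu>" for x y \<mu>
    using \<Psi>0 by blast+
  have meet: "\<exists>a. a \<in> G \<and> a \<in> ?A" "\<exists>b. b \<in> G \<and> b \<in> ?B" if "open G" "z \<in> G" "z \<in> ?C" for G z
    using cl[of z] that open_Int_closure_eq_empty[OF that(1)] by blast+
  \<comment> \<open>\<open>J z d\<close> says that near \<open>z\<close> the index over
    \<open>A\<close> exceeds the index over \<open>B\<close> by \<open>d\<close>. At a point over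
    \<open>C\<close> such a \<open>d\<close> exists because both sides are connected near
    \<open>z\<close>, and it is unique because both accumulate there.\<close>
  define J where "J z d \<longleftrightarrow> (\<exists>G. open G \<and> z \<in> G \<and> (\<forall>a\<in>G \<inter> ?A. \<forall>b\<in>G \<inter> ?B. \<Phi> a - \<Psi> b = d))" for z d
  have exJ: "\<exists>d. J z d" if z: "z \<in> ?C" for z
  proof -
    obtain G where G: "open G" "z \<in> G" "connected (G \<inter> ?A)" "connected (G \<inter> ?B)" using loc z by blast
    obtain a b where ab: "a \<in> G" "a \<in> ?A" "b \<in> G" "b \<in> ?B" using meet[OF G(1,2) z] by blast
    have "\<Phi> a' = \<Phi> a" if "a' \<in> G \<inter> ?A" for a'
      by (rule index_constant[OF \<Phi>(1) open_Int[OF G(1) op(1)] G(3)]) (use that ab in auto)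
    moreover have "\<Psi> b' = \<Psi> b" if "b' \<in> G \<inter> ?B" for b'
      by (rule index_constant[OF \<Psi>(1) open_Int[OF G(1) op(2)] G(4)]) (use that ab in auto)
    ultimately have "\<forall>a'\<in>G \<inter> ?A. \<forall>b'\<in>G \<inter> ?B. \<Phi> a' - \<Psi> b' = \<Phi> a - \<Psi> b" by metis
    then show ?thesis unfolding J_def using G(1,2) by blast
  qed
  have uniqJ: "d = d'" if z: "z \<in> ?C" and "J z d" "J z d'" for z d d'
  proof -
    obtain G where G: "open G" "z \<in> G" "\<forall>a\<in>G \<inter> ?A. \<forall>b\<in>G \<inter> ?B. \<Phi> a - \<Psi> b = d"
      using \<open>J z d\<close> unfolding J_def by blast
    obtain G' where G': "open G'" "z \<in> G'" "\<forall>a\<in>G' \<inter> ?A. \<forall>b\<in>G' \<inter> ?B. \<Phi> a - \<Psi> b = d'"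
      using \<open>J z d'\<close> unfolding J_def by blast
    have "open (G \<inter> G')" "z \<in> G \<inter> G'" using G G' by blast+
    then obtain a b where "a \<in> G \<inter> G'" "a \<in> ?A" "b \<in> G \<inter> G'" "b \<in> ?B" using meet[OF _ _ z] by metis
    then have "\<Phi> a - \<Psi> b = d" "\<Phi> a - \<Psi> b = d'" using G(3) G'(3) by blast+
    then show ?thesis by simp
  qed
  \<comment> \<open>Both indices change by the same amount \<open>L \<nu>\<close> under translation,
    so the jump depends only on the point of \<open>C\<close> below.\<close>
  have shiftJ: "J (z + \<nu>) d" if "J z d" and \<nu>: "\<nu> \<in> periods" for z d \<nu>
  proof -
    obtain G where G: "open G" "z \<in> G" "\<forall>a\<in>G \<inter> ?A. \<forall>b\<in>G \<inter> ?B. \<Phi> a - \<Psi> b = d"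
      using \<open>J z d\<close> unfolding J_def by blast
    let ?G = "(\<lambda>x. x - \<nu>) -` G"
    have "\<Phi> a - \<Psi> b = d" if a: "a \<in> ?G \<inter> ?A" and b: "b \<in> ?G \<inter> ?B" for a b
    proof -
      have m: "torus_cover (x - \<nu>) = torus_cover x" for x
        using torus_cover_shift[OF periods_uminus[OF \<nu>], of x] by simp
      have "a - \<nu> \<in> G \<inter> ?A" "b - \<nu> \<in> G \<inter> ?B" using a b m by auto
      then have "\<Phi> (a - \<nu>) - \<Psi> (b - \<nu>) = d" using G(3) by blast
      moreover have "\<Phi> a = \<Phi> (a - \<nu>) + L \<nu>" "\<Psi> b = \<Psi> (b - \<nu>) + L \<nu>"
        using \<Phi>(2)[OF \<nu>, of "a - \<nu>"] \<Psi>(2)[OF \<nu>, of "b - \<nu>"] m a b by simp_all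
      ultimately show ?thesis by simp
    qed
    moreover have "open ?G" by (intro open_vimage G continuous_intros)
    moreover have "z + \<nu> \<in> ?G" using G(2) by simp
    ultimately show ?thesis unfolding J_def by blast
  qed
  \<comment> \<open>The preimage of \<open>C\<close> may be disconnected. Constancy of the jump is
    therefore derived on \<open>C\<close> itself, by a relation between points of the torus that
    quantifies over all lifts.\<close>
  have jump: "d = d'" if z: "z \<in> ?C" "z' \<in> ?C" "J z d" "J z' d'" for z z' d d'
  proof -
    define Q where "Q c c' \<longleftrightarrow> (\<forall>z z' d d'. torus_cover z = c \<longrightarrow> torus_cover z' = c' \<longrightarrow> J z d \<longrightarrow> J z' d' \<longrightarrow> d = d')"
      for c c'
    have CT: "C \<subseteq> torus" using cover by blast
    have "Q (torus_cover z) (torus_cover z')"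
    proof (rule connected_equivalence_relation[OF C])
      show "torus_cover z \<in> C" "torus_cover z' \<in> C" using z by simp_all
      show "Q y x" if "Q x y" for x y using that unfolding Q_def by metis
      show "Q x w" if Qxy: "Q x y" "Q y w" and yC: "x \<in> C" "y \<in> C" "w \<in> C" for x y w
        unfolding Q_def
      proof (intro allI impI)
        fix p q d e assume pq: "torus_cover p = x" "torus_cover q = w" "J p d" "J q e"
        have "y \<in> torus" using yC(2) CT by blast
        then obtain r where r: "torus_cover r = y" by (rule torus_coverE)
        then obtain h where "J r h" using exJ[of r] yC(2) by auto
        then have "d = h" "h = e" using Qxy pq r unfolding Q_def by blast+
        then show "d = e" by simp
      qed
      fix c assume c: "c \<in> C"
      then have "c \<in> torus" using CT by blast
      then obtain p where p: "torus_cover p = c" by (rule torus_coverE)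
      then obtain d where d: "J p d" using exJ c by blast
      then obtain G where G: "open G" "p \<in> G" "\<forall>a\<in>G \<inter> ?A. \<forall>b\<in>G \<inter> ?B. \<Phi> a - \<Psi> b = d"
        unfolding J_def by blast
      have JG: "J r d" if "r \<in> G" for r unfolding J_def using G that by blast
      have all: "h = d" if r: "torus_cover r \<in> C" "torus_cover r \<in> torus_cover ` G" "J r h" for r h
      proof -
        obtain s where s: "s \<in> G" "torus_cover s = torus_cover r" using r(2) by (metis imageE)
        obtain \<nu> where \<nu>: "\<nu> \<in> periods" "r = s + \<nu>" using torus_cover_eqE[OF s(2)] .
        have "J r d" using shiftJ[OF JG[OF s(1)] \<nu>(1)] \<nu>(2) by simp
        then show ?thesis using uniqJ[of r h d] r(1,3) by simp
      qed
      show "\<exists>S. openin (top_of_set C) S \<and> c \<in> S \<and> (\<forall>x\<in>S. Q c x)"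
      proof (intro exI[of _ "C \<inter> torus_cover ` G"] conjI ballI)
        obtain H where "open H" "torus_cover ` G = torus \<inter> H"
          using open_torus_cover_image[OF G(1)] by (auto simp: openin_open)
        then have "C \<inter> torus_cover ` G = C \<inter> H" using CT by blast
        then show "openin (top_of_set C) (C \<inter> torus_cover ` G)" using \<open>open H\<close> by auto
        show "c \<in> C \<inter> torus_cover ` G" using c p G(2) by (metis IntI imageI)
        fix x assume x: "x \<in> C \<inter> torus_cover ` G"
        show "Q c x" unfolding Q_def
        proof (intro allI impI)
          fix r s h k assume rs: "torus_cover r = c" "torus_cover s = x" "J r h" "J s k"
          have "h = d" using all[of r h] rs c p G(2) by (metis imageI)
          moreover have "k = d" using all[of s k] rs x by simp
          ultimately show "h = k" by simp
        qed
      qed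
    qed
    then show ?thesis using z(3,4) unfolding Q_def by blast
  qed
  obtain d0 where d0: "\<And>z. z \<in> ?C \<Longrightarrow> J z d0"
  proof (cases "?C = {}")
    case True
    then show thesis using that by blast
  next
    case False
    then obtain z where z: "z \<in> ?C" by blast
    obtain d where d: "J z d" using exJ[OF z] by blast
    have "J z' d" if z': "z' \<in> ?C" for z'
    proof -
      obtain d' where "J z' d'" using exJ[OF z'] by blast
      then show ?thesis using jump[OF z z' d] by simp
    qed
    then show thesis by (rule that)
  qed
  \<comment> \<open>\<open>E r\<close> is the open set where the glued function,
    \<open>\<Phi>\<close> over \<open>A\<close> and \<open>\<Psi> + d0\<close> over
    \<open>B\<close>, is locally equal to \<open>r\<close>. These sets cover the plane and are
    pairwise disjoint, so one of them is the whole plane.\<close>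
  define E where "E r = {z. \<exists>G. open G \<and> z \<in> G \<and> (\<forall>a\<in>G \<inter> ?A. \<Phi> a = r) \<and> (\<forall>b\<in>G \<inter> ?B. \<Psi> b + d0 = r)}" for r
  have opE: "open (E r)" for r
  proof (rule open_subopen[THEN iffD2], rule ballI)
    fix z assume "z \<in> E r"
    then obtain G where G: "open G" "z \<in> G" "\<forall>a\<in>G \<inter> ?A. \<Phi> a = r" "\<forall>b\<in>G \<inter> ?B. \<Psi> b + d0 = r"
      unfolding E_def by blast
    then have "G \<subseteq> E r" unfolding E_def by blast
    then show "\<exists>T. open T \<and> z \<in> T \<and> T \<subseteq> E r" using G(1,2) by blast
  qed
  have trich: "z \<in> ?A \<or> z \<in> ?B \<or> z \<in> ?C" for z using torus_cover_in_torus[of z] cover by blast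
  have exE: "\<exists>r. z \<in> E r" for z
  proof -
    consider "z \<in> ?A" | "z \<in> ?B" | "z \<in> ?C" using trich by blast
    then show ?thesis
    proof cases
      case 1
      obtain e where e: "e > 0" "ball z e \<subseteq> ?A" using op(1) 1 open_contains_ball by blast
      have c1: "\<Phi> a = \<Phi> z" if "a \<in> ball z e" for a
        by (rule index_constant[OF \<Phi>(1) open_ball connected_ball e(2) that centre_in_ball[THEN iffD2, OF e(1)]])
      have c2: "ball z e \<inter> ?B = {}" using e(2) dis by blast
      have "z \<in> E (\<Phi> z)" unfolding E_def
      proof (intro CollectI exI[of _ "ball z e"] conjI ballI)
        show "open (ball z e)" "z \<in> ball z e" using e(1) by simp_all
        show "\<Phi> a = \<Phi> z" if "a \<in> ball z e \<inter> ?A" for a using c1 that by blast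
        show "\<Psi> b + d0 = \<Phi> z" if "b \<in> ball z e \<inter> ?B" for b using c2 that by blast
      qed
      then show ?thesis by blast
    next
      case 2
      obtain e where e: "e > 0" "ball z e \<subseteq> ?B" using op(2) 2 open_contains_ball by blast
      have c1: "\<Psi> a = \<Psi> z" if "a \<in> ball z e" for a
        by (rule index_constant[OF \<Psi>(1) open_ball connected_ball e(2) that centre_in_ball[THEN iffD2, OF e(1)]])
      have c2: "ball z e \<inter> ?A = {}" using e(2) dis by blast
      have "z \<in> E (\<Psi> z + d0)" unfolding E_def
      proof (intro CollectI exI[of _ "ball z e"] conjI ballI)
        show "open (ball z e)" "z \<in> ball z e" using e(1) by simp_all
        show "\<Phi> a = \<Psi> z + d0" if "a \<in> ball z e \<inter> ?A" for a using c2 that by blast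
        show "\<Psi> b + d0 = \<Psi> z + d0" if "b \<in> ball z e \<inter> ?B" for b using c1[of b] that by simp
      qed
      then show ?thesis by blast
    next
      case 3
      obtain G where G: "open G" "z \<in> G" "connected (G \<inter> ?A)" using loc 3 by blast
      obtain H where H: "open H" "z \<in> H" "\<forall>a\<in>H \<inter> ?A. \<forall>b\<in>H \<inter> ?B. \<Phi> a - \<Psi> b = d0"
        using d0[OF 3] unfolding J_def by blast
      have GH: "open (G \<inter> H)" "z \<in> G \<inter> H" using G H by blast+
      obtain a where a: "a \<in> G \<inter> H" "a \<in> ?A" using meet(1)[OF GH 3] by blast
      have "\<Phi> a' = \<Phi> a" if "a' \<in> (G \<inter> H) \<inter> ?A" for a'
        by (rule index_constant[OF \<Phi>(1) open_Int[OF G(1) op(1)] G(3)]) (use that a in auto)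
      moreover have "\<Psi> b + d0 = \<Phi> a" if "b \<in> (G \<inter> H) \<inter> ?B" for b
      proof -
        have "\<Phi> a - \<Psi> b = d0" using H(3) a that by blast
        then show ?thesis by simp
      qed
      ultimately have "z \<in> E (\<Phi> a)" unfolding E_def using GH by blast
      then show ?thesis by blast
    qed
  qed
  have uniqE: "r = r'" if "z \<in> E r" "z \<in> E r'" for z r r'
  proof -
    obtain G where G: "open G" "z \<in> G" "\<forall>a\<in>G \<inter> ?A. \<Phi> a = r" "\<forall>b\<in>G \<inter> ?B. \<Psi> b + d0 = r"
      using \<open>z \<in> E r\<close> unfolding E_def by blast
    obtain H where H: "open H" "z \<in> H" "\<forall>a\<in>H \<inter> ?A. \<Phi> a = r'" "\<forall>b\<in>H \<inter> ?B. \<Psi> b + d0 = r'"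
      using \<open>z \<in> E r'\<close> unfolding E_def by blast
    have GH: "open (G \<inter> H)" "z \<in> G \<inter> H" using G H by blast+
    have "\<exists>a. a \<in> G \<inter> H \<and> (a \<in> ?A \<or> a \<in> ?B)" using trich[of z] GH meet(1)[OF GH] by blast
    then obtain a where a: "a \<in> G" "a \<in> H" "a \<in> ?A \<or> a \<in> ?B" by blast
    from a(3) show ?thesis
    proof
      assume "a \<in> ?A"
      then have "\<Phi> a = r" "\<Phi> a = r'" using G(3) H(3) a(1,2) by blast+
      then show ?thesis by simp
    next
      assume "a \<in> ?B"
      then have "\<Psi> a + d0 = r" "\<Psi> a + d0 = r'" using G(4) H(4) a(1,2) by blast+
      then show ?thesis by simp
    qed
  qed
  have same: "\<exists>r. x \<in> E r \<and> y \<in> E r" for x y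
  proof (rule connected_equivalence_relation[of UNIV x y "\<lambda>x y. \<exists>r. x \<in> E r \<and> y \<in> E r"])
    show "\<exists>r. x \<in> E r \<and> z \<in> E r" if "\<exists>r. x \<in> E r \<and> y \<in> E r" "\<exists>r. y \<in> E r \<and> z \<in> E r" for x y z
      using that uniqE by blast
    show "\<exists>T. openin (top_of_set UNIV) T \<and> a \<in> T \<and> (\<forall>x\<in>T. \<exists>r. a \<in> E r \<and> x \<in> E r)" for a
      using exE[of a] opE by (auto simp: subtopology_UNIV open_openin[symmetric])
  qed (auto simp: connected_UNIV)
  obtain z where z: "z \<in> A" using A(3) by blast
  then have "z \<in> torus" using cover by blast
  then obtain x where x: "torus_cover x = z" by (rule torus_coverE)
  \<comment> \<open>The glued function agrees at \<open>x\<close> and \<open>x + \<mu>\<close>,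
    whereas the index over \<open>A\<close> differs at these points by
    \<open>L \<mu>\<close>.\<close>
  obtain r where "x \<in> E r" "x + \<mu> \<in> E r" using same by blast
  moreover have "\<Phi> y = r" if "y \<in> E r" "torus_cover y \<in> A" for y
    using that unfolding E_def by blast
  ultimately have "\<Phi> x = r" "\<Phi> (x + \<mu>) = r" using x z torus_cover_shift[OF \<mu>, of x] by simp_all
  then show ?thesis using \<Phi>(2)[OF \<mu>, of x] x z by simp
qed

text \<open>If neither side is essential, the functional \<open>fst\<close> vanishes on all classes.
  If \<open>\<nu>\<close> and \<open>\<mu>\<close> are nonzero classes of the two sides, the
  functional is \<open>det2 \<nu>\<close>: crossing kills the classes of \<open>B\<close>, and the
  classes of \<open>A\<close> are, like \<open>\<nu>\<close>, multiples of \<open>\<mu>\<close>.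
  Vanishing on all periods contradicts \<open>fst (period 1 0) = 2 * pi\<close> in the one case and
  \<open>\<nu>\<close> being nonzero in the other.\<close>

lemma sides_essential:
  assumes A: "openin (top_of_set torus) A" "connected A" "A \<noteq> {}"
    and B: "openin (top_of_set torus) B" "connected B"
    and C: "connected C" and cover: "A \<union> B \<union> C = torus"
    and dis: "A \<inter> B = {}"
    and cl: "\<And>z. torus_cover z \<in> C \<Longrightarrow> z \<in> closure (torus_cover -` A) \<and> z \<in> closure (torus_cover -` B)"
    and loc: "\<And>z. torus_cover z \<in> C \<Longrightarrow> \<exists>G. open G \<and> z \<in> G \<and> connected (G \<inter> torus_cover -` A) \<and>
      connected (G \<inter> torus_cover -` B)"
  shows "essential A \<noteq> essential B"
proof -
  note kill = no_functional_kills_both_sides[OF A B C cover dis cl loc]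
  have per: "period 1 0 \<in> periods" "period 0 1 \<in> periods" unfolding periods_def by blast+
  have "essential A \<or> essential B"
  proof (rule ccontr)
    assume "\<not> (essential A \<or> essential B)"
    then have z: "wraps A \<nu> \<Longrightarrow> \<nu> = 0" "wraps B \<nu> \<Longrightarrow> \<nu> = 0" for \<nu> unfolding essential_def by blast+
    have "fst (period 1 0) = (0::real)"
      by (rule kill[OF _ _ linear_fst _ _ per(1)]) (assumption | (drule z, simp))+
    then show False by (simp add: period_def)
  qed
  moreover have "\<not> (essential A \<and> essential B)"
  proof
    assume "essential A \<and> essential B"
    then obtain \<nu> \<mu> where \<nu>: "\<nu> \<noteq> 0" "wraps A \<nu>" and \<mu>: "\<mu> \<noteq> 0" "wraps B \<mu>"
      unfolding essential_def by blast
    have cross: "det2 a b = 0" if "wraps A a" "wraps B b" for a b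
      using wraps_crossing[OF that] dis by blast
    have LA: "det2 \<nu> a = 0" if "wraps A a" for a
    proof -
      have "det2 a \<mu> = 0" "det2 \<nu> \<mu> = 0" using cross that \<nu> \<mu> by blast+
      \<comment> \<open>The vector identity \<open>det2 \<nu> a *\<^sub>R \<mu> = det2 \<nu> \<mu>
        *\<^sub>R a - det2 a \<mu> *\<^sub>R \<nu>\<close>, written in coordinates.\<close>
      moreover have "fst \<mu> * det2 \<nu> a = fst a * det2 \<nu> \<mu> - fst \<nu> * det2 a \<mu>"
        "snd \<mu> * det2 \<nu> a = snd a * det2 \<nu> \<mu> - snd \<nu> * det2 a \<mu>"
        by (simp_all add: det2_def algebra_simps)
      ultimately have "fst \<mu> * det2 \<nu> a = 0" "snd \<mu> * det2 \<nu> a = 0" by simp_all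
      then show ?thesis using \<mu>(1) by (auto simp: prod_eq_iff)
    qed
    have LB: "det2 \<nu> b = 0" if "wraps B b" for b using cross \<nu>(2) that by blast
    have lin: "linear (det2 \<nu>)" using bounded_linear_det2(2) by (rule bounded_linear.linear)
    have "det2 \<nu> (period 1 0) = 0" "det2 \<nu> (period 0 1) = 0"
      by (rule kill[OF _ _ lin LA LB per(1)]; assumption) (rule kill[OF _ _ lin LA LB per(2)]; assumption)
    then have "\<nu> = 0" by (simp add: det2_def period_def prod_eq_iff)
    then show False using \<nu>(1) by simp
  qed
  ultimately show ?thesis by blast
qed

section \<open>Lifts of inessential sets\<close>

text \<open>In the complex plane a connected open set is simply connected if no component of its
  complement is bounded. A bounded component need not be open in the complement, but by the
  Sura-Bura theorem it lies in a compact relatively clopen set \<open>K\<close>, and adding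
  \<open>K\<close> to the open set leaves it open.\<close>

lemma homeomorphic_disc_if_no_compact_piece:
  fixes G :: "(real \<times> real) set"
  assumes G: "open G" "connected G" "G \<noteq> {}"
    and no: "\<And>B. compact B \<Longrightarrow> B \<noteq> {} \<Longrightarrow> B \<inter> G = {} \<Longrightarrow> open (G \<union> B) \<Longrightarrow> False"
  shows "G homeomorphic ball (0 :: real \<times> real) 1"
proof -
  define c where "c x = Complex (fst x) (snd x)" for x :: "real \<times> real"
  define c' where "c' z = (Re z, Im z)" for z
  have cont: "continuous_on S c" "continuous_on S' c'" for S S'
    unfolding c_def c'_def Complex_eq by (intro continuous_intros)+
  have inv: "c' (c x) = x" "c (c' z) = z" for x z by (simp_all add: c_def c'_def)
  have im: "c ` S = c' -` S" for S using inv by (auto simp: image_iff) metis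
  have oG: "open (c ` G)" unfolding im using open_vimage[OF G(1) cont(2)] .
  have cG: "connected (c ` G)" using connected_continuous_image[OF cont(1) G(2)] .
  have "simply_connected (c ` G)"
    unfolding simply_connected_eq_unbounded_complement_components[OF oG]
  proof (intro conjI ballI)
    show "connected (c ` G)" by (rule cG)
    fix C assume C: "C \<in> components (- c ` G)"
    show "\<not> bounded C"
    proof
      assume "bounded C"
      have clG: "closed (- c ` G)" using oG by (rule closed_Compl)
      then have "closed C" using closed_components[OF _ C] by blast
      then have "compact C" using \<open>bounded C\<close> compact_eq_bounded_closed by blast
      obtain K where K: "openin (top_of_set (- c ` G)) K" "compact K" "C \<subseteq> K" "K \<subseteq> UNIV"
        by (rule Sura_Bura_clopen_subset[OF closed_imp_locally_compact[OF clG] C \<open>compact C\<close> open_UNIV subset_UNIV])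
      have KG: "K \<subseteq> - c ` G" using K(1) openin_imp_subset by blast
      obtain H where H: "open H" "K = - c ` G \<inter> H" using K(1) by (auto simp: openin_open)
      have "open (c ` G \<union> K)"
      proof -
        have "c ` G \<union> K = c ` G \<union> H" using H(2) by blast
        then show ?thesis using oG H(1) by auto
      qed
      then have "open (c -` (c ` G \<union> K))" using open_vimage cont(1) by blast
      moreover have "c -` (c ` G \<union> K) = G \<union> c' ` K"
      proof -
        have "c x \<in> c ` G \<longleftrightarrow> x \<in> G" "c x \<in> K \<longleftrightarrow> x \<in> c' ` K" for x
          using inv by (metis imageE imageI)+
        then show ?thesis by blast
      qed
      ultimately have o: "open (G \<union> c' ` K)" by simp
      have "C \<noteq> {}" using in_components_nonempty[OF C] .
      then have ne: "c' ` K \<noteq> {}" using K(3) by blast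
      have "c' ` K \<inter> G = {}"
      proof -
        have "c' z \<notin> G" if "z \<in> K" for z using that KG inv(2) by (metis ComplD imageI subsetD)
        then show ?thesis by blast
      qed
      then show False
        using no[OF compact_continuous_image[OF cont(2) K(2)] ne _ o] by blast
    qed
  qed
  then have "c ` G homeomorphic ball (0::complex) 1"
    using simply_connected_eq_homeomorphic_to_disc[OF oG] G(3) by simp
  moreover have "G homeomorphic c ` G"
    unfolding homeomorphic_def homeomorphism_def
    using cont inv by (intro exI[of _ c] exI[of _ c']) (auto simp: image_comp)
  moreover have "ball (0::complex) 1 homeomorphic (UNIV :: complex set)"
    by (rule homeomorphic_ball_UNIV) simp
  moreover have "(UNIV :: complex set) homeomorphic (UNIV :: (real \<times> real) set)"
    by (simp add: homeomorphic_UNIV_UNIV)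
  moreover have "(UNIV :: (real \<times> real) set) homeomorphic ball (0 :: real \<times> real) 1"
    using homeomorphic_ball_UNIV[of 1 "0 :: real \<times> real"] homeomorphic_sym by fastforce
  ultimately show ?thesis by (meson homeomorphic_trans)
qed

lemma open_compact_empty:
  fixes S :: "(real \<times> real) set"
  assumes "open S" "compact S"
  shows "S = {}"
proof (rule ccontr)
  assume "S \<noteq> {}"
  then have "S = UNIV" using clopen[of S] assms compact_imp_closed by blast
  then have "bounded (UNIV :: (real \<times> real) set)" using assms(2) compact_imp_bounded by blast
  then show False using not_bounded_UNIV by blast
qed

text \<open>If the lift \<open>G\<close> of \<open>U\<close> had a hole, then filling the hole would produce a set whose translates
  form a disjoint open cover of the plane.\<close>

lemma inessential_homeomorphic_disc:
  assumes U: "openin (top_of_set torus) U" "connected U" "U \<noteq> {}" and ine: "\<not> essential U"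
    and L: "connected (torus - U)"
  shows "U homeomorphic ball (0 :: real \<times> real) 1"
proof -
  let ?P = "torus_cover -` U"
  have UT: "U \<subseteq> torus" using U(1) openin_imp_subset by blast
  obtain z0 where z0: "z0 \<in> U" using U(3) by blast
  then have "z0 \<in> torus" using UT by blast
  then obtain x0 where x0: "torus_cover x0 = z0" by (rule torus_coverE)
  have oP: "open ?P" using U(1) openin_torus_iff UT by blast
  define G where "G = path_component_set ?P x0"
  have oG: "open G" unfolding G_def by (rule open_path_component[OF oP])
  have GP: "G \<subseteq> ?P" unfolding G_def by (rule path_component_subset)
  have x0G: "x0 \<in> G" using x0 z0 by (simp add: G_def path_component_refl_eq)
  have conG: "connected G" unfolding G_def
    by (rule path_connected_imp_connected) (rule path_connected_path_component)
  \<comment> \<open>A path in \<open>G\<close> from \<open>x\<close> to \<open>x + \<nu>\<close>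
    with nonzero \<open>\<nu>\<close> would make \<open>U\<close> essential. So \<open>G\<close> is
    disjoint from its proper translates, and the covering is injective on it.\<close>
  have zero: "\<nu> = 0" if "x \<in> G" "x + \<nu> \<in> G" "\<nu> \<in> periods" for x \<nu>
  proof (rule ccontr)
    assume "\<nu> \<noteq> 0"
    have "path_component ?P x (x + \<nu>)"
      using that(1,2) path_component_sym path_component_trans unfolding G_def by blast
    then have "essential U" unfolding essential_def wraps_def using that(3) \<open>\<nu> \<noteq> 0\<close> by blast
    then show False using ine by blast
  qed
  have inj: "inj_on torus_cover G"
  proof (rule inj_onI)
    fix x y assume xy: "x \<in> G" "y \<in> G" "torus_cover x = torus_cover y"
    obtain \<nu> where "\<nu> \<in> periods" "y = x + \<nu>" using torus_cover_eqE[OF xy(3)] .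
    then show "x = y" using zero[of x \<nu>] xy by simp
  qed
  have GU: "torus_cover ` G = U"
  proof
    show "torus_cover ` G \<subseteq> U" using GP by blast
    show "U \<subseteq> torus_cover ` G"
    proof
      fix z assume z: "z \<in> U"
      then have "z \<in> torus" using UT by blast
      then obtain y where y: "torus_cover y = z" by (rule torus_coverE)
      obtain \<nu> where \<nu>: "\<nu> \<in> periods" "path_component ?P x0 (y + \<nu>)"
        by (rule path_component_transitive_cover[OF U(1,2), of x0 y]) (use x0 z0 y z in auto)
      then have "y + \<nu> \<in> G" by (simp add: G_def)
      moreover have "torus_cover (y + \<nu>) = z" using torus_cover_shift[OF \<nu>(1), of y] y by simp
      ultimately show "z \<in> torus_cover ` G" by (metis imageI)
    qed
  qed
  have hom: "G homeomorphic U"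
  proof -
    obtain g where "homeomorphism G U torus_cover g"
    proof (rule homeomorphism_injective_open_map[OF continuous_torus_cover GU inj])
      fix W assume "openin (top_of_set G) W"
      then have W: "open W" "W \<subseteq> G" using openin_open_eq[OF oG] by blast+
      have "torus_cover ` W \<subseteq> U" using W(2) GU by blast
      then show "openin (top_of_set U) (torus_cover ` W)"
        using openin_subset_trans[OF open_torus_cover_image[OF W(1)] _ UT] by blast
    qed
    then show ?thesis unfolding homeomorphic_def by blast
  qed
  have "G homeomorphic ball (0 :: real \<times> real) 1"
  proof (rule homeomorphic_disc_if_no_compact_piece[OF oG conG])
    show "G \<noteq> {}" using x0G by blast
    fix B assume B: "compact B" "B \<noteq> {}" "B \<inter> G = {}" "open (G \<union> B)"
    \<comment> \<open>\<open>B\<close> is relatively clopen in the complement of \<open>G\<close>,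
      so a connected set that avoids \<open>G\<close> lies in \<open>B\<close> or misses it.\<close>
    have inB: "X \<subseteq> B" if X: "connected X" "X \<subseteq> - G" "X \<inter> B \<noteq> {}" for X
    proof -
      have "(G \<union> B) \<inter> - B \<inter> X = {}" "X \<subseteq> (G \<union> B) \<union> - B" using X(2) by blast+
      moreover have "open (- B)" using B(1) compact_imp_closed by blast
      ultimately have "(G \<union> B) \<inter> X = {} \<or> - B \<inter> X = {}" using connectedD[OF X(1) B(4)] by blast
      then show ?thesis using X(3) by blast
    qed
    have ray: "\<exists>t\<ge>0. b + t *\<^sub>R \<nu> \<in> G" if b: "b \<in> B" and \<nu>: "\<nu> \<noteq> 0" for b \<nu>
    proof (rule ccontr)
      assume no: "\<not> (\<exists>t\<ge>0. b + t *\<^sub>R \<nu> \<in> G)"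
      let ?X = "(\<lambda>t. b + t *\<^sub>R \<nu>) ` {0..}"
      have "connected ?X" by (intro connected_continuous_image continuous_intros) simp
      moreover have "?X \<subseteq> - G" using no by auto
      moreover have "b \<in> ?X" by (rule image_eqI[of _ _ 0]) auto
      ultimately have "?X \<subseteq> B" using inB[of ?X] b by blast
      then have "bounded ?X" using B(1) compact_imp_bounded bounded_subset by blast
      then obtain K where K: "\<And>x. x \<in> ?X \<Longrightarrow> norm x \<le> K" unfolding bounded_iff by blast
      have n0: "norm \<nu> > 0" using \<nu> by simp
      define t where "t = (\<bar>K\<bar> + norm b + 1) / norm \<nu>"
      have t: "t \<ge> 0" using n0 by (simp add: t_def)
      then have "norm (b + t *\<^sub>R \<nu>) \<le> K" by (intro K) auto
      moreover have "norm (t *\<^sub>R \<nu>) \<le> norm (b + t *\<^sub>R \<nu>) + norm b"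
        using norm_triangle_ineq4[of "b + t *\<^sub>R \<nu>" b] by simp
      moreover have "norm (t *\<^sub>R \<nu>) = \<bar>K\<bar> + norm b + 1" using t n0 by (simp add: t_def)
      ultimately show False by linarith
    qed
    \<comment> \<open>Otherwise a whole translate of \<open>G\<close> sits in \<open>B\<close>. Take
      the point of \<open>B\<close> farthest in the direction \<open>\<nu>\<close>. The ray from it
      in this direction must hit \<open>G\<close>, as it cannot stay in the bounded set
      \<open>B\<close>; the translate by \<open>\<nu>\<close> of the point hit lies in
      \<open>B\<close> and is farther still.\<close>
    have noshift: "(\<lambda>x. x + \<nu>) ` G \<inter> B = {}" if \<nu>: "\<nu> \<in> periods" "\<nu> \<noteq> 0" for \<nu>
    proof (rule ccontr)
      assume meet: "(\<lambda>x. x + \<nu>) ` G \<inter> B \<noteq> {}"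
      have "connected ((\<lambda>x. x + \<nu>) ` G)"
        using conG by (intro connected_continuous_image continuous_intros)
      moreover have "(\<lambda>x. x + \<nu>) ` G \<subseteq> - G"
      proof (rule image_subsetI)
        show "x + \<nu> \<in> - G" if "x \<in> G" for x using zero[OF that _ \<nu>(1)] \<nu>(2) by blast
      qed
      ultimately have sub: "(\<lambda>x. x + \<nu>) ` G \<subseteq> B" using meet by (rule inB)
      have "continuous_on B (\<lambda>y. y \<bullet> \<nu>)" by (intro continuous_intros)
      then obtain b where b: "b \<in> B" "\<forall>y\<in>B. y \<bullet> \<nu> \<le> b \<bullet> \<nu>"
        using continuous_attains_sup[OF B(1,2)] by blast
      obtain t where t: "t \<ge> 0" "b + t *\<^sub>R \<nu> \<in> G" using ray[OF b(1) \<nu>(2)] by blast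
      then have "b + t *\<^sub>R \<nu> + \<nu> \<in> B" using sub by blast
      then have "(b + t *\<^sub>R \<nu> + \<nu>) \<bullet> \<nu> \<le> b \<bullet> \<nu>" using b(2) by blast
      then have "(t + 1) * (\<nu> \<bullet> \<nu>) \<le> 0" by (simp add: inner_add_left algebra_simps)
      moreover have "(t + 1) * (\<nu> \<bullet> \<nu>) > 0" using t(1) \<nu>(2) by (intro mult_pos_pos) auto
      ultimately show False by linarith
    qed
    have BL: "torus_cover b \<notin> U" if b: "b \<in> B" for b
    proof
      assume "torus_cover b \<in> U"
      then have "torus_cover b \<in> torus_cover ` G" using GU by simp
      then obtain g where g: "torus_cover b = torus_cover g" "g \<in> G" by (rule imageE)
      obtain \<nu> where \<nu>: "\<nu> \<in> periods" "b = g + \<nu>" using torus_cover_eqE[OF g(1)[symmetric]] .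
      have "\<nu> \<noteq> 0" using b g(2) \<nu>(2) B(3) by auto
      then show False using noshift[OF \<nu>(1)] b g(2) \<nu>(2) by blast
    qed
    define X where "X = G \<union> B"
    \<comment> \<open>The image of the hole is compact, and it is open in \<open>torus - U\<close>
      because the covering is open on the filled set \<open>X\<close>; connectedness of
      \<open>torus - U\<close> makes it everything.\<close>
    have qB: "torus_cover ` B = torus - U"
    proof -
      have sub: "torus_cover ` B \<subseteq> torus - U" using BL torus_cover_in_torus by blast
      have "closedin (top_of_set (torus - U)) (torus_cover ` B)"
        using compact_continuous_image[OF continuous_torus_cover B(1)] sub
        by (meson closed_subset compact_imp_closed)
      moreover have "openin (top_of_set (torus - U)) (torus_cover ` B)"
      proof -
        obtain H where H: "open H" "torus_cover ` X = torus \<inter> H"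
          using open_torus_cover_image[of X] B(4) unfolding X_def by (auto simp: openin_open)
        have "torus_cover ` X = U \<union> torus_cover ` B" unfolding X_def image_Un GU ..
        then have e: "torus \<inter> H = U \<union> torus_cover ` B" using H(2) by simp
        have gen: "Y = (S - W) \<inter> H" if "S \<inter> H = W \<union> Y" "Y \<subseteq> S - W" for S W Y
        proof (intro equalityI subsetI)
          show "x \<in> (S - W) \<inter> H" if "x \<in> Y" for x
            using that \<open>S \<inter> H = W \<union> Y\<close> \<open>Y \<subseteq> S - W\<close> by (metis IntD2 IntI UnCI subsetD)
          show "x \<in> Y" if "x \<in> (S - W) \<inter> H" for x
            using that \<open>S \<inter> H = W \<union> Y\<close> by (metis DiffE IntE IntI UnE)
        qed
        have "torus_cover ` B = (torus - U) \<inter> H" by (rule gen[OF e sub])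
        then show ?thesis using H(1) by auto
      qed
      ultimately have "torus_cover ` B = {} \<or> torus_cover ` B = torus - U"
        using L connected_clopen by blast
      then show ?thesis using B(2) by blast
    qed
    \<comment> \<open>Only the holes can overlap. The overlap is thus open as an intersection of
      translates of \<open>X\<close> and compact as an intersection of translates of
      \<open>B\<close>, hence empty.\<close>
    have disj: "X \<inter> (\<lambda>x. x + \<nu>) ` X = {}" if \<nu>: "\<nu> \<in> periods" "\<nu> \<noteq> 0" for \<nu>
    proof -
      have eq: "X \<inter> (\<lambda>x. x + \<nu>) ` X = B \<inter> (\<lambda>x. x + \<nu>) ` B"
      proof -
        have "G \<inter> (\<lambda>x. x + \<nu>) ` G = {}"
        proof (rule ccontr)
          assume "G \<inter> (\<lambda>x. x + \<nu>) ` G \<noteq> {}"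
          then obtain x where "x \<in> G" "x + \<nu> \<in> G" by blast
          then show False using zero[OF _ _ \<nu>(1)] \<nu>(2) by blast
        qed
        moreover have "G \<inter> (\<lambda>x. x + \<nu>) ` B = {}"
        proof (rule ccontr)
          assume "G \<inter> (\<lambda>x. x + \<nu>) ` B \<noteq> {}"
          then obtain b where b: "b \<in> B" "b + \<nu> \<in> G" by blast
          have "b + \<nu> + - \<nu> \<in> (\<lambda>x. x + - \<nu>) ` G" using b(2) by (rule imageI)
          then have "b \<in> (\<lambda>x. x + - \<nu>) ` G" by simp
          moreover have "- \<nu> \<noteq> 0" using \<nu>(2) by simp
          ultimately show False using noshift[OF periods_uminus[OF \<nu>(1)]] b(1) by blast
        qed
        moreover have "B \<inter> (\<lambda>x. x + \<nu>) ` G = {}" using noshift[OF \<nu>] by blast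
        ultimately show ?thesis unfolding X_def image_Un by blast
      qed
      have "open ((\<lambda>x. x + \<nu>) ` X)"
        using open_translation[OF B(4), of \<nu>] by (simp add: X_def add.commute)
      then have o: "open (X \<inter> (\<lambda>x. x + \<nu>) ` X)" using B(4) by (simp add: X_def open_Int)
      have "compact ((\<lambda>x. x + \<nu>) ` B)"
        by (intro compact_continuous_image continuous_intros B(1))
      then have c: "compact (X \<inter> (\<lambda>x. x + \<nu>) ` X)" unfolding eq
        using B(1) compact_Int by blast
      show ?thesis using open_compact_empty[OF o c] .
    qed
    let ?Y = "\<Union>\<nu>\<in>periods - {0}. (\<lambda>x. x + \<nu>) ` X"
    have oX: "open X" using B(4) by (simp add: X_def)
    have oY: "open ?Y"
      using open_translation[OF oX] by (intro open_UN ballI) (simp add: add.commute)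
    have "UNIV \<subseteq> X \<union> ?Y"
    proof
      fix z :: "real \<times> real"
      have "torus_cover z \<in> torus_cover ` X"
        using qB GU torus_cover_in_torus[of z] unfolding X_def image_Un by blast
      then obtain x where x: "torus_cover z = torus_cover x" "x \<in> X" by (rule imageE)
      obtain \<nu> where "\<nu> \<in> periods" "z = x + \<nu>" using torus_cover_eqE[OF x(1)[symmetric]] .
      then show "z \<in> X \<union> ?Y" using x(2) by (cases "\<nu> = 0") auto
    qed
    moreover have "X \<inter> ?Y \<inter> UNIV = {}" using disj by blast
    ultimately have "X \<inter> UNIV = {} \<or> ?Y \<inter> UNIV = {}" using connectedD[OF connected_UNIV oX oY] by blast
    moreover have "x0 \<in> X" using x0G by (simp add: X_def)
    moreover have "x0 + period 1 0 \<in> ?Y"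
    proof -
      have "period 1 0 \<in> periods - {0}"
        unfolding periods_def by (auto simp: period_def zero_prod_def)
      then show ?thesis using \<open>x0 \<in> X\<close> by blast
    qed
    ultimately show False by blast
  qed
  then show ?thesis using hom homeomorphic_sym homeomorphic_trans by blast
qed

section \<open>Uniqueness\<close>

lemma exp_eq_1_imp_constant:
  fixes g :: "'a::topological_space \<Rightarrow> complex"
  assumes "connected S" "continuous_on S g" "\<And>x. x \<in> S \<Longrightarrow> exp (g x) = 1"
  shows "g constant_on S"
proof (rule continuous_discrete_range_constant[OF assms(1,2)])
  fix x assume x: "x \<in> S"
  \<comment> \<open>Distinct values differ by a nonzero multiple of 2 \<pi> i; the bound 1 is merely
    a convenient one.\<close>
  have "1 \<le> norm (g y - g x)" if y: "y \<in> S" "g y \<noteq> g x" for y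
  proof -
    have "exp (g y) = exp (g x)" using assms(3) x y(1) by simp
    then obtain n :: int where n: "g y = g x + of_int (2 * n) * pi * \<i>" using exp_eq by blast
    have "n \<noteq> 0" using n y(2) by auto
    then have "\<bar>real_of_int n\<bar> \<ge> 1" by linarith
    moreover have "norm (g y - g x) = 2 * \<bar>real_of_int n\<bar> * pi" using n by (simp add: norm_mult)
    ultimately have "norm (g y - g x) \<ge> 2 * 1 * pi" by (simp add: mult_left_mono)
    then show ?thesis using pi_gt3 by linarith
  qed
  then show "\<exists>e>0. \<forall>y. y \<in> S \<and> g y \<noteq> g x \<longrightarrow> e \<le> norm (g y - g x)"
    by (intro exI[of _ 1]) simp
qed

text \<open>Along the circle traced by \<open>torus_cover (t, 0)\<close> a logarithm of the first
  coordinate differs from i t by a constant, yet it has to return to its initial value at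
  \<open>t = 2 * pi\<close>.\<close>

lemma no_log_on_torus:
  assumes "continuous_on torus h" "\<And>z. z \<in> torus \<Longrightarrow> exp (h z) = fst z"
  shows False
proof -
  define g where "g t = h (torus_cover (t, 0)) - \<i> * complex_of_real t" for t :: real
  have "continuous_on UNIV (\<lambda>t::real. torus_cover (t, 0))"
    by (rule continuous_on_compose2[OF continuous_torus_cover[of UNIV]]) (auto intro!: continuous_intros)
  then have "continuous_on UNIV (\<lambda>t::real. h (torus_cover (t, 0)))"
    by (rule continuous_on_compose2[OF assms(1)]) (auto simp: torus_cover_in_torus)
  then have cont: "continuous_on UNIV g" unfolding g_def by (intro continuous_intros)
  have "exp (g t) = 1" for t
  proof -
    have "exp (h (torus_cover (t, 0))) = exp (\<i> * complex_of_real t)"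
      using assms(2)[OF torus_cover_in_torus[of "(t, 0)"]] by (simp add: torus_cover_def cis_conv_exp)
    then show ?thesis by (simp add: g_def exp_diff)
  qed
  then have "g constant_on UNIV" by (intro exp_eq_1_imp_constant cont connected_UNIV) auto
  then have "g 0 = g (2 * pi)" unfolding constant_on_def by (metis UNIV_I)
  moreover have "torus_cover (2 * pi, 0) = torus_cover (0, 0)"
    using torus_cover_period[of "(0, 0)" 1 0] by (simp add: period_def)
  ultimately show False by (simp add: g_def)
qed

lemma disc_log:
  assumes "D \<subseteq> torus" "D homeomorphic ball (0 :: real \<times> real) 1"
  obtains g where "continuous_on D g" "\<forall>z\<in>D. exp (g z) = fst z"
proof -
  obtain \<phi> \<psi> where h: "homeomorphism D (ball (0 :: real \<times> real) 1) \<phi> \<psi>"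
    using assms(2) unfolding homeomorphic_def by blast
  have c: "continuous_on (ball 0 1) \<psi>" "continuous_on D \<phi>" "\<phi> ` D = ball 0 1"
    "\<And>z. z \<in> D \<Longrightarrow> \<psi> (\<phi> z) = z" "\<psi> ` ball 0 1 = D"
    using h unfolding homeomorphism_def by blast+
  have nz: "fst z \<noteq> 0" if "z \<in> torus" for z using that by (auto simp: torus_def)
  have cont: "continuous_on (ball 0 1) (\<lambda>x. fst (\<psi> x))" using c(1) by (rule continuous_on_fst)
  obtain l where l: "continuous_on (ball 0 1) l" "\<And>x. x \<in> ball 0 1 \<Longrightarrow> fst (\<psi> x) = exp (l x)"
  proof (rule continuous_logarithm_on_simply_connected[OF cont])
    show "simply_connected (ball (0 :: real \<times> real) 1)" by (simp add: convex_imp_simply_connected)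
    show "locally path_connected (ball (0 :: real \<times> real) 1)"
      by (simp add: open_imp_locally_path_connected)
    show "fst (\<psi> z) \<noteq> 0" if "z \<in> ball 0 1" for z
      using nz[of "\<psi> z"] c(5) assms(1) that by blast
  qed (rule that)
  have "continuous_on D (\<lambda>z. l (\<phi> z))"
    by (rule continuous_on_compose2[OF l(1) c(2)]) (simp add: c(3))
  moreover have "\<forall>z\<in>D. exp (l (\<phi> z)) = fst z"
    using l(2) c(3,4) by (metis imageI)
  ultimately show thesis by (rule that)
qed

text \<open>A bounded component of the complement of \<open>torus - D'\<close> in the disc \<open>D\<close> would be all of \<open>D'\<close>.\<close>

lemma disc_overlap_connected:
  assumes D: "openin (top_of_set torus) D" "D homeomorphic ball (0 :: real \<times> real) 1"
    and D': "openin (top_of_set torus) D'" "connected D'" and cover: "D \<union> D' = torus"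
  shows "connected (D \<inter> D')"
proof -
  have "D homeomorphic (UNIV :: (real \<times> real) set)"
    using D(2) homeomorphic_ball_UNIV[of 1 "0 :: real \<times> real"] homeomorphic_trans by fastforce
  then obtain \<phi> \<psi> where h: "homeomorphism D (UNIV :: (real \<times> real) set) \<phi> \<psi>"
    unfolding homeomorphic_def by blast
  have \<phi>: "continuous_on D \<phi>" "\<phi> ` D = UNIV" "\<And>z. z \<in> D \<Longrightarrow> \<psi> (\<phi> z) = z"
    and \<psi>: "continuous_on UNIV \<psi>" "range \<psi> = D" "\<And>x. \<phi> (\<psi> x) = x"
    using h unfolding homeomorphism_def by blast+
  have DT: "D \<subseteq> torus" "D' \<subseteq> torus" using cover by blast+
  define K where "K = \<phi> ` (torus - D')"
  have sub: "torus - D' \<subseteq> D" using cover by blast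
  have "compact (torus - D')"
    using D'(1) compact_torus by (metis closedin_compact closedin_diff closedin_self)
  then have cK: "compact K" unfolding K_def
    using compact_continuous_image continuous_on_subset[OF \<phi>(1) sub] by blast
  have \<psi>K: "\<psi> x \<in> D' \<longleftrightarrow> x \<notin> K" for x
  proof
    assume "\<psi> x \<in> D'"
    show "x \<notin> K"
    proof
      assume "x \<in> K"
      then obtain z where "z \<in> torus - D'" "x = \<phi> z" unfolding K_def by blast
      then show False using \<phi>(3)[of z] sub \<open>\<psi> x \<in> D'\<close> by auto
    qed
  next
    assume "x \<notin> K"
    show "\<psi> x \<in> D'"
    proof (rule ccontr)
      assume "\<psi> x \<notin> D'"
      then have "\<psi> x \<in> torus - D'" using \<psi>(2) DT by blast
      then have "\<phi> (\<psi> x) \<in> K" unfolding K_def by (rule imageI)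
      then show False using \<psi>(3) \<open>x \<notin> K\<close> by simp
    qed
  qed
  have "connected (- K)"
  proof (rule ccontr)
    assume nc: "\<not> connected (- K)"
    \<comment> \<open>The complement of a compact set in the plane has at most one unbounded
      component, so a disconnected one has a bounded component.\<close>
    have "\<exists>B\<in>components (- K). bounded B"
    proof (rule ccontr)
      assume nb: "\<not> (\<exists>B\<in>components (- K). bounded B)"
      have bK: "bounded (- (- K))" using cK compact_imp_bounded by simp
      have "B = B'" if "B \<in> components (- K)" "B' \<in> components (- K)" for B B'
        using cobounded_unique_unbounded_components[OF bK that(2) _ that(1)] nb that by simp
      note same = this
      have "connected_component_set (- K) x = - K" if x: "x \<in> - K" for x
      proof
        show "- K \<subseteq> connected_component_set (- K) x"
        proof
          fix y assume y: "y \<in> - K"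
          have "connected_component_set (- K) x = connected_component_set (- K) y"
            by (rule same[OF componentsI[OF x] componentsI[OF y]])
          moreover have "y \<in> connected_component_set (- K) y" using y by (simp add: connected_component_refl_eq)
          ultimately show "y \<in> connected_component_set (- K) x" by simp
        qed
      qed (rule connected_component_subset)
      then have "connected (- K)" unfolding connected_iff_eq_connected_component_set by (rule ballI)
      then show False using nc by contradiction
    qed
    then obtain B where B: "B \<in> components (- K)" "bounded B" by blast
    have oK: "open (- K)" using cK compact_imp_closed by blast
    have oB: "open B" using open_components[OF oK B(1)] .
    \<comment> \<open>Limit points of \<open>B\<close> outside \<open>B\<close> lie in
      \<open>K\<close>, so \<open>B \<union> K\<close> is closed and bounded.\<close>
    have "closure B \<inter> - K \<subseteq> B"
    proof -
      have "closedin (top_of_set (- K)) B" using B(1) by (rule closedin_component)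
      then obtain C where "closed C" "B = - K \<inter> C" by (auto simp: closedin_closed)
      then show ?thesis using closure_minimal[of B C] by blast
    qed
    then have BK: "B \<union> K = closure B \<union> K" using closure_subset by blast
    have "closed (B \<union> K)" unfolding BK using cK compact_imp_closed by blast
    moreover have "bounded (B \<union> K)" using B(2) compact_imp_bounded[OF cK] by simp
    ultimately have "compact (B \<union> K)" by (simp add: compact_eq_bounded_closed)
    then have "compact (\<psi> ` (B \<union> K))" by (rule compact_continuous_image[OF continuous_on_subset[OF \<psi>(1) subset_UNIV]])
    then have cl: "closed (\<psi> ` (B \<union> K))" by (rule compact_imp_closed)
    have BmK: "B \<subseteq> - K" using B(1) in_components_subset by blast
    have BD': "\<psi> ` B \<subseteq> D'" using \<psi>K BmK by blast
    have "\<psi> ` B = \<psi> ` (B \<union> K) \<inter> D'"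
    proof (intro equalityI subsetI)
      fix z assume "z \<in> \<psi> ` (B \<union> K) \<inter> D'"
      then obtain x where x: "z = \<psi> x" "x \<in> B \<union> K" "\<psi> x \<in> D'" by auto
      then have "x \<in> B" using \<psi>K[of x] by simp
      then show "z \<in> \<psi> ` B" using x(1) by simp
    qed (use BD' in auto)
    then have "closedin (top_of_set D') (\<psi> ` B)" using cl by (metis closedin_closed inf_commute)
    moreover have "openin (top_of_set D') (\<psi> ` B)"
    proof -
      have "\<psi> ` B = D \<inter> \<phi> -` B"
      proof (intro equalityI subsetI)
        fix z assume "z \<in> \<psi> ` B"
        then obtain x where x: "z = \<psi> x" "x \<in> B" by (rule imageE)
        then show "z \<in> D \<inter> \<phi> -` B" using \<psi>(2,3) by auto
      next
        fix z assume z: "z \<in> D \<inter> \<phi> -` B"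
        then have "z = \<psi> (\<phi> z)" "\<phi> z \<in> B" using \<phi>(3) by simp_all
        then show "z \<in> \<psi> ` B" by (rule image_eqI)
      qed
      moreover have "openin (top_of_set D) (D \<inter> \<phi> -` B)"
        using continuous_openin_preimage_gen[OF \<phi>(1) oB] .
      ultimately have "openin (top_of_set torus) (\<psi> ` B)" using D(1) openin_trans by metis
      then show ?thesis using BD' DT(2) openin_subset_trans by blast
    qed
    ultimately have "\<psi> ` B = {} \<or> \<psi> ` B = D'" using D'(2) connected_clopen by blast
    \<comment> \<open>Then \<open>D\<close> would be the whole compact torus, although it is
      homeomorphic to the plane.\<close>
    then have "D' \<subseteq> D" using in_components_nonempty[OF B(1)] \<psi>(2) by blast
    then have "D = torus" using cover by blast
    then have "compact (\<phi> ` D)" using compact_torus compact_continuous_image[OF \<phi>(1)] by simp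
    then have "bounded (UNIV :: (real \<times> real) set)" using \<phi>(2) compact_imp_bounded by simp
    then show False using not_bounded_UNIV by blast
  qed
  then have "connected (\<psi> ` (- K))"
    by (rule connected_continuous_image[OF continuous_on_subset[OF \<psi>(1) subset_UNIV]])
  moreover have "\<psi> ` (- K) = D \<inter> D'"
  proof (intro equalityI subsetI)
    fix z assume "z \<in> D \<inter> D'"
    then have "\<psi> (\<phi> z) = z" "\<phi> z \<notin> K" using \<phi>(3) \<psi>K[of "\<phi> z"] by auto
    then show "z \<in> \<psi> ` (- K)" by (metis ComplI imageI)
  next
    fix z assume "z \<in> \<psi> ` (- K)"
    then obtain x where x: "z = \<psi> x" "x \<in> - K" by (rule imageE)
    then show "z \<in> D \<inter> D'" using \<psi>K[of x] \<psi>(2) by auto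
  qed
  ultimately show ?thesis by simp
qed

lemma torus_not_two_discs:
  assumes D: "openin (top_of_set torus) D" "D homeomorphic ball (0 :: real \<times> real) 1"
    and D': "openin (top_of_set torus) D'" "D' homeomorphic ball (0 :: real \<times> real) 1"
    and cover: "D \<union> D' = torus"
  shows False
proof -
  have DT: "D \<subseteq> torus" "D' \<subseteq> torus" using cover by blast+
  have "connected D'" using D'(2) connected_ball homeomorphic_connectedness by blast
  then have con: "connected (D \<inter> D')" by (rule disc_overlap_connected[OF D D'(1) _ cover])
  obtain g where g: "continuous_on D g" "\<forall>z\<in>D. exp (g z) = fst z" by (rule disc_log[OF DT(1) D(2)])
  obtain g' where g': "continuous_on D' g'" "\<forall>z\<in>D'. exp (g' z) = fst z" by (rule disc_log[OF DT(2) D'(2)])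
  have nz: "fst z \<noteq> 0" if "z \<in> torus" for z using that by (auto simp: torus_def)
  have "(\<lambda>z. g z - g' z) constant_on D \<inter> D'"
  proof (rule exp_eq_1_imp_constant[OF con])
    show "continuous_on (D \<inter> D') (\<lambda>z. g z - g' z)"
      using continuous_on_subset[OF g(1)] continuous_on_subset[OF g'(1)] by (intro continuous_intros) auto
    show "exp (g z - g' z) = 1" if z: "z \<in> D \<inter> D'" for z
    proof -
      have "exp (g z) = fst z" "exp (g' z) = fst z" "fst z \<noteq> 0" using g(2) g'(2) nz z DT by blast+
      then show ?thesis by (simp add: exp_diff)
    qed
  qed
  then obtain k where k: "\<And>z. z \<in> D \<inter> D' \<Longrightarrow> g z - g' z = k" unfolding constant_on_def by blast
  have "D \<inter> D' \<noteq> {}"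
  proof
    assume e: "D \<inter> D' = {}"
    have ne: "D \<noteq> {}" "D' \<noteq> {}"
      using D(2) D'(2) homeomorphic_empty by fastforce+
    have "torus \<subseteq> D"
      by (rule connected_subset_of_separation[OF connected_torus D(1) D'(1)]) (use cover e ne in auto)
    then show False using e ne DT by blast
  qed
  then obtain p where p: "p \<in> D \<inter> D'" by blast
  have "exp k = exp (g p) / exp (g' p)" using k[OF p] exp_diff by metis
  also have "\<dots> = 1" using g(2) g'(2) p nz[of p] DT by auto
  finally have ek: "exp k = 1" .
  define h where "h z = (if z \<in> D then g z else g' z + k)" for z
  have "continuous_on (D \<union> D') h" unfolding h_def
  proof (rule continuous_on_cases_local_open)
    show "openin (top_of_set (D \<union> D')) D" "openin (top_of_set (D \<union> D')) D'" using D(1) D'(1) cover by simp_all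
    show "continuous_on D' (\<lambda>z. g' z + k)" using g'(1) by (intro continuous_intros)
    show "g z = g' z + k" if "z \<in> D \<and> z \<notin> D \<or> z \<in> D' \<and> z \<in> D" for z using k[of z] that by (simp add: algebra_simps)
  qed (rule g(1))
  moreover have "exp (h z) = fst z" if z: "z \<in> torus" for z
  proof (cases "z \<in> D")
    case True then show ?thesis using g(2) by (simp add: h_def)
  next
    case False
    then have "z \<in> D'" using z cover by blast
    then show ?thesis using False g'(2) ek by (simp add: h_def exp_add)
  qed
  ultimately show False using no_log_on_torus cover by metis
qed

text \<open>Being connected, \<open>w\<close> lies in one disc \<open>D\<close> of the complement of
  \<open>v\<close>, and \<open>v\<close> in one disc \<open>E\<close> of the complement of
  \<open>w\<close>. Any further disc \<open>X\<close> off \<open>v\<close> misses \<open>w\<close>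
  and so lies in one disc off \<open>w\<close>. This disc is \<open>E\<close>, since otherwise
  \<open>X\<close> would be clopen in the torus. So \<open>D\<close> and \<open>E\<close> alone
  cover the torus.\<close>

theorem disc_complement_unique:
  assumes v: "closed v" "connected v" "v \<noteq> {}" "v \<subseteq> torus"
    and w: "closed w" "connected w" "w \<noteq> {}" "w \<subseteq> torus" and vw: "v \<inter> w = {}"
    and dv: "disjoint_union_of_open_discs (torus - v)" and dw: "disjoint_union_of_open_discs (torus - w)"
  shows False
proof -
  have opc: "openin (top_of_set torus) (torus - x)" if "closed x" for x
    using that by (metis Diff_eq openin_open open_Compl)
  obtain \<D> where \<D>: "pairwise disjnt \<D>" "\<Union>\<D> = torus - v"
    "\<And>D. D \<in> \<D> \<Longrightarrow> openin (top_of_set (torus - v)) D \<and> D homeomorphic ball (0 :: real \<times> real) 1"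
    using dv unfolding disjoint_union_of_open_discs_def by blast
  obtain \<E> where \<E>: "pairwise disjnt \<E>" "\<Union>\<E> = torus - w"
    "\<And>D. D \<in> \<E> \<Longrightarrow> openin (top_of_set (torus - w)) D \<and> D homeomorphic ball (0 :: real \<times> real) 1"
    using dw unfolding disjoint_union_of_open_discs_def by blast
  have o\<D>: "openin (top_of_set torus) D" if "D \<in> \<D>" for D
    using \<D>(3)[OF that] opc[OF v(1)] openin_trans by blast
  have o\<E>: "openin (top_of_set torus) D" if "D \<in> \<E>" for D
    using \<E>(3)[OF that] opc[OF w(1)] openin_trans by blast
  have inside: "X \<subseteq> D" if "pairwise disjnt \<F>" "\<And>D. D \<in> \<F> \<Longrightarrow> openin (top_of_set torus) D"
    "connected X" "X \<subseteq> \<Union>\<F>" "D \<in> \<F>" "X \<inter> D \<noteq> {}" for X D and \<F> :: "(complex \<times> complex) set set"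
  proof (rule connected_subset_of_separation[OF that(3) that(2)[OF that(5)]])
    show "openin (top_of_set torus) (\<Union>(\<F> - {D}))" using that(2) by (intro openin_Union) blast
    show "X \<subseteq> D \<union> \<Union>(\<F> - {D})" using that(4) by blast
    show "D \<inter> \<Union>(\<F> - {D}) \<inter> X = {}"
    proof -
      have "D \<inter> E = {}" if "E \<in> \<F> - {D}" for E
        using pairwiseD[OF \<open>pairwise disjnt \<F>\<close> \<open>D \<in> \<F>\<close>, of E] that by (auto simp: disjnt_def)
      then show ?thesis by blast
    qed
    show "D \<inter> X \<noteq> {}" using that(6) by blast
  qed
  obtain x where x: "x \<in> w" using w(3) by blast
  then have "x \<in> \<Union>\<D>" using \<D>(2) w(4) vw by blast
  then obtain D where D: "D \<in> \<D>" "x \<in> D" by blast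
  have "w \<subseteq> \<Union>\<D>" using \<D>(2) w(4) vw by blast
  then have wD: "w \<subseteq> D" using inside[OF \<D>(1) o\<D> w(2) _ D(1)] x D(2) by blast
  obtain y where y: "y \<in> v" using v(3) by blast
  then have "y \<in> \<Union>\<E>" using \<E>(2) v(4) vw by blast
  then obtain E where E: "E \<in> \<E>" "y \<in> E" by blast
  have "v \<subseteq> \<Union>\<E>" using \<E>(2) v(4) vw by blast
  then have vE: "v \<subseteq> E" using inside[OF \<E>(1) o\<E> v(2) _ E(1)] y E(2) by blast
  have "torus \<subseteq> D \<union> E"
  proof
    fix z assume z: "z \<in> torus"
    show "z \<in> D \<union> E"
    proof (cases "z \<in> v \<or> z \<in> D")
      case False
      then have "z \<in> \<Union>\<D>" using z \<D>(2) by blast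
      then obtain X where X: "X \<in> \<D>" "z \<in> X" by blast
      have "X \<noteq> D" using X(2) False by blast
      then have "X \<inter> D = {}" using pairwiseD[OF \<D>(1) X(1) D(1)] by (simp add: disjnt_def)
      then have Xw: "X \<inter> w = {}" using wD by blast
      have XT: "X \<subseteq> torus - v" using X(1) \<D>(2) by blast
      have "X \<inter> E \<noteq> {}"
      proof
        assume e: "X \<inter> E = {}"
        have "torus \<subseteq> X"
        proof (rule connected_subset_of_separation[OF connected_torus o\<D>[OF X(1)]])
          show "openin (top_of_set torus) (\<Union>(\<D> - {X}) \<union> E)"
            using o\<D> o\<E>[OF E(1)] by (intro openin_Un openin_Union) auto
          show "torus \<subseteq> X \<union> (\<Union>(\<D> - {X}) \<union> E)"
          proof
            fix t assume "t \<in> torus"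
            then have "t \<in> v \<or> t \<in> \<Union>\<D>" using \<D>(2) by blast
            then show "t \<in> X \<union> (\<Union>(\<D> - {X}) \<union> E)" using vE by blast
          qed
          have "X \<inter> Y = {}" if "Y \<in> \<D> - {X}" for Y
            using pairwiseD[OF \<D>(1) X(1), of Y] that by (auto simp: disjnt_def)
          then show "X \<inter> (\<Union>(\<D> - {X}) \<union> E) \<inter> torus = {}" using e by blast
          show "X \<inter> torus \<noteq> {}" using X(2) z by blast
        qed
        then show False using XT y v(4) by blast
      qed
      moreover have "connected X"
        using \<D>(3)[OF X(1)] connected_ball homeomorphic_connectedness by blast
      moreover have "X \<subseteq> \<Union>\<E>" using \<E>(2) XT Xw by blast
      ultimately have "X \<subseteq> E" using inside[OF \<E>(1) o\<E> _ _ E(1)] by blast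
      then show ?thesis using X(2) by blast
    qed (use vE in blast)
  qed
  moreover have "D \<subseteq> torus" "E \<subseteq> torus" using D(1) E(1) \<D>(2) \<E>(2) by blast+
  ultimately have "D \<union> E = torus" by blast
  then show False
    using torus_not_two_discs[OF o\<D>[OF D(1)] _ o\<E>[OF E(1)]] \<D>(3)[OF D(1)] \<E>(3)[OF E(1)] by blast
qed

section \<open>The graph of a function of class \<open>\<F>\<close>\<close>

lemma open_image_noncritical:
  fixes F :: "real \<times> real \<Rightarrow> real"
  assumes F: "smooth_on UNIV F" and U: "open U" "\<And>x. x \<in> U \<Longrightarrow> \<not> (F has_derivative (\<lambda>_. 0)) (at x)"
  shows "open (F ` U)"
proof (rule open_subopen[THEN iffD2], rule ballI)
  fix t assume "t \<in> F ` U"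
  then obtain x where x: "t = F x" "x \<in> U" by (rule imageE)
  obtain B d where "open B" "x \<in> B" "B \<subseteq> U" "0 < d" "F ` B = {F x - d<..<F x + d}"
    by (rule noncritical_box[OF F U(2)[OF x(2)] U(1) x(2)])
  then show "\<exists>T. open T \<and> t \<in> T \<and> T \<subseteq> F ` U"
    using x(1) by (intro exI[of _ "F ` B"] conjI image_mono) auto
qed

lemma locally_connected_torus: "locally connected torus"
  unfolding torus_def
  by (rule locally_Times[OF locally_connected_sphere locally_connected_sphere]) (simp add: connected_Times)

lemma continuous_on_torus:
  assumes "continuous_on UNIV (f \<circ> torus_cover)"
  shows "continuous_on torus f"
  unfolding continuous_openin_preimage_eq
proof (intro allI impI)
  fix G :: "'a set" assume "open G"
  then have "open ((f \<circ> torus_cover) -` G)" using open_vimage[OF _ assms] by blast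
  moreover have "torus_cover -` (torus \<inter> f -` G) = (f \<circ> torus_cover) -` G"
    using torus_cover_in_torus by auto
  ultimately show "openin (top_of_set torus) (torus \<inter> f -` G)"
    using openin_torus_iff[of "torus \<inter> f -` G"] by simp
qed

lemma class_F_smooth: "f \<in> class_F \<Longrightarrow> smooth_on UNIV (f \<circ> torus_cover)"
  by (simp add: class_F_def)

lemma finite_reeb_vertices:
  assumes "f \<in> class_F"
  shows "finite (reeb_vertices f)"
proof -
  have "reeb_vertices f \<subseteq> reeb_proj f ` {z. critical_point f z}"
  proof
    fix K assume "K \<in> reeb_vertices f"
    then obtain z x where z: "x \<in> torus" "K = reeb_proj f x" "z \<in> K" "critical_point f z"
      unfolding reeb_vertices_def reeb_proj_image[symmetric] by blast
    have zx: "connected_component {w \<in> torus. f w = f x} x z" using z(2,3) by (simp add: reeb_proj_def)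
    then have "f z = f x" using connected_component_in by fastforce
    then have "reeb_proj f z = K"
      using connected_component_eq[of z "{w \<in> torus. f w = f x}" x] zx z(2) by (simp add: reeb_proj_def)
    then show "K \<in> reeb_proj f ` {z. critical_point f z}" using z(4) by blast
  qed
  then show ?thesis using finite_critical_points[OF assms] finite_subset by blast
qed

text \<open>Boxes are constructed in the plane and pushed down. The covering may fail to be
  injective on \<open>B\<close>, but the slices of the image are the images of the slices and hence
  connected.\<close>

lemma level_structure_torus:
  assumes f: "f \<in> class_F"
  shows "level_structure torus f (reeb_vertices f)"
proof
  let ?F = "f \<circ> torus_cover"
  have F: "smooth_on UNIV ?F" by (rule class_F_smooth[OF f])
  show "compact torus" "connected torus" "locally connected torus" "finite (reeb_vertices f)"
    by (rule compact_torus connected_torus locally_connected_torus finite_reeb_vertices[OF f])+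
  show "continuous_on torus f" by (rule continuous_on_torus[OF smooth_on_continuous_on[OF F]])
  show "reeb_vertices f \<subseteq> (\<Union>t. components {z \<in> torus. f z = t})"
    unfolding reeb_vertices_def level_components_def by blast
  fix z U assume z: "z \<in> torus - \<Union>(reeb_vertices f)" and U: "openin (top_of_set torus) U" "z \<in> U"
  obtain x where x: "torus_cover x = z" by (rule torus_coverE[of z]) (use z in auto)
  have nc: "\<not> (?F has_derivative (\<lambda>_. 0)) (at x)"
  proof
    assume "(?F has_derivative (\<lambda>_. 0)) (at x)"
    then have "critical_point f z" unfolding critical_point_def using x by blast
    moreover have "reeb_proj f z \<in> level_components f" using z reeb_proj_image by blast
    moreover have "z \<in> reeb_proj f z" using z by (simp add: reeb_proj_def connected_component_refl_eq)
    ultimately have "reeb_proj f z \<in> reeb_vertices f" unfolding reeb_vertices_def by blast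
    then show False using z \<open>z \<in> reeb_proj f z\<close> by blast
  qed
  have "open (torus_cover -` U)" "x \<in> torus_cover -` U"
    using U openin_torus_iff openin_imp_subset x by blast+
  then obtain B d where B: "open B" "x \<in> B" "B \<subseteq> torus_cover -` U" "0 < d" "?F ` B = {?F x - d<..<?F x + d}"
    "\<forall>t. connected (B \<inter> ?F -` {t})"
    by (rule noncritical_box[OF F nc])
  have "connected (torus_cover ` B \<inter> f -` {t})" for t
  proof -
    have "torus_cover ` B \<inter> f -` {t} = torus_cover ` (B \<inter> ?F -` {t})" by auto
    then show ?thesis using connected_continuous_image[OF continuous_torus_cover spec[OF B(6)]] by simp
  qed
  moreover have "f ` (torus_cover ` B) = {f z - d<..<f z + d}" using B(5) x by (simp add: image_comp)
  moreover have "z \<in> torus_cover ` B" using B(2) x by blast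
  moreover have "torus_cover ` B \<subseteq> U" using B(3) by blast
  ultimately show "\<exists>B d. openin (top_of_set torus) B \<and> z \<in> B \<and> B \<subseteq> U \<and> 0 < d \<and>
      f ` B = {f z - d<..<f z + d} \<and> (\<forall>t. connected (B \<inter> f -` {t}))"
    using open_torus_cover_image[OF B(1)] B(4) by blast
qed

section \<open>Instantiating the abstract setting\<close>

locale class_F_torus =
  fixes f :: "complex \<times> complex \<Rightarrow> real"
  assumes f: "f \<in> class_F"

sublocale class_F_torus \<subseteq> level_structure torus f "reeb_vertices f"
  by (rule level_structure_torus[OF f])

context class_F_torus begin

lemma lev_reeb_proj: "lev = reeb_proj f"
  by (intro ext) (simp add: lev_def reeb_proj_def)

lemma reeb_edges_eq: "reeb_edges f = (\<lambda>W. reeb_proj f ` W) ` components R"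
  by (simp add: reeb_edges_def R_def)

lemma reeb_proj_in_edge:
  assumes W: "W \<in> components R" and z: "z \<in> torus" "reeb_proj f z \<in> reeb_proj f ` W"
  shows "z \<in> W"
proof -
  obtain z' where z': "reeb_proj f z = reeb_proj f z'" "z' \<in> W" using z(2) by (rule imageE)
  have "z \<in> lev z" using z(1) by (rule lev_refl)
  then have "z \<in> lev z'" using z'(1) lev_reeb_proj by simp
  then show ?thesis using tube_lev_subset[OF component_tube[OF W] z'(2)] by blast
qed

text \<open>Closures in the quotient are computed on the torus: the preimage of the edge together
  with \<open>u\<close> and \<open>w\<close> is the closed set
  \<open>closure W \<union> u \<union> w\<close>, and the preimage of a neighbourhood of an end
  meets \<open>W\<close> because the closure of \<open>W\<close> meets that end.\<close>

lemma reeb_joins_ends: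
  assumes W: "W \<in> components R" and e: "ends W u w"
  shows "reeb_joins f (reeb_proj f ` W) x y \<longleftrightarrow> {u, w} = {x, y}"
proof -
  let ?e = "reeb_proj f ` W" and ?X = "reeb_topology f"
  have uw: "u \<in> reeb_vertices f" "w \<in> reeb_vertices f" using ends_in_V[OF e] .
  have cW: "closure W \<subseteq> W \<union> u \<union> w" using e by (simp add: ends_def)
  have WT: "W \<subseteq> torus" using component_in_R[OF W] R_subset by blast
  have top: "topspace ?X = level_components f"
    using quotient_imp_surjective_map[OF quotient_map_reeb_proj[of f]] reeb_proj_image[of f] by simp
  have uwL: "u \<in> level_components f" "w \<in> level_components f" using uw by (auto simp: reeb_vertices_def)
  have eL: "?e \<subseteq> level_components f" using WT reeb_proj_image by blast
  have proj_v: "reeb_proj f z = K \<longleftrightarrow> z \<in> K" if "K \<in> reeb_vertices f" "z \<in> torus" for K z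
    using vertex_lev[OF that(1), of z] lev_refl[OF that(2)] lev_reeb_proj by metis
  have "closedin ?X (?e \<union> {u, w})"
    unfolding closedin_def
  proof
    show "?e \<union> {u, w} \<subseteq> topspace ?X" using top uwL eL by blast
    have "{z \<in> torus. reeb_proj f z \<in> level_components f - (?e \<union> {u, w})} = torus - (closure W \<union> u \<union> w)"
    proof (intro equalityI subsetI)
      fix z assume z: "z \<in> {z \<in> torus. reeb_proj f z \<in> level_components f - (?e \<union> {u, w})}"
      then have zT: "z \<in> torus" and n: "reeb_proj f z \<notin> ?e" "reeb_proj f z \<noteq> u" "reeb_proj f z \<noteq> w"
        by blast+
      have "z \<notin> W" using n(1) by blast
      moreover have "z \<notin> u" "z \<notin> w"
        using n(2,3) proj_v[OF uw(1) zT] proj_v[OF uw(2) zT] by blast+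
      ultimately show "z \<in> torus - (closure W \<union> u \<union> w)" using zT cW by blast
    next
      fix z assume z: "z \<in> torus - (closure W \<union> u \<union> w)"
      then have "z \<notin> W" using closure_subset by blast
      then have "reeb_proj f z \<notin> ?e" using reeb_proj_in_edge[OF W] z by blast
      moreover have "reeb_proj f z \<noteq> u" "reeb_proj f z \<noteq> w"
        using proj_v[OF uw(1), of z] proj_v[OF uw(2), of z] z by blast+
      moreover have "reeb_proj f z \<in> level_components f" using z reeb_proj_image by blast
      ultimately show "z \<in> {z \<in> torus. reeb_proj f z \<in> level_components f - (?e \<union> {u, w})}" using z by simp
    qed
    moreover have "openin (top_of_set torus) (torus - (closure W \<union> u \<union> w))"
      using closed_vertex uw by (intro topen_diff topen_T) auto
    ultimately show "openin ?X (topspace ?X - (?e \<union> {u, w}))"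
      unfolding openin_reeb_topology top by auto
  qed
  then have up: "?X closure_of ?e \<subseteq> ?e \<union> {u, w}" by (rule closure_of_minimal[rotated]) blast
  obtain z where z: "z \<in> W" using in_components_nonempty[OF W] by blast
  have "closure W \<inter> K \<noteq> {}" if "K = u \<or> K = w" for K
  proof -
    have "closure (W \<inter> f -` {..<f z}) \<inter> u \<noteq> {}" "closure (W \<inter> f -` {f z<..}) \<inter> w \<noteq> {}"
      using e z by (simp_all add: ends_def)
    moreover have "closure (W \<inter> S) \<subseteq> closure W" for S by (intro closure_mono) blast
    ultimately show ?thesis using that by blast
  qed
  moreover have "K \<in> ?X closure_of ?e" if K: "K \<in> reeb_vertices f" "closure W \<inter> K \<noteq> {}" for K
    unfolding in_closure_of
  proof (intro conjI allI impI)
    show "K \<in> topspace ?X" using K(1) top by (auto simp: reeb_vertices_def)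
    fix G assume G: "K \<in> G \<and> openin ?X G"
    obtain p where p: "p \<in> closure W" "p \<in> K" using K(2) by blast
    have pT: "p \<in> torus" using p(2) vertex_subset_T[OF K(1)] by blast
    have "openin (top_of_set torus) {z \<in> torus. reeb_proj f z \<in> G}"
      using G openin_reeb_topology by blast
    moreover have "p \<in> {z \<in> torus. reeb_proj f z \<in> G}" using pT p(2) proj_v[OF K(1) pT] G by simp
    ultimately have "W \<inter> {z \<in> torus. reeb_proj f z \<in> G} \<noteq> {}" by (rule closure_meets[OF p(1) WT])
    then show "\<exists>y. y \<in> ?e \<and> y \<in> G" by blast
  qed
  ultimately have "u \<in> ?X closure_of ?e" "w \<in> ?X closure_of ?e" using uw by blast+
  moreover have "K \<notin> ?e" if K: "K \<in> reeb_vertices f" for K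
  proof
    assume "K \<in> ?e"
    then obtain z where z: "K = reeb_proj f z" "z \<in> W" by (rule imageE)
    then have "z \<in> torus" using WT by blast
    then have "z \<in> K" using proj_v[OF K, of z] z(1) by simp
    then show False using component_in_R[OF W] z(2) K by (auto simp: R_def)
  qed
  ultimately have "?X closure_of ?e - ?e = {u, w}" using up uw by blast
  then show ?thesis by (simp add: reeb_joins_def)
qed

text \<open>Together with \<open>W\<close> the path would give a cycle. Its endpoints differ because
  \<open>f\<close> has different values on them, and another component of \<open>R\<close> is a
  different edge because an edge determines its preimage.\<close>

lemma tree_acyclic:
  assumes tree: "reeb_graph_is_tree f" and W: "W \<in> components R" and e: "ends W u w"
  shows "(u, w) \<notin> (other_edges W)\<^sup>*"
proof
  assume path: "(u, w) \<in> (other_edges W)\<^sup>*"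
  let ?V = "reeb_vertices f" and ?E = "reeb_edges f" and ?e = "reeb_proj f ` W"
  have uw: "u \<in> ?V" "w \<in> ?V" using ends_in_V[OF e] .
  have "u \<noteq> w"
  proof
    assume "u = w"
    obtain a b where ab: "a < b" "\<forall>x\<in>u. f x = a" "\<forall>x\<in>w. f x = b" using e unfolding ends_def by blast
    obtain x where x: "x \<in> u" using vertex_nonempty[OF uw(1)] by blast
    have "f x = a" "f x = b" using bspec[OF ab(2) x] bspec[OF ab(3), of x] x \<open>u = w\<close> by blast+
    then show False using ab(1) by simp
  qed
  have "other_edges W \<subseteq> {(x, y). x \<in> ?V \<and> y \<in> ?V \<and> (\<exists>e'\<in>?E - {?e}. reeb_joins f e' x y)}"
  proof (rule subrelI)
    fix x y assume "(x, y) \<in> other_edges W"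
    then obtain W' where W': "W' \<in> components R" "W' \<noteq> W" "ends W' x y \<or> ends W' y x"
      unfolding other_edges_def by blast
    have xy: "x \<in> ?V" "y \<in> ?V" using W'(3) ends_in_V by blast+
    have j: "reeb_joins f (reeb_proj f ` W') x y"
      using W'(3) reeb_joins_ends[OF W'(1), of x y x y] reeb_joins_ends[OF W'(1), of y x x y] by blast
    have "reeb_proj f ` W' \<noteq> ?e"
    proof
      assume eq: "reeb_proj f ` W' = ?e"
      obtain z where z: "z \<in> W'" using in_components_nonempty[OF W'(1)] by blast
      then have "z \<in> torus" using component_in_R[OF W'(1)] R_subset by blast
      moreover have "reeb_proj f z \<in> ?e" using z eq by blast
      ultimately have "z \<in> W" by (rule reeb_proj_in_edge[OF W])
      then show False using components_nonoverlap[OF W W'(1)] W'(2) z by blast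
    qed
    then have "reeb_proj f ` W' \<in> ?E - {?e}" using W'(1) by (simp add: reeb_edges_eq)
    then show "(x, y) \<in> {(x, y). x \<in> ?V \<and> y \<in> ?V \<and> (\<exists>e'\<in>?E - {?e}. reeb_joins f e' x y)}"
      using xy j by blast
  qed
  then have p: "(u, w) \<in> {(x, y). x \<in> ?V \<and> y \<in> ?V \<and> (\<exists>e'\<in>?E - {?e}. reeb_joins f e' x y)}\<^sup>*"
    using path rtrancl_mono by blast
  have eE: "?e \<in> ?E" using W by (simp add: reeb_edges_eq)
  have jo: "reeb_joins f ?e w u" using reeb_joins_ends[OF W e] by blast
  have "\<exists>vs es. graph_cycle ?V ?E (reeb_joins f) vs es"
  proof (rule graph_cycle_from_path[OF p uw(1) \<open>u \<noteq> w\<close> eE jo])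
    show "{x, y} = {x', y'}" if "reeb_joins f e x y" "reeb_joins f e x' y'" for e x y x' y'
      using that by (simp add: reeb_joins_def)
  qed
  then show False using tree by (simp add: reeb_graph_is_tree_def graph_tree_def)
qed

lemma noncritical_lift:
  assumes "torus_cover x \<in> R"
  shows "\<not> (f \<circ> torus_cover has_derivative (\<lambda>_. 0)) (at x)"
proof
  assume "(f \<circ> torus_cover has_derivative (\<lambda>_. 0)) (at x)"
  then have "critical_point f (torus_cover x)" unfolding critical_point_def by blast
  moreover have "lev (torus_cover x) \<in> level_components f"
    using imageI[OF torus_cover_in_torus[of x], of "reeb_proj f"] by (simp add: lev_reeb_proj reeb_proj_image)
  moreover have "torus_cover x \<in> lev (torus_cover x)" by (rule lev_refl[OF torus_cover_in_torus])
  ultimately have "lev (torus_cover x) \<in> reeb_vertices f" unfolding reeb_vertices_def by blast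
  then show False using assms \<open>torus_cover x \<in> lev (torus_cover x)\<close> unfolding R_def by blast
qed

text \<open>The planar counterpart of \<open>connected_tube_preimage\<close>, again by openness and
  connected slices. It provides connectedness of the two sides near a point of the level between
  them.\<close>

lemma half_box:
  assumes G: "open G" "G \<subseteq> torus_cover -` R" "\<And>t. connected (G \<inter> (f \<circ> torus_cover) -` {t})"
    "connected ((f \<circ> torus_cover) ` G)" and J: "connected J"
  shows "connected (G \<inter> (f \<circ> torus_cover) -` J)"
proof -
  let ?F = "f \<circ> torus_cover"
  have F: "smooth_on UNIV ?F" by (rule class_F_smooth[OF f])
  have "connected (G \<inter> ?F -` (J \<inter> ?F ` G))"
  proof (rule connected_open_monotone_preimage[OF _ refl])
    show "continuous_on G ?F" using smooth_on_continuous_on[OF F] continuous_on_subset by blast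
    fix C assume "openin (top_of_set G) C"
    then have C: "open C" "C \<subseteq> G" using openin_open_eq[OF G(1)] by blast+
    have "open (?F ` C)"
      by (rule open_image_noncritical[OF F C(1)]) (use noncritical_lift C(2) G(2) in blast)
    moreover have "?F ` C \<subseteq> ?F ` G" using C(2) by (rule image_mono)
    ultimately show "openin (top_of_set (?F ` G)) (?F ` C)" by (meson open_subset)
  next
    show "connected (J \<inter> ?F ` G)"
      using G(4) J by (simp add: is_interval_connected_1 [symmetric] is_interval_Int)
  qed (use G(3) in auto)
  moreover have "G \<inter> ?F -` (J \<inter> ?F ` G) = G \<inter> ?F -` J" by auto
  ultimately show ?thesis by simp
qed

text \<open>Inside the tube \<open>W\<close> the two sides of \<open>lev z\<close> are the parts
  where \<open>f\<close> is below and above \<open>f z\<close>. A box around a lifted point of the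
  level thus contains points over both sides, and its halves are connected; these are the local
  conditions of \<open>sides_essential\<close>.\<close>

lemma essential_sides:
  assumes z: "z \<in> R" and A: "A \<in> components (torus - lev z)" and B: "B \<in> components (torus - lev z)"
    and AB: "A \<noteq> B"
  shows "essential A \<noteq> essential B"
proof -
  let ?F = "f \<circ> torus_cover"
  have F: "smooth_on UNIV ?F" by (rule class_F_smooth[OF f])
  define W where "W = connected_component_set R z"
  have W: "W \<in> components R" "z \<in> W"
    using z by (auto simp: W_def components_def connected_component_refl_eq)
  have tW: "tube W" using component_tube[OF W(1)] .
  have WR: "W \<subseteq> R" using component_in_R[OF W(1)] .
  obtain P Q where PQ: "P \<in> components (torus - lev z)" "Q \<in> components (torus - lev z)"
    "components (torus - lev z) = {P, Q}"
    "W \<inter> f -` {..<f z} \<noteq> {}" "W \<inter> f -` {f z<..} \<noteq> {}"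
    "W \<inter> f -` {..<f z} \<subseteq> P" "W \<inter> f -` {f z<..} \<subseteq> Q"
    by (rule level_sides[OF W])
  have "P \<noteq> Q" using A B AB PQ(3) by auto
  then have dis: "P \<inter> Q = {}" using components_nonoverlap[OF PQ(1,2)] by simp
  have ol: "openin (top_of_set torus) (torus - lev z)" by (rule topen_diff[OF topen_T closed_lev])
  have oPQ: "openin (top_of_set torus) P" "openin (top_of_set torus) Q"
    using topen_components[OF ol] PQ(1,2) by blast+
  have U: "P \<union> Q = torus - lev z" using Union_components[of "torus - lev z"] PQ(3) by simp
  have cover: "P \<union> Q \<union> lev z = torus" unfolding U using lev_subset_T[of z] by blast
  have lz: "y \<in> lev z" if "y \<in> W" "f y = f z" for y
    using tW W(2) that unfolding tube_def by metis
  have WP: "y \<in> P \<longleftrightarrow> f y < f z" "y \<in> Q \<longleftrightarrow> f z < f y" if y: "y \<in> W" for y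
  proof -
    have "f y < f z \<Longrightarrow> y \<in> P" "f z < f y \<Longrightarrow> y \<in> Q" using PQ(6,7) y by auto
    moreover have "f y = f z \<Longrightarrow> y \<notin> P \<and> y \<notin> Q" using lz[OF y] U by blast
    ultimately show "y \<in> P \<longleftrightarrow> f y < f z" "y \<in> Q \<longleftrightarrow> f z < f y" using dis by (meson disjoint_iff linorder_cases)+
  qed
  have oW: "open (torus_cover -` W)"
    using topen_component[OF W(1)] openin_torus_iff openin_imp_subset by blast
  have lift: "torus_cover x \<in> W" "?F x = f z" "\<not> (?F has_derivative (\<lambda>_. 0)) (at x)"
    if "torus_cover x \<in> lev z" for x
  proof -
    show w: "torus_cover x \<in> W" using that tube_lev_subset[OF tW W(2)] by blast
    show "?F x = f z" using f_lev[OF that] by simp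
    show "\<not> (?F has_derivative (\<lambda>_. 0)) (at x)" using noncritical_lift w WR by blast
  qed
  have "essential P \<noteq> essential Q"
  proof (rule sides_essential[OF oPQ(1) _ _ oPQ(2) _ connected_lev cover dis])
    show "connected P" "connected Q" "P \<noteq> {}"
      using PQ(1,2) in_components_connected in_components_nonempty by blast+
  next
    fix x assume x: "torus_cover x \<in> lev z"
    note l = lift[OF x]
    have pt: "\<exists>y\<in>H. y \<in> torus_cover -` P" "\<exists>y\<in>H. y \<in> torus_cover -` Q" if H: "open H" "x \<in> H" for H
    proof -
      have oHW: "open (H \<inter> torus_cover -` W)" "x \<in> H \<inter> torus_cover -` W" using H oW l(1) by auto
      obtain G d where G: "open G" "x \<in> G" "G \<subseteq> H \<inter> torus_cover -` W" "0 < d"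
        "?F ` G = {?F x - d<..<?F x + d}"
        by (rule noncritical_box[OF F l(3) oHW])
      have m: "f z - d/2 \<in> ?F ` G" "f z + d/2 \<in> ?F ` G" unfolding G(5) using G(4) l(2) by simp_all
      from m(1) obtain y1 where y1: "f z - d/2 = ?F y1" "y1 \<in> G" by (rule imageE)
      have "torus_cover y1 \<in> W" "f (torus_cover y1) < f z" using y1 G(3,4) by (blast, simp)
      then have "torus_cover y1 \<in> P" using WP(1) by blast
      then show "\<exists>y\<in>H. y \<in> torus_cover -` P" using y1(2) G(3) by blast
      from m(2) obtain y2 where y2: "f z + d/2 = ?F y2" "y2 \<in> G" by (rule imageE)
      have "torus_cover y2 \<in> W" "f z < f (torus_cover y2)" using y2 G(3,4) by (blast, simp)
      then have "torus_cover y2 \<in> Q" using WP(2) by blast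
      then show "\<exists>y\<in>H. y \<in> torus_cover -` Q" using y2(2) G(3) by blast
    qed
    show "x \<in> closure (torus_cover -` P) \<and> x \<in> closure (torus_cover -` Q)"
      unfolding closure_iff_nhds_not_empty
    proof (intro conjI allI impI)
      fix S H assume H: "x \<in> H" "H \<subseteq> S" "open H"
      show "torus_cover -` P \<inter> S \<noteq> {}" using pt(1)[OF H(3,1)] H(2) by blast
      show "torus_cover -` Q \<inter> S \<noteq> {}" using pt(2)[OF H(3,1)] H(2) by blast
    qed
    have xW: "x \<in> torus_cover -` W" using l(1) by simp
    obtain G d where G: "open G" "x \<in> G" "G \<subseteq> torus_cover -` W" "0 < d"
      "?F ` G = {?F x - d<..<?F x + d}" "\<forall>t. connected (G \<inter> ?F -` {t})"
      by (rule noncritical_box[OF F l(3) oW xW])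
    have GR: "G \<subseteq> torus_cover -` R" using G(3) WR by blast
    have cF: "connected (?F ` G)" unfolding G(5) by simp
    have "G \<inter> torus_cover -` P = G \<inter> ?F -` {..<f z}" "G \<inter> torus_cover -` Q = G \<inter> ?F -` {f z<..}"
      using WP G(3) by auto
    then have "connected (G \<inter> torus_cover -` P)" "connected (G \<inter> torus_cover -` Q)"
      using half_box[OF G(1) GR spec[OF G(6)] cF, of "{..<f z}"] half_box[OF G(1) GR spec[OF G(6)] cF, of "{f z<..}"] by simp_all
    then show "\<exists>G. open G \<and> x \<in> G \<and> connected (G \<inter> torus_cover -` P) \<and> connected (G \<inter> torus_cover -` Q)"
      using G(1,2) by blast
  qed
  moreover have "A = P \<and> B = Q \<or> A = Q \<and> B = P" using A B AB PQ(3) by auto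
  ultimately show ?thesis by blast
qed

lemma level_tree_torus:
  assumes "reeb_graph_is_tree f"
  shows "level_tree torus f (reeb_vertices f) essential"
proof
  note acyc = tree_acyclic[OF assms]
  show "finite (components (torus - \<Union>(reeb_vertices f)))"
    using finite_components_if_acyclic[OF acyc] by (simp add: R_def)
  show "essential B" if "A \<subseteq> B" "essential A" for A B using essential_mono[OF that] .
  show "\<exists>A\<in>\<U>. essential A" if "\<U> \<noteq> {}" "\<And>A. A \<in> \<U> \<Longrightarrow> openin (top_of_set torus) A"
    "\<And>A B. A \<in> \<U> \<Longrightarrow> B \<in> \<U> \<Longrightarrow> A \<subseteq> B \<or> B \<subseteq> A" "essential (\<Union>\<U>)" for \<U>
    by (rule essential_Union[OF that])
  fix z assume "z \<in> torus - \<Union>(reeb_vertices f)"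
  then have z: "z \<in> R" by (simp add: R_def)
  show "\<not> connected (torus - connected_component_set {w \<in> torus. f w = f z} z)"
    using separates_if_acyclic[OF acyc z] unfolding lev_def .
  show "essential A \<noteq> essential B"
    if "A \<in> components (torus - connected_component_set {w \<in> torus. f w = f z} z)"
      "B \<in> components (torus - connected_component_set {w \<in> torus. f w = f z} z)" "A \<noteq> B" for A B
    using essential_sides[OF z, unfolded lev_def, OF that] .
qed

text \<open>Without vertices \<open>f\<close> would be open on the whole torus, and its image would
  be a nonempty open compact set of reals.\<close>

lemma vertices_nonempty: "reeb_vertices f \<noteq> {}"
proof
  assume "reeb_vertices f = {}"
  then have "torus \<subseteq> R" unfolding R_def by simp
  then have "open (f ` torus)" using open_image topen_T by blast
  moreover have "compact (f ` torus)" using compact_continuous_image[OF cont compact_T] .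
  moreover have "f ` torus \<noteq> {}" using torus_cover_in_torus by blast
  ultimately have "f ` torus = UNIV" using clopen[of "f ` torus"] compact_imp_closed by blast
  then have "bounded (UNIV :: real set)" using \<open>compact (f ` torus)\<close> compact_imp_bounded by simp
  then show False using not_bounded_UNIV by blast
qed

text \<open>Every component of the complement accumulates at the connected set \<open>K\<close>, so
  its union with \<open>K\<close> is connected, and the complement of \<open>U\<close> is made up of
  such unions. This is the connectedness that \<open>inessential_homeomorphic_disc\<close> asks
  for.\<close>

lemma complement_component_connected:
  assumes K: "K \<in> reeb_vertices f" and U: "U \<in> components (torus - K)"
  shows "connected (torus - U)"
proof -
  let ?\<C> = "components (torus - K) - {U}"
  have oK: "openin (top_of_set torus) (torus - K)" by (rule topen_diff[OF topen_T closed_vertex[OF K]])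
  have ne: "torus - K \<noteq> torus" using vertex_nonempty[OF K] vertex_subset_T[OF K] by blast
  have con: "connected (K \<union> C)" if C: "C \<in> ?\<C>" for C
  proof -
    have CC: "C \<in> components (torus - K)" using C by simp
    obtain x where x: "x \<in> closure C" "x \<in> torus" "x \<notin> torus - K"
      by (rule open_component_not_closed[OF CC oK ne])
    have "connected (insert x C)"
      by (rule connected_intermediate_closure[OF in_components_connected[OF CC]])
        (use x(1) closure_subset in auto)
    then have "connected (K \<union> insert x C)"
      using connected_Un[OF connected_vertex[OF K]] x(2,3) by blast
    moreover have "K \<union> insert x C = K \<union> C" using x(2,3) by blast
    ultimately show ?thesis by simp
  qed
  have "connected (\<Union>(insert K ((\<lambda>C. K \<union> C) ` ?\<C>)))"
  proof (rule connected_Union)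
    show "connected S" if "S \<in> insert K ((\<lambda>C. K \<union> C) ` ?\<C>)" for S
      using that con connected_vertex[OF K] by blast
    show "\<Inter>(insert K ((\<lambda>C. K \<union> C) ` ?\<C>)) \<noteq> {}" using vertex_nonempty[OF K] by blast
  qed
  moreover have "\<Union>(insert K ((\<lambda>C. K \<union> C) ` ?\<C>)) = torus - U"
  proof (intro equalityI subsetI)
    fix x assume "x \<in> \<Union>(insert K ((\<lambda>C. K \<union> C) ` ?\<C>))"
    then consider "x \<in> K" | C where "C \<in> ?\<C>" "x \<in> C" by blast
    then show "x \<in> torus - U"
    proof cases
      case 1
      then show ?thesis using vertex_subset_T[OF K] in_components_subset[OF U] by blast
    next
      case 2
      then have "C \<inter> U = {}" using components_nonoverlap[of C "torus - K" U] U by simp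
      then show ?thesis using 2 in_components_subset[of C "torus - K"] by blast
    qed
  next
    fix x assume x: "x \<in> torus - U"
    show "x \<in> \<Union>(insert K ((\<lambda>C. K \<union> C) ` ?\<C>))"
    proof (cases "x \<in> K")
      case False
      then have "x \<in> \<Union>(components (torus - K))" using x Union_components[of "torus - K"] by simp
      then obtain C where "C \<in> components (torus - K)" "x \<in> C" by blast
      then show ?thesis using x by blast
    qed simp
  qed
  ultimately show ?thesis by simp
qed

lemma complement_discs:
  assumes K: "K \<in> reeb_vertices f" and ine: "\<forall>U\<in>components (torus - K). \<not> essential U"
  shows "disjoint_union_of_open_discs (torus - K)"
  unfolding disjoint_union_of_open_discs_def
proof (intro exI[of _ "components (torus - K)"] conjI ballI)
  have oK: "openin (top_of_set torus) (torus - K)" by (rule topen_diff[OF topen_T closed_vertex[OF K]])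
  show "pairwise disjnt (components (torus - K))"
    using pairwise_disjoint_components[of "torus - K"] by (simp add: pairwise_def disjnt_def)
  show "\<Union>(components (torus - K)) = torus - K" by (rule Union_components)
  fix U assume U: "U \<in> components (torus - K)"
  have oU: "openin (top_of_set torus) U" using topen_components[OF oK U] .
  show "openin (top_of_set (torus - K)) U"
    using openin_subset_trans[OF oU in_components_subset[OF U]] by blast
  show "U homeomorphic ball (0 :: real \<times> real) 1"
    by (rule inessential_homeomorphic_disc[OF oU in_components_connected[OF U] in_components_nonempty[OF U]
          bspec[OF ine U] complement_component_connected[OF K U]])
qed

lemma reeb_proj_preimage:
  assumes v: "v \<in> reeb_vertices f"
  shows "{z \<in> torus. reeb_proj f z = v} = v"
proof (intro equalityI subsetI)
  fix z assume "z \<in> {z \<in> torus. reeb_proj f z = v}"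
  then show "z \<in> v" using lev_refl[of z] by (simp add: lev_reeb_proj)
next
  fix z assume z: "z \<in> v"
  then have "z \<in> torus" using vertex_subset_T[OF v] by (rule subsetD[rotated])
  moreover have "reeb_proj f z = v" using vertex_lev[OF v z] by (simp add: lev_reeb_proj)
  ultimately show "z \<in> {z \<in> torus. reeb_proj f z = v}" by simp
qed

theorem unique_disc_vertex:
  assumes "reeb_graph_is_tree f"
  shows "\<exists>!v. v \<in> reeb_vertices f \<and>
    disjoint_union_of_open_discs (torus - {z \<in> torus. reeb_proj f z = v})"
proof -
  interpret level_tree torus f "reeb_vertices f" essential by (rule level_tree_torus[OF assms])
  obtain v where v: "v \<in> reeb_vertices f" "\<forall>U\<in>components (torus - v). \<not> essential U"
    using exists_vertex_no_bad[OF vertices_nonempty] by blast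
  show ?thesis
  proof (rule ex1I[of _ v])
    show "v \<in> reeb_vertices f \<and> disjoint_union_of_open_discs (torus - {z \<in> torus. reeb_proj f z = v})"
      using complement_discs[OF v] reeb_proj_preimage[OF v(1)] v(1) by simp
    fix w assume w: "w \<in> reeb_vertices f \<and> disjoint_union_of_open_discs (torus - {z \<in> torus. reeb_proj f z = w})"
    have dw: "disjoint_union_of_open_discs (torus - w)"
      using conjunct2[OF w] unfolding reeb_proj_preimage[OF conjunct1[OF w]] .
    show "w = v"
    proof (rule ccontr)
      assume "w \<noteq> v"
      then have "v \<inter> w = {}" using vertices_disjoint v(1) w by blast
      then show False
        using disc_complement_unique[OF closed_vertex connected_vertex vertex_nonempty vertex_subset_T
            closed_vertex connected_vertex vertex_nonempty vertex_subset_T _ complement_discs dw]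
          v conjunct1[OF w] by blast
    qed
  qed
qed

end

theorem proposition1:
  fixes f :: "complex \<times> complex \<Rightarrow> real"
  assumes "f \<in> class_F"
    and "reeb_graph_is_tree f"
  shows "\<exists>!v. v \<in> reeb_vertices f \<and>
    disjoint_union_of_open_discs (torus - {z \<in> torus. reeb_proj f z = v})"
  using class_F_torus.unique_disc_vertex[OF class_F_torus.intro[OF assms(1)] assms(2)] .

end
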